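(* Let $G$ be a connected simple graph on the vertex set $[n]$ with at least one edge, and let $\mathcal{H}_G$ denote the set of connected induced subgraphs of $G$ with at least one edge. Either let $I_H=\mathrm{gin}(J_H)$ for all $H\in\mathcal{H}_G$, or let $I_H=\mathrm{in}_<(J_H)$ for all $H\in\mathcal{H}_G$ (note $G\in\mathcal{H}_G$). With $i_H:\mathbb{R}^{2|H|}\to\mathbb{R}^{2n}$ the canonical inclusions, the set of vertices of the symbolic polyhedron $\mathrm{SP}(I_G)$ is $$\mathcal{V}(\mathrm{SP}(I_G))=\bigcup_{H\in\mathcal{H}_G} i_H\big(\mathcal{V}_F(\mathrm{SP}(I_H))\big),$$ where $\mathcal{V}_F(\mathrm{SP}(I_H))$ is the set of full vertices. Furthermore, $\widehat{\alpha}(I_G)$ is the smallest sum of coordinates of an element of this union, and $\widehat{\mathrm{reg}}(I_G)$ is the largest sum of coordinates of an element of this union.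
   Context: $\mathbb{K}$ is a field. For a simple graph $H$ with vertex set $V_H\subseteq[n]$ (labels inherited from $[n]$), let $S_H=\mathbb{K}[x_i,y_i\mid i\in V_H]$ and $J_H=(x_iy_j-x_jy_i\mid\{i,j\}\in E(H))\subset S_H$ (binomial edge ideal). $\mathrm{in}_<(J_H)$ is its initial ideal (generated by all leading monomials) for the lexicographic order with $x_1>\dots>x_n>y_1>\dots>y_n$ (restricted to the variables present). $\mathrm{gin}(J_H)$ is the multigraded generic initial ideal (for $\deg x_i=\deg y_i=\mathbf{e}_i$), which by a known theorem is, and may here be taken by definition to be, the ideal $\mathrm{gin}(J_H)=(y_{v_1}\cdots y_{v_s}x_ix_j\mid i,v_1,\dots,v_s,j\text{ a path in }H,\ s\ge 0)$ (paths have distinct vertices). Both are squarefree monomial ideals. Symbolic polyhedron: for a squarefree monomial ideal $I$ in a polynomial ring in $N$ variables with minimal primes $P_M$ generated by the variables with index in $M\subseteq [N]$, $\mathrm{SP}(I)=\{a\in\mathbb{R}^N_{\ge 0}\mid \sum_{j\in M}a_j\ge 1\text{ for all minimal primes }P_M\}$. $\mathcal{V}(\mathrm{SP}(I))$ is its set of vertices (extreme points). In $\mathbb{R}^{2n}$, coordinate $j$ corresponds to $x_j$ and coordinate $n+j$ to $y_j$ for $1\le j\le n$; similarly, coordinates of $\mathbb{R}^{2|H|}$ are indexed by $j$ and $n+j$ for $j\in V_H$. The canonical inclusion $i_H$ keeps the coordinates $j,n+j$ with $j\in V_H$ and puts $0$ in all other coordinates. A vertex $a\in\mathcal{V}(\mathrm{SP}(I_H))$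 is full if $a_j+a_{n+j}\ne 0$ for all $j\in V_H$; $\mathcal{V}_F(\mathrm{SP}(I_H))$ is the set of full vertices. For a squarefree monomial ideal $I$ with minimal primes $P_M$, $I^{(m)}=\bigcap_M P_M^m$; $\widehat{\alpha}(I)=\lim_{m\to\infty}\alpha(I^{(m)})/m$, where $\alpha$ is the least degree of a nonzero element, and $\widehat{\mathrm{reg}}(I)=\lim_{m\to\infty}\mathrm{reg}(I^{(m)})/m$, with $\mathrm{reg}$ the Castelnuovo–Mumford regularity (both limits exist for nonzero monomial ideals). *)

theory Defs
  imports
    "HOL-Analysis.Polytope"
    "HOL-Analysis.Finite_Function_Topology"
    "HOL-Algebra.Ideal_Product"
    "Jordan_Normal_Form.Matrix"
    "Graph_Theory.Digraph_Component"
    "Graph_Theory.Vertex_Walk"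
begin

section \<open>Polynomial rings\<close>

text \<open>
  Variables are indexed by natural numbers: for graphs on vertices in \<open>{1..n}\<close>, index \<open>j\<close> stands
  for \<open>x\<^sub>j\<close> and index \<open>n + j\<close> for \<open>y\<^sub>j\<close>.  The polynomial ring in the variables with index
  in \<open>X\<close> is a ring record whose carrier is a subset of the type of all polynomials.
\<close>

type_synonym 'a mpoly = "(nat \<Rightarrow>\<^sub>0 nat) \<Rightarrow>\<^sub>0 'a"

definition polyring :: "nat set \<Rightarrow> 'a::field mpoly ring"
  where "polyring X =
    \<lparr> carrier = {p. \<forall>m \<in> Poly_Mapping.keys p. Poly_Mapping.keys m \<subseteq> X},
      monoid.mult = (*), one = 1, zero = 0, add = (+) \<rparr>"

definition var :: "nat \<Rightarrow> 'a::field mpoly"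
  where "var k = Poly_Mapping.single (Poly_Mapping.single k 1) 1"

definition mdeg :: "(nat \<Rightarrow>\<^sub>0 nat) \<Rightarrow> nat"
  where "mdeg m = (\<Sum>k \<in> Poly_Mapping.keys m. Poly_Mapping.lookup m k)"

definition tdeg :: "'a::field mpoly \<Rightarrow> nat"
  where "tdeg p = Max (mdeg ` Poly_Mapping.keys p)"

lemma cring_polyring: "cring (polyring X :: 'a::field mpoly ring)"
proof (rule cringI)
  show "abelian_group (polyring X :: 'a mpoly ring)"
  proof (rule abelian_groupI)
    fix p q :: "'a mpoly"
    assume p: "p \<in> carrier (polyring X)" and q: "q \<in> carrier (polyring X)"
    show "p \<oplus>\<^bsub>polyring X\<^esub> q \<in> carrier (polyring X)"
      using p q Poly_Mapping.keys_add[of p q] by (fastforce simp: polyring_def)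
    show "\<exists>y \<in> carrier (polyring X). y \<oplus>\<^bsub>polyring X\<^esub> p = \<zero>\<^bsub>polyring X\<^esub>"
      using p by (intro bexI[of _ "- p"]) (auto simp: polyring_def)
  qed (auto simp: polyring_def algebra_simps)
  show "comm_monoid (polyring X :: 'a mpoly ring)"
  proof (rule comm_monoidI)
    fix p q :: "'a mpoly"
    assume p: "p \<in> carrier (polyring X)" and q: "q \<in> carrier (polyring X)"
    show "p \<otimes>\<^bsub>polyring X\<^esub> q \<in> carrier (polyring X)"
    proof -
      have "Poly_Mapping.keys m \<subseteq> X" if m: "m \<in> Poly_Mapping.keys (p * q)" for m
      proof -
        obtain a b where ab: "m = a + b" "a \<in> Poly_Mapping.keys p" "b \<in> Poly_Mapping.keys q"
          using m Poly_Mapping.keys_mult[of p q] by auto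
        have "Poly_Mapping.keys a \<subseteq> X" "Poly_Mapping.keys b \<subseteq> X"
          using p q ab by (auto simp: polyring_def)
        then show ?thesis
          using Poly_Mapping.keys_add[of a b] ab(1) by blast
      qed
      then show ?thesis by (simp add: polyring_def)
    qed
  qed (auto simp: polyring_def algebra_simps)
qed (auto simp: polyring_def algebra_simps)


section \<open>Initial ideals, minimal primes, symbolic powers\<close>

text \<open>
  The library order on finitely supported functions compares two exponent vectors at the smallest
  index where they differ.  On \<^typ>\<open>nat \<Rightarrow>\<^sub>0 nat\<close> it is therefore the lexicographic monomial order in
  which variables of smaller index are larger, that is, \<open>x\<^sub>1 > \<dots> > x\<^sub>n > y\<^sub>1 > \<dots> > y\<^sub>n\<close>.
\<close>

definition initial_ideal :: "nat set \<Rightarrow> 'a::field mpoly set \<Rightarrow> 'a mpoly set"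
  where "initial_ideal X J =
    Idl\<^bsub>polyring X\<^esub> {Poly_Mapping.single (Max (Poly_Mapping.keys f)) 1 | f. f \<in> J \<and> f \<noteq> 0}"

definition minimal_primes :: "('b, 'c) ring_scheme \<Rightarrow> 'b set \<Rightarrow> 'b set set"
  where "minimal_primes R I =
    {P. primeideal P R \<and> I \<subseteq> P \<and> (\<forall>Q. primeideal Q R \<and> I \<subseteq> Q \<and> Q \<subseteq> P \<longrightarrow> Q = P)}"

text \<open>Intersection of powers of minimal primes: this is the symbolic power for radical ideals.\<close>

definition symbolic_power :: "('b, 'c) ring_scheme \<Rightarrow> 'b set \<Rightarrow> nat \<Rightarrow> 'b set"
  where "symbolic_power R I m =
    carrier R \<inter> (\<Inter>P \<in> minimal_primes R I. P [^]\<^bsub>ideals_set R\<^esub> m)"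

definition alpha :: "'a::field mpoly set \<Rightarrow> nat"
  where "alpha J = (LEAST d. \<exists>f \<in> J. f \<noteq> 0 \<and> tdeg f = d)"

definition alpha_hat :: "nat set \<Rightarrow> 'a::field mpoly set \<Rightarrow> real"
  where "alpha_hat X I = lim (\<lambda>m. real (alpha (symbolic_power (polyring X) I m)) / real m)"


section \<open>Castelnuovo--Mumford regularity\<close>

text \<open>
  A list \<open>D = [d\<^sub>1, \<dots>, d\<^sub>r]\<close> of degrees describes the graded free module
  \<open>S(-d\<^sub>1) \<oplus> \<dots> \<oplus> S(-d\<^sub>r)\<close>.  A graded homomorphism (of degree \<open>0\<close>) from the module of \<open>D\<close> to the
  module of \<open>E\<close> is a matrix whose entry at \<open>(i, j)\<close> is homogeneous of degree \<open>D ! j - E ! i\<close>.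
\<close>

definition free_module :: "nat set \<Rightarrow> nat \<Rightarrow> 'a::field mpoly Matrix.vec set"
  where "free_module X r =
    {v \<in> carrier_vec r. \<forall>i<r. vec_index v i \<in> carrier (polyring X)}"

definition graded_hom :: "nat set \<Rightarrow> nat list \<Rightarrow> nat list \<Rightarrow> 'a::field mpoly Matrix.mat \<Rightarrow> bool"
  where "graded_hom X D E A \<longleftrightarrow>
    A \<in> carrier_mat (length E) (length D) \<and>
    (\<forall>i < length E. \<forall>j < length D. A $$ (i, j) \<in> carrier (polyring X) \<and>
      (\<forall>m \<in> Poly_Mapping.keys (A $$ (i, j)). mdeg m + E ! i = D ! j))"

text \<open>
  A minimal graded free resolution \<open>\<dots> \<rightarrow> F\<^sub>1 \<rightarrow> F\<^sub>0 \<rightarrow> J \<rightarrow> 0\<close> of a homogeneous ideal \<open>J\<close>: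
  \<open>D i\<close> lists the degrees of the basis of \<open>F\<^sub>i\<close>, \<open>A 0\<close> is the augmentation (a single row of
  generators of \<open>J\<close>) and \<open>A (Suc i)\<close> is the differential from \<open>F\<^sub>i\<^sub>+\<^sub>1\<close> to \<open>F\<^sub>i\<close>.
  Minimality means that the differentials have entries in the homogeneous maximal ideal.
\<close>

definition minimal_free_resolution ::
    "nat set \<Rightarrow> 'a::field mpoly set \<Rightarrow> (nat \<Rightarrow> nat list) \<Rightarrow> (nat \<Rightarrow> 'a mpoly Matrix.mat) \<Rightarrow> bool"
  where "minimal_free_resolution X J D A \<longleftrightarrow>
    graded_hom X (D 0) [0] (A 0) \<and>
    (\<lambda>w. vec_index (A 0 *\<^sub>v w) 0) ` free_module X (length (D 0)) = J \<and>
    (\<forall>i. graded_hom X (D (Suc i)) (D i) (A (Suc i)) \<and>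
      (\<lambda>w. A (Suc i) *\<^sub>v w) ` free_module X (length (D (Suc i))) =
        {w \<in> free_module X (length (D i)). A i *\<^sub>v w = 0\<^sub>v (dim_row (A i))} \<and>
      (\<forall>k < length (D i). \<forall>l < length (D (Suc i)).
        Poly_Mapping.lookup (A (Suc i) $$ (k, l)) 0 = 0))"

text \<open>
  The regularity is the largest \<open>d - i\<close> such that \<open>F\<^sub>i\<close> has a basis element of degree \<open>d\<close>.
  Minimal graded free resolutions are unique up to isomorphism, so the choice is immaterial.
\<close>

definition regularity :: "nat set \<Rightarrow> 'a::field mpoly set \<Rightarrow> int"
  where "regularity X J =
    (let D = (SOME D. \<exists>A. minimal_free_resolution X J D A)
     in Max {int d - int i | d i. d \<in> set (D i)})"

definition reg_hat :: "nat set \<Rightarrow> 'a::field mpoly set \<Rightarrow> real"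
  where "reg_hat X I =
    lim (\<lambda>m. real_of_int (regularity X (symbolic_power (polyring X) I m)) / real m)"


section \<open>Graphs and their ideals\<close>

text \<open>
  Simple graphs are given by \<^locale>\<open>pair_graph\<close>; each edge is represented by both its orientations.
\<close>

definition conn_induced_subgraphs :: "nat pair_pre_digraph \<Rightarrow> nat pair_pre_digraph set"
  where "conn_induced_subgraphs G =
    {H. induced_subgraph (with_proj H) (with_proj G) \<and>
        Digraph_Component.connected (with_proj H) \<and> parcs H \<noteq> {}}"

definition var_idx :: "nat \<Rightarrow> nat pair_pre_digraph \<Rightarrow> nat set"
  where "var_idx n H = pverts H \<union> (\<lambda>j. n + j) ` pverts H"

definition binomial_edge_ideal :: "nat \<Rightarrow> nat pair_pre_digraph \<Rightarrow> 'a::field mpoly set"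
  where "binomial_edge_ideal n H =
    Idl\<^bsub>polyring (var_idx n H)\<^esub>
      {var i * var (n + j) - var j * var (n + i) | i j. (i, j) \<in> parcs H}"

definition gin :: "nat \<Rightarrow> nat pair_pre_digraph \<Rightarrow> 'a::field mpoly set"
  where "gin n H =
    Idl\<^bsub>polyring (var_idx n H)\<^esub>
      {(\<Prod>v\<leftarrow>vs. var (n + v)) * var i * var j | i vs j. vpath (i # vs @ [j]) (with_proj H)}"


section \<open>Symbolic polyhedra\<close>

text \<open>
  Real coordinate space with coordinates indexed by \<open>X\<close> is the space of those finitely supported
  functions that vanish outside \<open>X\<close>.
\<close>

definition symbolic_polyhedron :: "nat set \<Rightarrow> 'a::field mpoly set \<Rightarrow> (nat \<Rightarrow>\<^sub>0 real) set"
  where "symbolic_polyhedron X I =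
    {a. Poly_Mapping.keys a \<subseteq> X \<and> (\<forall>k \<in> X. 0 \<le> Poly_Mapping.lookup a k) \<and>
        (\<forall>M \<subseteq> X. Idl\<^bsub>polyring X\<^esub> (var ` M) \<in> minimal_primes (polyring X) I \<longrightarrow>
          1 \<le> (\<Sum>k \<in> M. Poly_Mapping.lookup a k))}"

definition vertices :: "(nat \<Rightarrow>\<^sub>0 real) set \<Rightarrow> (nat \<Rightarrow>\<^sub>0 real) set"
  where "vertices S = {a. a extreme_point_of S}"

definition full_vertices ::
    "nat \<Rightarrow> nat pair_pre_digraph \<Rightarrow> 'a::field mpoly set \<Rightarrow> (nat \<Rightarrow>\<^sub>0 real) set"
  where "full_vertices n H I =
    {a \<in> vertices (symbolic_polyhedron (var_idx n H) I).
      \<forall>j \<in> pverts H. Poly_Mapping.lookup a j + Poly_Mapping.lookup a (n + j) \<noteq> 0}"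

text \<open>
  The canonical inclusion of the space with coordinates in \<open>X\<close> into a larger coordinate space.
  On functions vanishing outside \<open>X\<close> it does not change the underlying function.
\<close>

definition coord_inclusion :: "nat set \<Rightarrow> (nat \<Rightarrow>\<^sub>0 real) \<Rightarrow> (nat \<Rightarrow>\<^sub>0 real)"
  where "coord_inclusion X a = Poly_Mapping.mapp (\<lambda>k c. if k \<in> X then c else 0) a"

definition coord_sum :: "(nat \<Rightarrow>\<^sub>0 real) \<Rightarrow> real"
  where "coord_sum a = (\<Sum>k \<in> Poly_Mapping.keys a. Poly_Mapping.lookup a k)"

end

theory Submission
  imports Defs
begin

text \<open>
  The face of \<open>SP(I\<^sub>G)\<close> with coordinates in \<open>W\<close> is the polyhedron of the subgraph induced on \<open>W\<close>;
  if that subgraph is disconnected, a vertex is supported in one of the parts, so the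
  indices \<open>j\<close> with a nonzero \<open>x\<^sub>j\<close>- or \<open>y\<^sub>j\<close>-coordinate induce a connected subgraph.  For the initial ideals these two
  facts are obtained by linear algebra instead of a Groebner basis.

  The \<open>m\<close>-th symbolic power is spanned by the monomials with exponent in \<open>m SP(I)\<close>, and rounding
  changes degrees by a bounded amount only; hence the initial degree follows \<open>m\<close> times the least
  coordinate sum of a vertex.  Rounding up \<open>m\<close> times a vertex of largest coordinate sum yields a minimal
  generator of almost this degree, which bounds the regularity from below.  For the upper bound,
  every multidegree \<open>b\<close> of the minimal free resolution has, for each \<open>j\<close> with \<open>b\<^sub>j \<noteq> 0\<close>, a nearly tight
  inequality involving \<open>j\<close>, so \<open>b\<close> is close to \<open>m\<close> times a compact face.
\<close>

section \<open>Polynomials\<close>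

text \<open>The obstacle is the regularity. \<open>regularity\<close> refers to an arbitrarily
  chosen resolution graded by total degree, whereas the upper bound needs multidegrees. So a minimal
  multigraded resolution is constructed as well, coarsened to total degrees, and compared with the
  chosen one by chain maps and a homotopy; for this reason the grading is a parameter
  \<open>wt\<close> of \<open>ghom\<close> and \<open>resolution\<close>. Nearly tight inequalities
  suffice because they hold up to an error that is independent of \<open>m\<close> and disappears
  after division by \<open>m\<close>. The estimate bounds the degrees d themselves, not only d - i,
  so it is uniform over all levels of the resolution. Minimal primes of an ideal generated by
  monomials depend only on the supports of the generators. The graph enters the polyhedral part only
  through these supports, by the conditions collected in \<open>graph_ideals\<close>; paths satisfy
  them because a path cannot change its connected component, leading monomials because a product of
  two linear functionals detects leading terms in disjoint sets of variables.\<close>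

abbreviation lookup :: "('b \<Rightarrow>\<^sub>0 'c::zero) \<Rightarrow> 'b \<Rightarrow> 'c" where "lookup \<equiv> Poly_Mapping.lookup"
abbreviation keys :: "('b \<Rightarrow>\<^sub>0 'c::zero) \<Rightarrow> 'b set" where "keys \<equiv> Poly_Mapping.keys"
abbreviation mon :: "(nat \<Rightarrow>\<^sub>0 nat) \<Rightarrow> 'a::field mpoly" where "mon u \<equiv> Poly_Mapping.single u 1"
abbreviation unit_exp :: "nat \<Rightarrow> nat \<Rightarrow>\<^sub>0 nat" where "unit_exp k \<equiv> Poly_Mapping.single k (Suc 0)"
abbreviation Pol :: "nat set \<Rightarrow> 'a::field mpoly set" where "Pol X \<equiv> carrier (polyring X)"

lemma in_Pol_iff: "p \<in> Pol X \<longleftrightarrow> (\<forall>m \<in> keys p. keys m \<subseteq> X)"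
  by (simp add: polyring_def)

lemma keys_add_nat: "keys (a + b :: 'b \<Rightarrow>\<^sub>0 nat) = keys a \<union> keys b"
  by (auto simp: in_keys_iff lookup_add)

lemma exp_add_diff: "a + (b - a) = b" if "\<And>k. lookup a k \<le> lookup b k"
  for a b :: "'b \<Rightarrow>\<^sub>0 nat"
  using that by (intro poly_mapping_eqI) (simp add: lookup_add lookup_minus)

lemma Pol_0 [simp]: "0 \<in> Pol X" and Pol_1 [simp]: "1 \<in> Pol X"
  and Pol_single [simp]: "keys u \<subseteq> X \<Longrightarrow> Poly_Mapping.single u c \<in> Pol X"
  by (auto simp: in_Pol_iff)

lemma Pol_add: "p \<in> Pol X \<Longrightarrow> q \<in> Pol X \<Longrightarrow> p + q \<in> Pol X"
  using keys_add[of p q] by (fastforce simp: in_Pol_iff)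

lemma Pol_uminus: "p \<in> Pol X \<Longrightarrow> - p \<in> Pol X"
  by (auto simp: in_Pol_iff in_keys_iff)

lemma Pol_diff: "p \<in> Pol X \<Longrightarrow> q \<in> Pol X \<Longrightarrow> p - q \<in> Pol X"
  using Pol_add[of p X "- q"] Pol_uminus[of q X] by simp

lemma Pol_mult: "p \<in> Pol X \<Longrightarrow> q \<in> Pol X \<Longrightarrow> p * q \<in> Pol X"
  using cring_polyring[of X, THEN cring.axioms(1), THEN ring.ring_simprules(5), of p q]
  by (simp add: polyring_def)

lemma Pol_sum: "(\<And>i. i \<in> A \<Longrightarrow> f i \<in> Pol X) \<Longrightarrow> sum f A \<in> Pol X"
  by (induction A rule: infinite_finite_induct) (auto intro: Pol_add)

lemma Pol_mono: "X \<subseteq> Y \<Longrightarrow> p \<in> Pol X \<Longrightarrow> p \<in> Pol Y"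
  by (auto simp: in_Pol_iff)

lemma poly_eq_sum: "p = (\<Sum>m \<in> keys p. Poly_Mapping.single m (lookup p m))"
  by (rule poly_mapping_eqI) (auto simp: lookup_sum lookup_single when_def in_keys_iff)

text \<open>The case of a single term may use that its exponent occurs in \<open>p\<close>;
  \<open>restr_times\<close> relies on this.\<close>

lemma poly_induct [case_names zero add single]:
  fixes p :: "'b \<Rightarrow>\<^sub>0 'c::comm_monoid_add"
  assumes "P 0" "\<And>p q. P p \<Longrightarrow> P q \<Longrightarrow> P (p + q)"
    and "\<And>m c. m \<in> keys p \<Longrightarrow> P (Poly_Mapping.single m c)"
  shows "P p"
proof -
  have "P (\<Sum>m \<in> A. Poly_Mapping.single m (lookup p m))" if "A \<subseteq> keys p" for A
    using finite_subset[OF that finite_keys] that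
    by (induction A rule: finite_induct) (auto intro: assms)
  from this[of "keys p"] show ?thesis using poly_eq_sum[of p] by simp
qed

lemma single_times: "Poly_Mapping.single u c * p = (\<Sum>m \<in> keys p. Poly_Mapping.single (u + m) (c * lookup p m))"
  by (subst poly_eq_sum[of p]) (simp add: sum_distrib_left mult_single)

lemma lookup_single_times: "lookup (Poly_Mapping.single u c * p) (u + v) = c * lookup p v"
  for u :: "'b::cancel_comm_monoid_add" and p :: "'b \<Rightarrow>\<^sub>0 'a::comm_semiring_1"
  by (simp add: single_times lookup_sum lookup_single when_def in_keys_iff sum.If_cases if_distrib)

text \<open>Subtraction of exponents is meaningful only for multiples, hence the explicit
  divisibility condition.\<close>

lemma lookup_single_times_add: "lookup (Poly_Mapping.single u c * p) v =
   (if \<exists>w. v = u + w then c * lookup p (v - u) else 0)"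
  for u :: "'b::cancel_comm_monoid_add" and p :: "'b \<Rightarrow>\<^sub>0 'a::comm_semiring_1"
proof (cases "\<exists>w. v = u + w")
  case True
  then obtain w where w: "v = u + w" by blast
  then show ?thesis using lookup_single_times[of u c p w] by auto
next
  case False
  then have "lookup (Poly_Mapping.single u c * p) v = 0"
    by (auto simp: single_times lookup_sum lookup_single when_def intro!: sum.neutral)
  with False show ?thesis by simp
qed

lemma keys_mon_times: "keys (mon u * p) = (+) u ` keys p"
  by (auto simp: in_keys_iff lookup_single_times_add split: if_splits)

lemma keys_single_times_subset: "keys (Poly_Mapping.single u c * p) \<subseteq> (+) u ` keys p"
  for u :: "'b::cancel_comm_monoid_add" and p :: "'b \<Rightarrow>\<^sub>0 'a::comm_semiring_1"
proof
  fix v assume "v \<in> keys (Poly_Mapping.single u c * p)"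
  then obtain w where "v = u + w" "c * lookup p w \<noteq> 0"
    by (auto simp: in_keys_iff lookup_single_times_add split: if_splits)
  then show "v \<in> (+) u ` keys p" by (metis imageI in_keys_iff mult_zero_right)
qed

text \<open>Used at three levels: for homogeneous components of a polynomial, for the substitution
  of 0 for some variables, and, in \<open>exp_restr\<close>, for the part of an exponent on a set of
  indices.\<close>

definition restr :: "('b \<Rightarrow> bool) \<Rightarrow> ('b \<Rightarrow>\<^sub>0 'c) \<Rightarrow> ('b \<Rightarrow>\<^sub>0 'c::zero)"
  where "restr P p = Poly_Mapping.mapp (\<lambda>m c. if P m then c else 0) p"

lemma lookup_restr: "lookup (restr P p) m = (if P m then lookup p m else 0)"
  by (auto simp: restr_def lookup_mapp when_def in_keys_iff)

lemma keys_restr: "keys (restr P p) = {m \<in> keys p. P m}"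
  by (auto simp: in_keys_iff lookup_restr split: if_splits)

lemma restr_Pol: "p \<in> Pol X \<Longrightarrow> restr P p \<in> Pol X"
  by (auto simp: in_Pol_iff keys_restr)

lemma restr_add: "restr P (p + q) = restr P p + restr P q"
  by (intro poly_mapping_eqI) (simp add: lookup_restr lookup_add)

lemma restr_diff: "restr P (p - q) = restr P p - restr P q"
  for p q :: "'b \<Rightarrow>\<^sub>0 'c::cancel_comm_monoid_add"
  by (intro poly_mapping_eqI) (simp add: lookup_restr lookup_minus)

lemma restr_0 [simp]: "restr P 0 = 0"
  by (intro poly_mapping_eqI) (simp add: lookup_restr)

lemma restr_sum: "restr P (sum f A) = (\<Sum>i \<in> A. restr P (f i))"
  by (induction A rule: infinite_finite_induct) (auto simp: restr_add)

lemma restr_id: "(\<And>m. m \<in> keys p \<Longrightarrow> P m) \<Longrightarrow> restr P p = p"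
  by (intro poly_mapping_eqI) (auto simp: lookup_restr in_keys_iff)

lemma restr_none: "(\<And>m. m \<in> keys p \<Longrightarrow> \<not> P m) \<Longrightarrow> restr P p = 0"
  by (intro poly_mapping_eqI) (auto simp: lookup_restr in_keys_iff)

lemma restr_split: "p = restr P p + restr (\<lambda>m. \<not> P m) p"
  for p :: "'b \<Rightarrow>\<^sub>0 'c::monoid_add"
  by (intro poly_mapping_eqI) (simp add: lookup_restr lookup_add)

lemma restr_single: "restr P (Poly_Mapping.single m c) = (if P m then Poly_Mapping.single m c else 0)"
  by (intro poly_mapping_eqI) (auto simp: lookup_restr lookup_single when_def)

text \<open>Typical case: \<open>p\<close> is homogeneous of degree \<open>d\<close>, and \<open>P\<close>, \<open>Q\<close> select the degrees
  \<open>d + e\<close> and \<open>e\<close>.\<close>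

lemma restr_times:
  fixes p q :: "'b::cancel_comm_monoid_add \<Rightarrow>\<^sub>0 'c::comm_semiring_1"
  assumes "\<And>a b. a \<in> keys p \<Longrightarrow> P (a + b) \<longleftrightarrow> Q b"
  shows "restr P (p * q) = p * restr Q q"
proof (induction p rule: poly_induct)
  case (add p' q')
  then show ?case by (simp add: distrib_right restr_add)
next
  case (single m c)
  show ?case
  proof (induction q rule: poly_induct)
    case (single m' c')
    then show ?case using assms[OF \<open>m \<in> keys p\<close>, of m']
      by (simp add: mult_single restr_single)
  qed (auto simp: distrib_left restr_add)
qed simp

text \<open>The exponent 0 is a sum of two exponents only as 0 + 0. This allows identities between
  matrices to be reduced modulo the variables.\<close>

lemma lookup_times_0: "lookup (p * q) 0 = lookup p 0 * lookup q (0 :: 'b \<Rightarrow>\<^sub>0 nat)"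
  for p q :: "('b \<Rightarrow>\<^sub>0 nat) \<Rightarrow>\<^sub>0 'c::comm_semiring_1"
proof (induction p rule: poly_induct)
  case (single m c)
  have "(\<exists>w. 0 = m + w) \<longleftrightarrow> m = 0"
    by (metis keys_add_nat Un_empty keys_zero keys_eq_empty add.right_neutral)
  then show ?case by (auto simp: lookup_single_times_add lookup_single)
qed (auto simp: distrib_right lookup_add)

section \<open>Dickson's lemma\<close>

text \<open>A finite set \<open>T0\<close> that works on \<open>X\<close> also works for those
  members of \<open>T\<close> whose value at the new index \<open>x\<close> is at least the maximum
  \<open>N\<close> over \<open>T0\<close>. The remaining members form finitely many slices with
  constant value at \<open>x\<close>, and each slice is covered by the induction hypothesis.\<close>

lemma dickson_fun:
  fixes f :: "'b \<Rightarrow> 'c \<Rightarrow> nat"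
  assumes "finite X"
  shows "\<exists>T0 \<subseteq> T. finite T0 \<and> (\<forall>g \<in> T. \<exists>h \<in> T0. \<forall>k \<in> X. f h k \<le> f g k)"
  using assms
proof (induction X arbitrary: T rule: finite_induct)
  case empty
  show ?case
  proof (cases "T = {}")
    case False
    then obtain t where "t \<in> T" by blast
    then show ?thesis by (intro exI[of _ "{t}"]) auto
  qed auto
next
  case (insert x X)
  obtain T0 where T0: "T0 \<subseteq> T" "finite T0" "\<And>g. g \<in> T \<Longrightarrow> \<exists>h \<in> T0. \<forall>k \<in> X. f h k \<le> f g k"
    using insert.IH[of T] by blast
  define N where "N = Max ((\<lambda>h. f h x) ` T0)"
  have "\<forall>c. \<exists>S \<subseteq> {g \<in> T. f g x = c}. finite S \<and>
      (\<forall>g \<in> {g \<in> T. f g x = c}. \<exists>h \<in> S. \<forall>k \<in> X. f h k \<le> f g k)"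
    by (rule allI, rule insert.IH)
  from choice[OF this] obtain S where S: "\<forall>c. S c \<subseteq> {g \<in> T. f g x = c} \<and> finite (S c) \<and>
      (\<forall>g \<in> {g \<in> T. f g x = c}. \<exists>h \<in> S c. \<forall>k \<in> X. f h k \<le> f g k)" ..
  show ?case
  proof (intro exI[of _ "T0 \<union> (\<Union>c \<in> {..<N}. S c)"] conjI ballI)
    show "T0 \<union> (\<Union>c \<in> {..<N}. S c) \<subseteq> T" using T0(1) S by blast
    show "finite (T0 \<union> (\<Union>c \<in> {..<N}. S c))" using T0(2) S by auto
    fix g assume g: "g \<in> T"
    show "\<exists>h \<in> T0 \<union> (\<Union>c \<in> {..<N}. S c). \<forall>k \<in> insert x X. f h k \<le> f g k"
    proof (cases "f g x < N")
      case True
      obtain h where h: "h \<in> S (f g x)" "\<forall>k \<in> X. f h k \<le> f g k" using S g by blast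
      then have "f h x = f g x" using S by blast
      with h True show ?thesis by (intro bexI[of _ h]) auto
    next
      case False
      obtain h where h: "h \<in> T0" "\<forall>k \<in> X. f h k \<le> f g k" using T0(3)[OF g] by blast
      have "f h x \<le> N" unfolding N_def using h(1) T0(2) by (intro Max_ge) auto
      with h False show ?thesis by (intro bexI[of _ h]) auto
    qed
  qed
qed

text \<open>Divisibility of monomials; the type class order on exponents is the lexicographic
  one.\<close>

definition exp_le :: "(nat \<Rightarrow>\<^sub>0 nat) \<Rightarrow> (nat \<Rightarrow>\<^sub>0 nat) \<Rightarrow> bool"
  where "exp_le u v \<longleftrightarrow> (\<forall>k. lookup u k \<le> lookup v k)"

lemma exp_le_refl [simp]: "exp_le u u" by (simp add: exp_le_def)
lemma exp_le_trans: "exp_le u v \<Longrightarrow> exp_le v w \<Longrightarrow> exp_le u w"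
  by (auto simp: exp_le_def intro: le_trans)
lemma exp_le_add [simp]: "exp_le u (u + v)" "exp_le u (v + u)" by (auto simp: exp_le_def lookup_add)
lemma exp_le_addE: assumes "exp_le u v" obtains w where "v = u + w" "w = v - u"
  using exp_add_diff[of u v] assms by (metis exp_le_def)
lemma exp_le_keys: "exp_le u v \<Longrightarrow> keys u \<subseteq> keys v"
  by (metis exp_le_addE keys_add_nat Un_upper1)

lemma dickson:
  assumes "finite X" "\<And>g. g \<in> T \<Longrightarrow> keys g \<subseteq> X"
  obtains T0 where "T0 \<subseteq> T" "finite T0" "\<And>g. g \<in> T \<Longrightarrow> \<exists>h \<in> T0. exp_le h g"
proof -
  obtain T0 where T0: "T0 \<subseteq> T" "finite T0"
    "\<And>g. g \<in> T \<Longrightarrow> \<exists>h \<in> T0. \<forall>k \<in> X. lookup h k \<le> lookup g k"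
    using dickson_fun[OF assms(1), of T lookup] by blast
  have "exp_le h g" if "h \<in> T0" "\<forall>k \<in> X. lookup h k \<le> lookup g k" for h g
    unfolding exp_le_def
  proof
    fix k show "lookup h k \<le> lookup g k"
    proof (cases "k \<in> X")
      case False
      then have "lookup h k = 0" using assms(2) T0(1) that(1) by (metis in_keys_iff subsetD)
      then show ?thesis by simp
    qed (use that(2) in blast)
  qed
  with T0 show thesis by (intro that[of T0]) blast+
qed


section \<open>Graded free modules\<close>

text \<open>Elements of the free module of rank \<open>r\<close> are functions vanishing from index \<open>r\<close> on, and
  homomorphisms are matrices given as functions of row and column.\<close>

definition FM :: "nat set \<Rightarrow> nat \<Rightarrow> (nat \<Rightarrow> 'a::field mpoly) set"
  where "FM X r = {w. (\<forall>i. w i \<in> Pol X) \<and> (\<forall>i \<ge> r. w i = 0)}"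

definition app :: "(nat \<Rightarrow> nat \<Rightarrow> 'a::field mpoly) \<Rightarrow> nat \<Rightarrow> (nat \<Rightarrow> 'a mpoly) \<Rightarrow> nat \<Rightarrow> 'a mpoly"
  where "app A r w = (\<lambda>i. \<Sum>j<r. A i j * w j)"

text \<open>The grading is a parameter: \<open>mdeg\<close> gives total degrees and the identity
  gives multidegrees. Since the index bounds are demanded of every monomial, all entries outside the
  matrix are zero.\<close>

definition ghom :: "nat set \<Rightarrow> ((nat \<Rightarrow>\<^sub>0 nat) \<Rightarrow> 'g::cancel_comm_monoid_add) \<Rightarrow> 'g list \<Rightarrow> 'g list \<Rightarrow>
    (nat \<Rightarrow> nat \<Rightarrow> 'a::field mpoly) \<Rightarrow> bool"
  where "ghom X wt D E A \<longleftrightarrow> (\<forall>i j. A i j \<in> Pol X \<and>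
    (\<forall>m \<in> keys (A i j). i < length E \<and> j < length D \<and> wt m + E ! i = D ! j))"

text \<open>Component of degree \<open>g\<close> of an element of the free module with basis degrees
  \<open>E\<close>. Homogeneity of degree \<open>g\<close> is expressed throughout as being fixed by
  this projection.\<close>

definition vpart :: "((nat \<Rightarrow>\<^sub>0 nat) \<Rightarrow> 'g::cancel_comm_monoid_add) \<Rightarrow> 'g list \<Rightarrow> 'g \<Rightarrow>
    (nat \<Rightarrow> 'a::field mpoly) \<Rightarrow> nat \<Rightarrow> 'a mpoly"
  where "vpart wt E g w = (\<lambda>i. restr (\<lambda>m. wt m + E ! i = g) (w i))"

lemma ghomD:
  assumes "ghom X wt D E A"
  shows "A i j \<in> Pol X" "m \<in> keys (A i j) \<Longrightarrow> i < length E"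
    "m \<in> keys (A i j) \<Longrightarrow> j < length D" "m \<in> keys (A i j) \<Longrightarrow> wt m + E ! i = D ! j"
    "i \<ge> length E \<Longrightarrow> A i j = 0" "j \<ge> length D \<Longrightarrow> A i j = 0"
proof -
  show "A i j \<in> Pol X" "m \<in> keys (A i j) \<Longrightarrow> i < length E"
    "m \<in> keys (A i j) \<Longrightarrow> j < length D" "m \<in> keys (A i j) \<Longrightarrow> wt m + E ! i = D ! j"
    using assms by (auto simp: ghom_def)
  have "\<exists>m. m \<in> keys (A i j)" if "A i j \<noteq> 0" using that by (metis keys_eq_empty ex_in_conv)
  then show "i \<ge> length E \<Longrightarrow> A i j = 0" "j \<ge> length D \<Longrightarrow> A i j = 0"
    using assms unfolding ghom_def by (meson leD)+
qed

lemma FM_add: "v \<in> FM X r \<Longrightarrow> w \<in> FM X r \<Longrightarrow> (\<lambda>i. v i + w i) \<in> FM X r"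
  and FM_diff: "v \<in> FM X r \<Longrightarrow> w \<in> FM X r \<Longrightarrow> (\<lambda>i. v i - w i) \<in> FM X r"
  and FM_smult: "p \<in> Pol X \<Longrightarrow> w \<in> FM X r \<Longrightarrow> (\<lambda>i. p * w i) \<in> FM X r"
  and FM_0 [simp]: "(\<lambda>i. 0) \<in> FM X r"
  by (auto simp: FM_def Pol_add Pol_diff Pol_mult)

lemma FM_vpart: "w \<in> FM X r \<Longrightarrow> vpart wt E g w \<in> FM X r"
  by (auto simp: FM_def vpart_def restr_Pol)

lemma app_FM: "ghom X wt D E A \<Longrightarrow> w \<in> FM X r \<Longrightarrow> app A r w \<in> FM X (length E)"
  using ghomD(1,5)[of X wt D E A] by (auto simp: FM_def app_def intro!: Pol_sum Pol_mult)

lemma app_add: "app A r (\<lambda>i. v i + w i) = (\<lambda>i. app A r v i + app A r w i)"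
  by (simp add: app_def distrib_left sum.distrib)

lemma app_diff: "app A r (\<lambda>i. v i - w i) = (\<lambda>i. app A r v i - app A r w i)"
  by (simp add: app_def right_diff_distrib sum_subtractf)

lemma app_smult: "app A r (\<lambda>i. p * w i) = (\<lambda>i. p * app A r w i)"
  by (simp add: app_def sum_distrib_left mult.left_commute)

lemma app_0 [simp]: "app A r (\<lambda>i. 0) = (\<lambda>i. 0)"
  by (simp add: app_def)

lemma app_app: "app A r (app B s w) = app (\<lambda>i k. \<Sum>j<r. A i j * B j k) s w"
proof
  fix i
  have "app A r (app B s w) i = (\<Sum>j<r. \<Sum>k<s. A i j * B j k * w k)"
    by (simp add: app_def sum_distrib_left mult.assoc)
  also have "\<dots> = (\<Sum>k<s. \<Sum>j<r. A i j * B j k * w k)" by (rule sum.swap)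
  finally show "app A r (app B s w) i = app (\<lambda>i k. \<Sum>j<r. A i j * B j k) s w i"
    by (simp add: app_def sum_distrib_right)
qed

lemma app_unit: "l < r \<Longrightarrow> app A r (\<lambda>i. if i = l then 1 else 0) = (\<lambda>i. A i l)"
  by (simp add: app_def if_distrib cong: if_cong)

lemma unit_FM: "l < r \<Longrightarrow> (\<lambda>i. if i = l then 1 else 0) \<in> FM X r"
  by (auto simp: FM_def)

text \<open>Kernels are graded for this reason, and liftings can be made homogeneous.\<close>

lemma vpart_app:
  assumes "ghom X wt D E A" and wt: "\<And>a b. wt (a + b) = wt a + wt b"
  shows "vpart wt E g (app A (length D) w) = app A (length D) (vpart wt D g w)"
proof
  fix i
  have "restr (\<lambda>m. wt m + E ! i = g) (A i j * w j) = A i j * restr (\<lambda>m. wt m + D ! j = g) (w j)" for j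
  proof (rule restr_times)
    fix a b assume "a \<in> keys (A i j)"
    then have "wt a + E ! i = D ! j" using assms(1) by (rule ghomD(4)[rotated])
    then have "wt (a + b) + E ! i = wt b + D ! j"
      unfolding wt by (metis add.assoc add.commute)
    then show "(wt (a + b) + E ! i = g) = (wt b + D ! j = g)" by simp
  qed
  then show "vpart wt E g (app A (length D) w) i = app A (length D) (vpart wt D g w) i"
    by (simp add: vpart_def app_def restr_sum)
qed


section \<open>Graded submodules\<close>

definition submod :: "nat set \<Rightarrow> (nat \<Rightarrow> 'a::field mpoly) set \<Rightarrow> bool"
  where "submod X K \<longleftrightarrow> (\<lambda>i. 0) \<in> K \<and> (\<forall>v \<in> K. \<forall>w \<in> K. (\<lambda>i. v i + w i) \<in> K) \<and>
    (\<forall>p \<in> Pol X. \<forall>w \<in> K. (\<lambda>i. p * w i) \<in> K)"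

lemma submodD:
  assumes "submod X K"
  shows "(\<lambda>i. 0) \<in> K" "v \<in> K \<Longrightarrow> w \<in> K \<Longrightarrow> (\<lambda>i. v i + w i) \<in> K"
    "p \<in> Pol X \<Longrightarrow> w \<in> K \<Longrightarrow> (\<lambda>i. p * w i) \<in> K"
    "v \<in> K \<Longrightarrow> w \<in> K \<Longrightarrow> (\<lambda>i. v i - w i) \<in> K"
proof -
  show 1: "(\<lambda>i. 0) \<in> K" "\<And>v w. v \<in> K \<Longrightarrow> w \<in> K \<Longrightarrow> (\<lambda>i. v i + w i) \<in> K"
    "\<And>p w. p \<in> Pol X \<Longrightarrow> w \<in> K \<Longrightarrow> (\<lambda>i. p * w i) \<in> K"
    using assms by (auto simp: submod_def)
  assume "v \<in> K" "w \<in> K"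
  then show "(\<lambda>i. v i - w i) \<in> K"
    using 1(2)[of v "\<lambda>i. - 1 * w i"] 1(3)[of "- 1" w] Pol_uminus[OF Pol_1] by auto
qed

text \<open>Built by adding one multiple of a generator at a time, which gives an induction
  principle for the generated submodule.\<close>

inductive_set gen :: "nat set \<Rightarrow> (nat \<Rightarrow> 'a::field mpoly) set \<Rightarrow> (nat \<Rightarrow> 'a mpoly) set"
  for X B where
    zero: "(\<lambda>i. 0) \<in> gen X B"
  | step: "p \<in> Pol X \<Longrightarrow> b \<in> B \<Longrightarrow> w \<in> gen X B \<Longrightarrow> (\<lambda>i. w i + p * b i) \<in> gen X B"

lemma gen_submod: "submod X (gen X B)"
proof -
  have "(\<lambda>i. v i + w i) \<in> gen X B" if "v \<in> gen X B" "w \<in> gen X B" for v w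
    using that(2)
  proof induction
    case (step p b w)
    have "(\<lambda>i. (v i + w i) + p * b i) \<in> gen X B" using step by (intro gen.step) auto
    then show ?case by (simp add: add.assoc)
  qed (use that(1) in simp)
  moreover have "(\<lambda>i. p * w i) \<in> gen X B" if "p \<in> Pol X" "w \<in> gen X B" for p w
    using that(2)
  proof induction
    case (step q b w)
    have "(\<lambda>i. p * w i + (p * q) * b i) \<in> gen X B" using step that(1) by (intro gen.step Pol_mult) auto
    then show ?case by (simp add: distrib_left mult.assoc)
  qed (simp add: gen.zero)
  ultimately show ?thesis by (auto simp: submod_def gen.zero)
qed

lemma gen_subset: "submod X K \<Longrightarrow> B \<subseteq> K \<Longrightarrow> gen X B \<subseteq> K"
proof
  fix w assume "submod X K" "B \<subseteq> K" "w \<in> gen X B"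
  from this(3) show "w \<in> K"
    by induction (use \<open>submod X K\<close> \<open>B \<subseteq> K\<close> in \<open>auto intro!: submodD\<close>)
qed

lemma gen_sum:
  "(\<lambda>i. \<Sum>j \<in> S. p j * b j i) \<in> gen X B" if "\<And>j. j \<in> S \<Longrightarrow> p j \<in> Pol X" "\<And>j. j \<in> S \<Longrightarrow> b j \<in> B"
  using that
proof (induction S rule: infinite_finite_induct)
  case (insert j S)
  then have "(\<lambda>i. (\<Sum>j \<in> S. p j * b j i) + p j * b j i) \<in> gen X B" by (intro gen.step) auto
  with insert show ?case by (simp add: add.commute)
qed (auto simp: gen.zero)

lemma gen_base: "b \<in> B \<Longrightarrow> b \<in> gen X B"
  using gen_sum[of "{0::nat}" "\<lambda>_. 1" X "\<lambda>_. b" B] by simp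

text \<open>Homogeneous elements suffice: subtracting one component from \<open>w\<close> removes
  one degree from the finite set of degrees that occur, and both pieces stay in
  \<open>K\<close>.\<close>

lemma graded_subset:
  assumes K: "submod X K" "K \<subseteq> FM X (length E)" "\<And>w g. w \<in> K \<Longrightarrow> vpart wt E g w \<in> K"
    and L: "submod X L" "\<And>w g. w \<in> K \<Longrightarrow> vpart wt E g w = w \<Longrightarrow> w \<in> L"
  shows "K \<subseteq> L"
proof
  define S where "S = (\<lambda>w :: nat \<Rightarrow> 'a mpoly. \<Union>i < length E. (\<lambda>m. wt m + E ! i) ` keys (w i))"
  have fin: "finite (S w)" for w by (auto simp: S_def)
  fix w assume "w \<in> K"
  then show "w \<in> L"
  proof (induction "card (S w)" arbitrary: w rule: less_induct)
    case less
    show ?case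
    proof (cases "S w = {}")
      case True
      then have "keys (w i) = {}" if "i < length E" for i using that by (auto simp: S_def)
      then have "w i = 0" for i using less.prems K(2) by (cases "i < length E") (auto simp: FM_def)
      then have "w = (\<lambda>i. 0)" by blast
      then show ?thesis using submodD(1)[OF L(1)] by simp
    next
      case False
      then obtain g where g: "g \<in> S w" by blast
      define v where "v = vpart wt E g w"
      define u where "u = (\<lambda>i. w i - v i)"
      have v: "v \<in> K" "vpart wt E g v = v"
        using K(3) less.prems by (auto simp: v_def vpart_def fun_eq_iff keys_restr intro!: restr_id)
      have u: "u \<in> K" unfolding u_def using submodD(4)[OF K(1) less.prems v(1)] .
      have "u i = restr (\<lambda>m. wt m + E ! i \<noteq> g) (w i)" for i
        by (intro poly_mapping_eqI) (simp add: u_def v_def vpart_def lookup_minus lookup_restr)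
      then have "S u = S w - {g}" by (auto simp: S_def keys_restr)
      then have "card (S u) < card (S w)" using fin g by (metis card_Diff1_less)
      then have "u \<in> L" using less.hyps u by blast
      moreover have "v \<in> L" using L(2) v by blast
      ultimately have "(\<lambda>i. u i + v i) \<in> L" using submodD(2)[OF L(1)] by blast
      then show ?thesis by (simp add: u_def)
    qed
  qed
qed

section \<open>Multigraded submodules are finitely generated\<close>

abbreviation mpart :: "(nat \<Rightarrow>\<^sub>0 nat) list \<Rightarrow> (nat \<Rightarrow>\<^sub>0 nat) \<Rightarrow> (nat \<Rightarrow> 'a::field mpoly) \<Rightarrow> nat \<Rightarrow> 'a mpoly"
  where "mpart \<equiv> vpart (\<lambda>m. m)"

lemma FM_index: "w \<in> FM X r \<Longrightarrow> w i \<noteq> 0 \<Longrightarrow> i < r"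
  unfolding FM_def by (metis (mono_tags, lifting) linorder_not_le mem_Collect_eq)

lemma vpart_fixed_iff: "vpart wt E g w = w \<longleftrightarrow> (\<forall>i. \<forall>m \<in> keys (w i). wt m + E ! i = g)"
proof
  assume "vpart wt E g w = w"
  then have "restr (\<lambda>m. wt m + E ! i = g) (w i) = w i" for i by (metis vpart_def)
  then show "\<forall>i. \<forall>m \<in> keys (w i). wt m + E ! i = g"
    by (metis (mono_tags, lifting) keys_restr mem_Collect_eq)
qed (auto simp: vpart_def intro: restr_id)

text \<open>The exponent is determined by the multidegree \<open>g\<close> and the basis degree
  \<open>E ! l\<close>, so each coordinate carries at most one monomial.\<close>

lemma mpart_component:
  assumes "mpart E g w = w"
  obtains m where "w l = Poly_Mapping.single m (lookup (w l) m)" "m + E ! l = g \<or> w l = 0"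
proof (cases "w l = 0")
  case False
  then obtain m where m: "m \<in> keys (w l)" by (metis keys_eq_empty ex_in_conv)
  have *: "m' + E ! l = g" if "m' \<in> keys (w l)" for m'
    using assms that by (auto simp: vpart_fixed_iff)
  have "m' = m" if "m' \<in> keys (w l)" for m'
    using *[OF that] *[OF m] by (metis add_right_cancel)
  then have "keys (w l) = {m}" using m by blast
  then have "w l = Poly_Mapping.single m (lookup (w l) m)"
    using poly_eq_sum[of "w l"] by simp
  with *[OF m] show thesis by (intro that[of m]) auto
qed (auto intro: that[of 0])

text \<open>Elimination of leading terms. By \<open>dickson\<close>, for each coordinate
  \<open>l\<close> finitely many multidegrees lie below those of all homogeneous elements whose
  first nonzero coordinate is \<open>l\<close>. Subtracting a multiple of a corresponding element
  clears this coordinate and keeps the degree.\<close>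

lemma graded_fg:
  assumes "finite X" and K: "submod X K" "K \<subseteq> FM X (length E)"
    "\<And>w g. w \<in> K \<Longrightarrow> mpart E g w \<in> K"
    and E: "\<And>d. d \<in> set E \<Longrightarrow> keys d \<subseteq> X"
  shows "\<exists>B. finite B \<and> (\<forall>b \<in> B. \<exists>g. keys g \<subseteq> X \<and> mpart E g b = b) \<and> gen X B = K"
proof -
  define r where "r = length E"
  define T where "T = (\<lambda>l. {g. keys g \<subseteq> X \<and> (\<exists>w \<in> K. mpart E g w = w \<and> w l \<noteq> 0 \<and> (\<forall>i<l. w i = 0))})"
  have "\<exists>S. S \<subseteq> T l \<and> finite S \<and> (\<forall>g \<in> T l. \<exists>h \<in> S. exp_le h g)" for l
    by (rule dickson[OF \<open>finite X\<close>, of "T l"]) (auto simp: T_def)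
  then obtain S where S: "\<And>l. S l \<subseteq> T l" "\<And>l. finite (S l)"
      "\<And>l g. g \<in> T l \<Longrightarrow> \<exists>h \<in> S l. exp_le h g"
    by metis
  have "\<forall>l g. \<exists>w. g \<in> T l \<longrightarrow> w \<in> K \<and> mpart E g w = w \<and> w l \<noteq> 0 \<and> (\<forall>i<l. w i = 0)"
    by (auto simp: T_def)
  then obtain W where W: "\<And>l g. g \<in> T l \<Longrightarrow> W l g \<in> K \<and> mpart E g (W l g) = W l g \<and>
      W l g l \<noteq> 0 \<and> (\<forall>i<l. W l g i = 0)" by metis
  define B where "B = (\<Union>l<r. W l ` S l)"
  have "finite B" unfolding B_def using S(2) by blast
  have BK: "B \<subseteq> K" unfolding B_def using S(1) W by blast
  have hom: "\<exists>g. keys g \<subseteq> X \<and> mpart E g b = b" if b: "b \<in> B" for b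
  proof -
    obtain l g where "g \<in> T l" "b = W l g" using b S(1) by (auto simp: B_def)
    then show ?thesis using W[of g l] by (auto simp: T_def)
  qed
  \<comment> \<open>Descending induction on the number of leading coordinates known to vanish; at
    \<open>l = r\<close> only the zero vector is left.\<close>
  have red: "w \<in> gen X B" if "l \<le> r" "w \<in> K" "mpart E g w = w" "\<forall>i<l. w i = 0" for l w g
    using that
  proof (induction l arbitrary: w rule: inc_induct)
    case base
    then have "w i = 0" for i using K(2) by (cases "i < r") (auto simp: FM_def r_def)
    then have "w = (\<lambda>i. 0)" by blast
    then show ?case by (simp add: gen.zero)
  next
    case (step l)
    show ?case
    proof (cases "w l = 0")
      case True
      with step.prems have "\<forall>i<Suc l. w i = 0" by (auto simp: less_Suc_eq)
      with step.IH step.prems show ?thesis by blast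
    next
      case False
      obtain m where m: "w l = Poly_Mapping.single m (lookup (w l) m)" "m + E ! l = g"
        using mpart_component[OF step.prems(2), of l] False by metis
      have "m \<in> keys (w l)" using m(1) False by (metis in_keys_iff single_zero)
      then have "keys m \<subseteq> X" using step.prems(1) K(2) by (auto simp: FM_def in_Pol_iff)
      moreover have "keys (E ! l) \<subseteq> X" using E step.hyps by (auto simp: r_def)
      ultimately have "keys g \<subseteq> X" using m(2) by (metis keys_add_nat Un_least)
      then have "g \<in> T l" using step.prems False by (auto simp: T_def)
      then obtain h where h: "h \<in> S l" "exp_le h g" using S(3) by blast
      then have "h \<in> T l" using S(1) by blast
      define b where "b = W l h"
      have b: "b \<in> K" "mpart E h b = b" "b l \<noteq> 0" "\<forall>i<l. b i = 0" "b \<in> B"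
        using W[OF \<open>h \<in> T l\<close>] h step.hyps by (auto simp: b_def B_def)
      obtain m0 where m0: "b l = Poly_Mapping.single m0 (lookup (b l) m0)" "m0 + E ! l = h"
        using mpart_component[OF b(2), of l] b(3) by metis
      obtain u where u: "g = h + u" using exp_le_addE[OF h(2)] by metis
      have um: "u + m0 = m"
      proof -
        have "(u + m0) + E ! l = m + E ! l" using u m(2) m0(2) by (metis add.assoc add.commute)
        then show ?thesis by simp
      qed
      define c c0 where "c = lookup (w l) m" and "c0 = lookup (b l) m0"
      have "c0 \<noteq> 0" using m0(1) b(3) by (auto simp: c0_def)
      \<comment> \<open>Chosen so that \<open>p * b\<close> and \<open>w\<close> have the same term
        in coordinate \<open>l\<close>.\<close>
      define p where "p = Poly_Mapping.single u (c / c0)"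
      have "keys u \<subseteq> X" using \<open>keys g \<subseteq> X\<close> u by (simp add: keys_add_nat)
      then have p: "p \<in> Pol X" by (simp add: p_def)
      define w' where "w' = (\<lambda>i. w i - p * b i)"
      have "w' \<in> K" unfolding w'_def using K(1) step.prems(1) b(1) p by (intro submodD)
      moreover have "mpart E g w' = w'"
        unfolding vpart_fixed_iff
      proof (intro allI ballI)
        fix i m' assume "m' \<in> keys (w' i)"
        then have "m' \<in> keys (w i) \<or> m' \<in> keys (p * b i)"
          unfolding w'_def using keys_diff[of "w i" "p * b i"] by blast
        then show "m' + E ! i = g"
        proof
          assume "m' \<in> keys (p * b i)"
          then obtain m'' where "m' = u + m''" "m'' \<in> keys (b i)"
            using keys_single_times_subset[of u "c / c0" "b i"] by (auto simp: p_def)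
          moreover have "m'' + E ! i = h" using b(2) \<open>m'' \<in> keys (b i)\<close> by (auto simp: vpart_fixed_iff)
          ultimately show ?thesis using u by (metis add.assoc add.commute)
        qed (use step.prems(2) in \<open>auto simp: vpart_fixed_iff\<close>)
      qed
      moreover have "\<forall>i<Suc l. w' i = 0"
      proof -
        have "p * b l = w l"
          by (subst m0(1), subst m(1)) (use \<open>c0 \<noteq> 0\<close> in \<open>simp add: p_def mult_single um flip: c_def c0_def\<close>)
        then show ?thesis using step.prems(3) b(4) by (auto simp: w'_def less_Suc_eq)
      qed
      ultimately have "w' \<in> gen X B" using step.IH by blast
      then have "(\<lambda>i. w' i + p * b i) \<in> gen X B" using p b(5) by (intro gen.step)
      then show ?thesis by (simp add: w'_def)
    qed
  qed
  have "K \<subseteq> gen X B"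
    by (rule graded_subset[OF K gen_submod]) (use red[of 0] in auto)
  with gen_subset[OF K(1) BK] \<open>finite B\<close> hom show ?thesis by blast
qed


section \<open>Minimal graded free resolutions\<close>

lemma image_submod:
  fixes A :: "nat \<Rightarrow> nat \<Rightarrow> 'a::field mpoly"
  shows "submod X (app A r ` FM X r)"
  unfolding submod_def
proof (intro conjI ballI)
  show "(\<lambda>i. 0) \<in> app A r ` FM X r" using imageI[OF FM_0, of "app A r"] by simp
next
  fix v w assume "v \<in> app A r ` FM X r" "w \<in> app A r ` FM X r"
  then obtain v' w' where *: "v' \<in> FM X r" "v = app A r v'" "w' \<in> FM X r" "w = app A r w'" by blast
  then have "app A r (\<lambda>i. v' i + w' i) \<in> app A r ` FM X r" by (intro imageI FM_add)
  then show "(\<lambda>i. v i + w i) \<in> app A r ` FM X r" by (simp add: * app_add)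
next
  fix p :: "'a mpoly" and w assume p: "p \<in> Pol X" and "w \<in> app A r ` FM X r"
  then obtain w' where *: "w' \<in> FM X r" "w = app A r w'" by blast
  then have "app A r (\<lambda>i. p * w' i) \<in> app A r ` FM X r" using p by (intro imageI FM_smult)
  then show "(\<lambda>i. p * w i) \<in> app A r ` FM X r" by (simp add: * app_smult)
qed

text \<open>The columns are a homogeneous generating set of least cardinality. A relation with a
  nonzero constant term could be solved for one generator, which would make the set smaller.\<close>

lemma minimal_presentation:
  fixes K :: "(nat \<Rightarrow> 'a::field mpoly) set"
  assumes "finite X" and K: "submod X K" "K \<subseteq> FM X (length E)"
    "\<And>w g. w \<in> K \<Longrightarrow> mpart E g w \<in> K"
    and E: "\<And>d. d \<in> set E \<Longrightarrow> keys d \<subseteq> X"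
  shows "\<exists>D A. (\<forall>d \<in> set D. keys d \<subseteq> X) \<and> ghom X (\<lambda>m. m) D E A \<and>
    app A (length D) ` FM X (length D) = K \<and>
    (\<forall>w \<in> FM X (length D). app A (length D) w = (\<lambda>i. 0) \<longrightarrow> (\<forall>l. lookup (w l) 0 = 0))"
proof -
  define Q where "Q = (\<lambda>B. finite B \<and> (\<forall>b \<in> B. \<exists>g. keys g \<subseteq> X \<and> mpart E g b = b) \<and> gen X B = K)"
  have "\<exists>B. Q B" unfolding Q_def by (rule graded_fg[OF assms])
  then obtain B where B: "Q B" "\<And>B'. Q B' \<Longrightarrow> card B \<le> card B'"
    using ex_has_least_nat[of Q _ card] by metis
  obtain gs where gs: "set gs = B" "distinct gs"
    using B(1) finite_distinct_list[of B] unfolding Q_def by blast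
  obtain \<delta> where \<delta>: "\<And>b. b \<in> B \<Longrightarrow> keys (\<delta> b) \<subseteq> X \<and> mpart E (\<delta> b) b = b"
    using B(1) unfolding Q_def by metis
  define r where "r = length gs"
  define D where "D = map \<delta> gs"
  define A where "A = (\<lambda>i j. if j < r then (gs ! j) i else 0)"
  have lenD [simp]: "length D = r" by (simp add: D_def r_def)
  have inB: "gs ! j \<in> B" if "j < r" for j using that gs by (auto simp: r_def)
  have genB: "gen X B = K" using B(1) by (simp add: Q_def)
  have BK: "B \<subseteq> K" using genB gen_base by blast
  have app_eq: "app A r w = (\<lambda>i. \<Sum>j<r. w j * (gs ! j) i)" for w
    by (simp add: app_def A_def mult.commute)
  have hom: "ghom X (\<lambda>m. m) D E A"
    unfolding ghom_def
  proof (intro allI conjI ballI)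
    fix i j
    show "A i j \<in> Pol X" using inB[of j] BK K(2) by (auto simp: A_def FM_def)
    fix m assume m: "m \<in> keys (A i j)"
    then show "j < length D" by (auto simp: A_def split: if_splits)
    with m have j: "j < r" "m \<in> keys ((gs ! j) i)" by (auto simp: A_def)
    then have "gs ! j \<in> FM X (length E)" using inB BK K(2) by blast
    then show "i < length E" by (rule FM_index) (use j(2) in auto)
    show "m + E ! i = D ! j"
      using \<delta>[OF inB[OF j(1)]] j by (auto simp: vpart_fixed_iff D_def r_def)
  qed
  have image: "app A r ` FM X r = K"
  proof
    show "app A r ` FM X r \<subseteq> K"
      unfolding app_eq genB[symmetric] using inB by (auto simp: FM_def intro!: gen_sum)
    have "submod X (app A r ` FM X r)" by (rule image_submod)
    moreover have "B \<subseteq> app A r ` FM X r"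
    proof
      fix b assume "b \<in> B"
      then obtain l where l: "l < r" "b = gs ! l" using gs by (auto simp: r_def in_set_conv_nth)
      then have "b = app A r (\<lambda>i. if i = l then 1 else 0)" by (simp add: app_unit A_def)
      then show "b \<in> app A r ` FM X r" using unit_FM[OF l(1)] by blast
    qed
    ultimately show "K \<subseteq> app A r ` FM X r" unfolding genB[symmetric] by (rule gen_subset)
  qed
  have minimal: "lookup (w l) 0 = 0" if w: "w \<in> FM X r" "app A r w = (\<lambda>i. 0)" for w l
  proof (rule ccontr)
    assume nz: "lookup (w l) 0 \<noteq> 0"
    then have l: "l < r" using FM_index[OF w(1), of l] lookup_zero by metis
    \<comment> \<open>In degree \<open>D ! l\<close> the coefficient at \<open>l\<close> is a
      constant, so this component of the relation can be solved for \<open>gs ! l\<close>.\<close>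
    define v where "v = mpart D (D ! l) w"
    have v: "v \<in> FM X r" using FM_vpart[OF w(1)] by (simp add: v_def)
    have v0: "app A r v = (\<lambda>i. 0)"
      using vpart_app[OF hom, of "D ! l" w] w(2) by (simp add: v_def vpart_def)
    define c where "c = lookup (w l) 0"
    have vl: "v l = Poly_Mapping.single 0 c"
      by (intro poly_mapping_eqI) (auto simp: v_def vpart_def lookup_restr lookup_single c_def when_def)
    define b where "b = gs ! l"
    define ic where "ic = (Poly_Mapping.single 0 (- inverse c) :: 'a mpoly)"
    have "b i = (\<Sum>j \<in> {..<r} - {l}. (ic * v j) * (gs ! j) i)" for i
    proof -
      have "0 = (\<Sum>j<r. v j * (gs ! j) i)" using fun_cong[OF v0, of i] by (simp add: app_eq)
      also have "\<dots> = v l * b i + (\<Sum>j \<in> {..<r} - {l}. v j * (gs ! j) i)"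
        using l by (simp add: sum.remove b_def)
      finally have "v l * b i + (\<Sum>j \<in> {..<r} - {l}. v j * (gs ! j) i) = 0" by simp
      from arg_cong[OF this, of "(*) ic"]
      have "ic * v l * b i + (\<Sum>j \<in> {..<r} - {l}. ic * v j * (gs ! j) i) = 0"
        by (simp add: distrib_left sum_distrib_left mult.assoc)
      moreover have "ic * v l = -1"
        using nz by (simp add: vl ic_def mult_single c_def single_uminus)
      ultimately show ?thesis
        by (simp add: neg_eq_iff_add_eq_0)
    qed
    then have "b = (\<lambda>i. \<Sum>j \<in> {..<r} - {l}. (ic * v j) * (gs ! j) i)" by blast
    also have "\<dots> \<in> gen X (B - {b})"
    proof (rule gen_sum)
      fix j assume j: "j \<in> {..<r} - {l}"
      show "ic * v j \<in> Pol X" using v by (auto simp: FM_def ic_def intro!: Pol_mult)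
      have "gs ! j \<noteq> b" using j l gs(2) by (auto simp: b_def r_def nth_eq_iff_index_eq)
      then show "gs ! j \<in> B - {b}" using inB j by auto
    qed
    finally have "B \<subseteq> gen X (B - {b})" using gen_base[of _ "B - {b}" X] by blast
    then have "K \<subseteq> gen X (B - {b})" unfolding genB[symmetric] by (rule gen_subset[OF gen_submod])
    moreover have "gen X (B - {b}) \<subseteq> K" using BK by (intro gen_subset K) auto
    ultimately have "Q (B - {b})" using B(1) by (auto simp: Q_def)
    then have "card B \<le> card (B - {b})" by (rule B(2))
    moreover have "b \<in> B" using inB l by (simp add: b_def)
    ultimately show False using B(1) card_Diff1_less[of B b] by (auto simp: Q_def)
  qed
  have "\<forall>d \<in> set D. keys d \<subseteq> X" using \<delta> gs(1) by (auto simp: D_def)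
  with hom image minimal show ?thesis by (intro exI[of _ D] exI[of _ A]) simp
qed

text \<open>Level \<open>0\<close> is the polynomial ring itself, so level \<open>Suc i\<close> is the usual \<open>F\<^sub>i\<close>.\<close>

definition resolution :: "nat set \<Rightarrow> ((nat \<Rightarrow>\<^sub>0 nat) \<Rightarrow> 'g::cancel_comm_monoid_add) \<Rightarrow> 'a::field mpoly set \<Rightarrow>
    (nat \<Rightarrow> 'g list) \<Rightarrow> (nat \<Rightarrow> nat \<Rightarrow> nat \<Rightarrow> 'a mpoly) \<Rightarrow> bool"
  where "resolution X wt J D A \<longleftrightarrow> D 0 = [0] \<and> (\<forall>i. ghom X wt (D (Suc i)) (D i) (A i)) \<and>
    app (A 0) (length (D 1)) ` FM X (length (D 1)) = {w \<in> FM X 1. w 0 \<in> J} \<and>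
    (\<forall>i. app (A (Suc i)) (length (D (Suc (Suc i)))) ` FM X (length (D (Suc (Suc i)))) =
      {w \<in> FM X (length (D (Suc i))). app (A i) (length (D (Suc i))) w = (\<lambda>i. 0)})"

text \<open>The index is shifted because \<open>A 0\<close> is the augmentation, whose entries may
  be constants.\<close>

definition minimal :: "(nat \<Rightarrow> nat \<Rightarrow> nat \<Rightarrow> 'a::field mpoly) \<Rightarrow> bool"
  where "minimal A \<longleftrightarrow> (\<forall>i k l. lookup (A (Suc i) k l) 0 = 0)"

definition monomial_ideal :: "nat set \<Rightarrow> (nat \<Rightarrow>\<^sub>0 nat) set \<Rightarrow> 'a::field mpoly set"
  where "monomial_ideal X U = {f \<in> Pol X. keys f \<subseteq> U}"

text \<open>Minimal presentations of successive kernels are spliced together. The presentation at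
  one level ensures that its relations have no constant terms, and this is the minimality of the
  next differential.\<close>

lemma exists_minimal_multigraded_resolution:
  fixes U :: "(nat \<Rightarrow>\<^sub>0 nat) set"
  assumes "finite X" and U: "\<And>u v. u \<in> U \<Longrightarrow> keys v \<subseteq> X \<Longrightarrow> v + u \<in> U"
  obtains D A where "resolution X (\<lambda>m. m) (monomial_ideal X U :: 'a::field mpoly set) D A"
    "minimal A" "\<And>i d. d \<in> set (D i) \<Longrightarrow> keys d \<subseteq> X"
proof -
  define J where "J = (monomial_ideal X U :: 'a mpoly set)"
  define K0 where "K0 = {w \<in> FM X 1. w 0 \<in> J}"
  define Ker :: "(nat \<Rightarrow>\<^sub>0 nat) list \<times> (nat \<Rightarrow> nat \<Rightarrow> 'a mpoly) \<Rightarrow> (nat \<Rightarrow> 'a mpoly) set"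
    where "Ker = (\<lambda>(D, A). {w \<in> FM X (length D). app A (length D) w = (\<lambda>i. 0)})"
  define good :: "(nat \<Rightarrow>\<^sub>0 nat) list \<Rightarrow> (nat \<Rightarrow> 'a mpoly) set \<Rightarrow>
      (nat \<Rightarrow>\<^sub>0 nat) list \<times> (nat \<Rightarrow> nat \<Rightarrow> 'a mpoly) \<Rightarrow> bool"
    where "good = (\<lambda>E K (D, A). (\<forall>d \<in> set D. keys d \<subseteq> X) \<and> ghom X (\<lambda>m. m) D E A \<and>
      app A (length D) ` FM X (length D) = K \<and>
      (\<forall>w \<in> FM X (length D). app A (length D) w = (\<lambda>i. 0) \<longrightarrow> (\<forall>l. lookup (w l) 0 = 0)))"
  have J: "0 \<in> J" "\<And>f g. f \<in> J \<Longrightarrow> g \<in> J \<Longrightarrow> f + g \<in> J" "\<And>p f. p \<in> Pol X \<Longrightarrow> f \<in> J \<Longrightarrow> p * f \<in> J"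
    "\<And>P f. f \<in> J \<Longrightarrow> restr P f \<in> J"
  proof -
    show "f + g \<in> J" if "f \<in> J" "g \<in> J" for f g
      using that keys_add[of f g] by (auto simp: J_def monomial_ideal_def Pol_add)
    show "p * f \<in> J" if "p \<in> Pol X" "f \<in> J" for p f
      using that keys_mult[of p f] U by (fastforce simp: J_def monomial_ideal_def Pol_mult in_Pol_iff[of p])
  qed (auto simp: J_def monomial_ideal_def restr_Pol keys_restr)
  have ex0: "\<exists>s. good [0] K0 s"
  proof -
    have "submod X K0" using J(1-3) by (auto simp: submod_def K0_def FM_add FM_smult)
    moreover have "K0 \<subseteq> FM X (length [0 :: nat \<Rightarrow>\<^sub>0 nat])" by (auto simp: K0_def)
    moreover have "mpart [0] g w \<in> K0" if "w \<in> K0" for w g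
      using that J(4) by (simp add: K0_def FM_vpart) (simp add: vpart_def)
    ultimately show ?thesis
      using minimal_presentation[OF \<open>finite X\<close>, of K0 "[0]"] by (auto simp: good_def)
  qed
  have ex_step: "\<exists>s'. good (fst s) (Ker (fst s, snd s)) s'" if s: "good E K s" for E K s
  proof -
    obtain D A where [simp]: "s = (D, A)" by (cases s)
    have A: "\<forall>d \<in> set D. keys d \<subseteq> X" "ghom X (\<lambda>m. m) D E A" using s by (auto simp: good_def)
    have "submod X (Ker (D, A))"
      by (auto simp: submod_def Ker_def FM_add FM_smult app_add app_smult)
    moreover have "mpart D g w \<in> Ker (D, A)" if "w \<in> Ker (D, A)" for w g
      using that vpart_app[OF A(2), of g w] by (auto simp: Ker_def FM_vpart) (simp add: vpart_def)
    ultimately show ?thesis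
      using minimal_presentation[OF \<open>finite X\<close>, of "Ker (D, A)" D] A(1)
      by (auto simp: good_def Ker_def)
  qed
  \<comment> \<open>The choice remembers only that the current pair presents some module;
    \<open>ex_step\<close> needs nothing more to find a successor.\<close>
  define Good where "Good = (\<lambda>s. \<exists>E K. good E K s)"
  have "\<exists>f. \<forall>n. (Good (f n) \<and> (n = 0 \<longrightarrow> good [0] K0 (f n))) \<and>
      good (fst (f n)) (Ker (fst (f n), snd (f n))) (f (Suc n))"
  proof (rule dependent_nat_choice[where P="\<lambda>n s. Good s \<and> (n = 0 \<longrightarrow> good [0] K0 s)"
        and Q="\<lambda>n s s'. good (fst s) (Ker (fst s, snd s)) s'"])
    show "\<exists>s. Good s \<and> (0 = (0::nat) \<longrightarrow> good [0] K0 s)" using ex0 by (auto simp: Good_def)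
    show "\<exists>s'. (Good s' \<and> (Suc n = 0 \<longrightarrow> good [0] K0 s')) \<and> good (fst s) (Ker (fst s, snd s)) s'"
      if "Good s \<and> (n = 0 \<longrightarrow> good [0] K0 s)" for s n
      using that ex_step unfolding Good_def by blast
  qed
  then obtain f where f: "good [0] K0 (f 0)"
      "\<And>n. good (fst (f n)) (Ker (fst (f n), snd (f n))) (f (Suc n))"
    by blast
  define D where "D = (\<lambda>n. case n of 0 \<Rightarrow> [0] | Suc n \<Rightarrow> fst (f n))"
  define A where "A = (\<lambda>n. snd (f n))"
  have f_eq: "f n = (D (Suc n), A n)" for n by (simp add: D_def A_def)
  have g0: "good [0] K0 (D 1, A 0)" using f(1) by (simp add: f_eq)
  have gS: "good (D (Suc n)) (Ker (D (Suc n), A n)) (D (Suc (Suc n)), A (Suc n))" for n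
    using f(2)[of n] by (simp add: f_eq)
  have gh: "ghom X (\<lambda>m. m) (D (Suc i)) (D i) (A i)" for i
    by (cases i) (use g0 gS in \<open>auto simp: good_def D_def\<close>)
  have cf: "lookup (w l) 0 = 0" if "w \<in> Ker (D (Suc i), A i)" for i w l
    using that g0 gS[of "i - 1"] by (cases i) (auto simp: good_def Ker_def)
  have res: "resolution X (\<lambda>m. m) J D A"
    unfolding resolution_def
  proof (intro conjI allI gh)
    show "D 0 = [0]" by (simp add: D_def)
    show "app (A 0) (length (D 1)) ` FM X (length (D 1)) = {w \<in> FM X 1. w 0 \<in> J}"
      using g0 by (simp add: good_def K0_def)
    show "app (A (Suc i)) (length (D (Suc (Suc i)))) ` FM X (length (D (Suc (Suc i)))) =
      {w \<in> FM X (length (D (Suc i))). app (A i) (length (D (Suc i))) w = (\<lambda>i. 0)}" for i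
      using gS[of i] by (simp add: good_def Ker_def)
  qed
  have "lookup (A (Suc i) k l) 0 = 0" for i k l
  proof (cases "l < length (D (Suc (Suc i)))")
    case True
    then have "app (A (Suc i)) (length (D (Suc (Suc i)))) (\<lambda>i. if i = l then 1 else 0) \<in> Ker (D (Suc i), A i)"
      using gS[of i] unit_FM[OF True, of X] by (auto simp: good_def)
    from cf[OF this, of k] show ?thesis by (simp add: app_unit[OF True])
  next
    case False
    then show ?thesis using ghomD(6)[OF gh] by simp
  qed
  then have "minimal A" by (simp add: minimal_def)
  moreover have "keys d \<subseteq> X" if d: "d \<in> set (D i)" for i d
  proof (cases i)
    case 0
    then show ?thesis using d by (simp add: D_def)
  next
    case (Suc i')
    then show ?thesis using d g0 gS[of "i' - 1"] by (cases i') (auto simp: good_def)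
  qed
  ultimately show thesis using res that unfolding J_def by blast
qed

section \<open>Comparison of resolutions\<close>

definition mm :: "(nat \<Rightarrow> nat \<Rightarrow> 'a::field mpoly) \<Rightarrow> nat \<Rightarrow> (nat \<Rightarrow> nat \<Rightarrow> 'a mpoly) \<Rightarrow> nat \<Rightarrow> nat \<Rightarrow> 'a mpoly"
  where "mm A r B = (\<lambda>i k. \<Sum>j<r. A i j * B j k)"

lemma app_mm: "app A r (app B s w) = app (mm A r B) s w"
  unfolding mm_def by (rule app_app)

lemma mm_column: "(\<lambda>i. mm A r B i l) = app A r (\<lambda>j. B j l)"
  by (simp add: mm_def app_def)

text \<open>At level 0 these are the elements of \<open>J\<close> as vectors of length one. Thus
  exactness at the augmentation and at all later levels becomes the single statement
  \<open>resolutionD(3)\<close>.\<close>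

definition cycles :: "nat set \<Rightarrow> 'a::field mpoly set \<Rightarrow> (nat \<Rightarrow> 'g list) \<Rightarrow> (nat \<Rightarrow> nat \<Rightarrow> nat \<Rightarrow> 'a mpoly) \<Rightarrow>
    nat \<Rightarrow> (nat \<Rightarrow> 'a mpoly) set"
  where "cycles X J D A i = (case i of 0 \<Rightarrow> {w \<in> FM X 1. w 0 \<in> J} |
    Suc i \<Rightarrow> {w \<in> FM X (length (D (Suc i))). app (A i) (length (D (Suc i))) w = (\<lambda>i. 0)})"

lemma resolutionD:
  assumes "resolution X wt J D A"
  shows "D 0 = [0]" "ghom X wt (D (Suc i)) (D i) (A i)"
    "app (A i) (length (D (Suc i))) ` FM X (length (D (Suc i))) = cycles X J D A i"
  using assms by (auto simp: resolution_def cycles_def split: nat.split)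

lemma cycles_FM: "resolution X wt J D A \<Longrightarrow> cycles X J D A i \<subseteq> FM X (length (D i))"
  using resolutionD(1)[of X wt J D A] by (cases i) (auto simp: cycles_def)

lemma column_cycle:
  assumes "resolution X wt J D A" "l < length (D (Suc i))"
  shows "(\<lambda>k. A i k l) \<in> cycles X J D A i"
proof -
  have "app (A i) (length (D (Suc i))) (\<lambda>i. if i = l then 1 else 0) \<in> cycles X J D A i"
    using resolutionD(3)[OF assms(1), of i] unit_FM[OF assms(2), of X] by blast
  then show ?thesis by (simp add: app_unit[OF assms(2)])
qed

text \<open>Matrices without a degree condition, for the homotopies in
  \<open>minimal_resolution_degrees\<close>, whose homogeneity is not tracked.\<close>

definition is_mat :: "nat set \<Rightarrow> nat \<Rightarrow> nat \<Rightarrow> (nat \<Rightarrow> nat \<Rightarrow> 'a::field mpoly) \<Rightarrow> bool"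
  where "is_mat X r s C \<longleftrightarrow> (\<forall>i j. C i j \<in> Pol X \<and> (i \<ge> r \<or> j \<ge> s \<longrightarrow> C i j = 0))"

lemma ghom_is_mat: "ghom X wt D E A \<Longrightarrow> is_mat X (length E) (length D) A"
  using ghomD[of X wt D E A] by (auto simp: is_mat_def)

lemma app_FM_mat: "is_mat X r s C \<Longrightarrow> w \<in> FM X s \<Longrightarrow> app C s w \<in> FM X r"
  by (auto simp: is_mat_def FM_def app_def intro!: Pol_sum Pol_mult)

text \<open>Projectivity of free modules: each column is lifted on its own.\<close>

lemma lift_columns:
  assumes "\<And>l. l < s \<Longrightarrow> (\<lambda>i. C i l) \<in> app B r ` FM X r" "\<And>i l. l \<ge> s \<Longrightarrow> C i l = 0"
  obtains f where "is_mat X r s f" "mm B r f = C"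
proof -
  have "\<forall>l. \<exists>w. l < s \<longrightarrow> w \<in> FM X r \<and> (\<lambda>i. C i l) = app B r w" using assms(1) by blast
  then obtain w where w: "\<And>l. l < s \<Longrightarrow> w l \<in> FM X r \<and> (\<lambda>i. C i l) = app B r (w l)" by metis
  define f where "f = (\<lambda>k l. if l < s then w l k else 0)"
  have "is_mat X r s f" using w by (auto simp: is_mat_def f_def FM_def)
  moreover have "mm B r f i l = C i l" for i l
  proof (cases "l < s")
    case True
    then have "(\<lambda>i. mm B r f i l) = (\<lambda>i. C i l)" using w by (simp add: mm_column f_def)
    then show ?thesis by (rule fun_cong)
  next
    case False
    then show ?thesis using assms(2)[of l i] by (simp add: mm_def f_def)
  qed
  ultimately show thesis by (intro that[of f]) auto
qed

text \<open>Each lifted column is replaced by its component in the degree of that column. As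
  \<open>B\<close> commutes with taking components and the columns of \<open>C\<close> are
  homogeneous, it remains a lift.\<close>

lemma lift_columns_graded:
  assumes "\<And>l. l < length D \<Longrightarrow> (\<lambda>i. C i l) \<in> app B (length D') ` FM X (length D')"
    and C: "ghom X wt D E C" and B: "ghom X wt D' E B" and wt: "\<And>a b. wt (a + b) = wt a + wt b"
  obtains f where "ghom X wt D D' f" "mm B (length D') f = C"
proof -
  obtain f where f: "is_mat X (length D') (length D) f" "mm B (length D') f = C"
    by (rule lift_columns[of "length D" C B "length D'" X]) (use assms(1) ghomD(6)[OF C] in auto)
  define g where "g = (\<lambda>k l. vpart wt D' (D ! l) (\<lambda>j. f j l) k)"
  have "ghom X wt D D' g"
    unfolding ghom_def
  proof (intro allI conjI ballI)
    fix i j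
    show "g i j \<in> Pol X" using f(1) by (auto simp: g_def vpart_def is_mat_def intro: restr_Pol)
    fix m assume "m \<in> keys (g i j)"
    then have m: "m \<in> keys (f i j)" "wt m + D' ! i = D ! j"
      by (auto simp: g_def vpart_def keys_restr)
    then show "wt m + D' ! i = D ! j" by simp
    have "f i j \<noteq> 0" using m(1) by auto
    then show "i < length D'" "j < length D" using f(1) not_le unfolding is_mat_def by blast+
  qed
  moreover have "mm B (length D') g i l = C i l" for i l
  proof -
    have "(\<lambda>i. mm B (length D') g i l) = vpart wt E (D ! l) (app B (length D') (\<lambda>j. f j l))"
      unfolding vpart_app[OF B wt] by (simp add: mm_column g_def)
    also have "app B (length D') (\<lambda>j. f j l) = (\<lambda>i. C i l)"
      unfolding mm_column[symmetric] f(2) ..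
    also have "vpart wt E (D ! l) (\<lambda>i. C i l) = (\<lambda>i. C i l)"
      unfolding vpart_fixed_iff using ghomD(4)[OF C] by blast
    finally show ?thesis by (rule fun_cong)
  qed
  ultimately show thesis by (intro that[of g]) auto
qed

text \<open>Comparison theorem for free resolutions, starting from the identity at level 0.
  Preservation of cycles is the invariant that makes the columns liftable at the next level.\<close>

lemma chain_map:
  fixes D :: "nat \<Rightarrow> 'g::cancel_comm_monoid_add list"
  assumes A: "resolution X wt J D A" and B: "resolution X wt J D' B"
    and wt: "\<And>a b. wt (a + b) = wt a + wt b"
  obtains f where "\<And>i. ghom X wt (D i) (D' i) (f i)"
    "\<And>i. mm (B i) (length (D' (Suc i))) (f (Suc i)) = mm (f i) (length (D i)) (A i)"
    "f 0 = (\<lambda>i j. if i = 0 \<and> j = 0 then 1 else 0)"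
    "\<And>i w. w \<in> cycles X J D A i \<Longrightarrow> app (f i) (length (D i)) w \<in> cycles X J D' B i"
proof -
  define f0 :: "nat \<Rightarrow> nat \<Rightarrow> 'a mpoly" where "f0 = (\<lambda>i j. if i = 0 \<and> j = 0 then 1 else 0)"
  define P where "P = (\<lambda>i f. ghom X wt (D i) (D' i) f \<and>
    (\<forall>w \<in> cycles X J D A i. app f (length (D i)) w \<in> cycles X J D' B i) \<and> (i = 0 \<longrightarrow> f = f0))"
  define R where "R = (\<lambda>i f f'. mm (B i) (length (D' (Suc i))) f' = mm f (length (D i)) (A i))"
  have wt0: "wt 0 = 0" using wt[of 0 0] by simp
  have "\<exists>f. \<forall>n. P n (f n) \<and> R n (f n) (f (Suc n))"
  proof (rule dependent_nat_choice)
    have "ghom X wt (D 0) (D' 0) f0"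
      using wt0 by (auto simp: ghom_def f0_def resolutionD(1)[OF A] resolutionD(1)[OF B])
    moreover have "app f0 1 w = w" if "w \<in> FM X 1" for w
      using that by (auto simp: app_def f0_def FM_def fun_eq_iff)
    ultimately show "\<exists>f. P 0 f"
      unfolding P_def by (intro exI[of _ f0]) (auto simp: cycles_def resolutionD(1)[OF A])
  next
    fix f n assume f: "P n f"
    have gf: "ghom X wt (D n) (D' n) f" using f by (simp add: P_def)
    define C where "C = mm f (length (D n)) (A n)"
    have C: "ghom X wt (D (Suc n)) (D' n) C"
      unfolding ghom_def
    proof (intro allI conjI ballI)
      fix i j
      show "C i j \<in> Pol X" unfolding C_def mm_def
        using ghomD(1)[OF gf] ghomD(1)[OF resolutionD(2)[OF A]] by (intro Pol_sum Pol_mult)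
      fix m assume "m \<in> keys (C i j)"
      then obtain k where "m \<in> keys (f i k * A n k j)"
        using keys_sum[of "\<lambda>k. f i k * A n k j" "{..<length (D n)}"] by (auto simp: C_def mm_def)
      then obtain a b where ab: "m = a + b" "a \<in> keys (f i k)" "b \<in> keys (A n k j)"
        using keys_mult[of "f i k" "A n k j"] by blast
      show "i < length (D' n)" using ghomD(2)[OF gf ab(2)] .
      show "j < length (D (Suc n))" using ghomD(3)[OF resolutionD(2)[OF A] ab(3)] .
      have "wt m + D' n ! i = (wt a + D' n ! i) + wt b" by (simp add: ab(1) wt ac_simps)
      also have "\<dots> = wt b + D n ! k" using ghomD(4)[OF gf ab(2)] by (simp add: ac_simps)
      also have "\<dots> = D (Suc n) ! j" using ghomD(4)[OF resolutionD(2)[OF A] ab(3)] .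
      finally show "wt m + D' n ! i = D (Suc n) ! j" .
    qed
    have "(\<lambda>i. C i l) \<in> app (B n) (length (D' (Suc n))) ` FM X (length (D' (Suc n)))"
      if "l < length (D (Suc n))" for l
      unfolding resolutionD(3)[OF B] C_def mm_column
      using f column_cycle[OF A that] by (simp add: P_def)
    from lift_columns_graded[OF this C resolutionD(2)[OF B] wt]
    obtain f' where f': "ghom X wt (D (Suc n)) (D' (Suc n)) f'"
        "mm (B n) (length (D' (Suc n))) f' = C" by blast
    have "app f' (length (D (Suc n))) w \<in> cycles X J D' B (Suc n)"
      if w: "w \<in> cycles X J D A (Suc n)" for w
    proof -
      have w': "w \<in> FM X (length (D (Suc n)))" "app (A n) (length (D (Suc n))) w = (\<lambda>i. 0)"
        using w by (auto simp: cycles_def)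
      have "app (B n) (length (D' (Suc n))) (app f' (length (D (Suc n))) w) =
          app f (length (D n)) (app (A n) (length (D (Suc n))) w)"
        by (simp add: app_mm f'(2) C_def)
      then show ?thesis using app_FM[OF f'(1) w'(1)] w'(2) by (simp add: cycles_def)
    qed
    then show "\<exists>f'. P (Suc n) f' \<and> R n f f'"
      using f' by (intro exI[of _ f']) (auto simp: P_def R_def C_def)
  qed
  then obtain f where "\<forall>n. P n (f n) \<and> R n (f n) (f (Suc n))" by blast
  then show thesis by (intro that[of f]) (auto simp: P_def R_def f0_def)
qed

text \<open>For chain maps \<open>f\<close>, \<open>g\<close> between the two resolutions, \<open>g f\<close> is homotopic to the identity; since
  the differentials of \<open>A\<close> have no constant terms, the constant part of \<open>g f\<close> is the identity matrix.\<close>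

lemma minimal_resolution_degrees:
  fixes D :: "nat \<Rightarrow> 'g::cancel_comm_monoid_add list"
  assumes A: "resolution X wt J D A" and min: "minimal A" and B: "resolution X wt J D' B"
    and wt: "\<And>a b. wt (a + b) = wt a + wt b"
  shows "set (D (Suc i)) \<subseteq> set (D' (Suc i))"
proof -
  obtain f where f: "\<And>i. ghom X wt (D i) (D' i) (f i)"
    "\<And>i. mm (B i) (length (D' (Suc i))) (f (Suc i)) = mm (f i) (length (D i)) (A i)"
    "f 0 = (\<lambda>i j. if i = 0 \<and> j = 0 then 1 else 0)"
    "\<And>i w. w \<in> cycles X J D A i \<Longrightarrow> app (f i) (length (D i)) w \<in> cycles X J D' B i"
    by (rule chain_map[OF A B wt]) blast
  obtain g where g: "\<And>i. ghom X wt (D' i) (D i) (g i)"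
    "\<And>i. mm (A i) (length (D (Suc i))) (g (Suc i)) = mm (g i) (length (D' i)) (B i)"
    "g 0 = (\<lambda>i j. if i = 0 \<and> j = 0 then 1 else 0)"
    "\<And>i w. w \<in> cycles X J D' B i \<Longrightarrow> app (g i) (length (D' i)) w \<in> cycles X J D A i"
    by (rule chain_map[OF B A wt]) blast
  \<comment> \<open>Deviation of the composition g f from the identity: a chain endomorphism that
    vanishes at level 0.\<close>
  define \<phi> where "\<phi> = (\<lambda>i k l. mm (g i) (length (D' i)) (f i) k l - (if k = l \<and> l < length (D i) then 1 else 0))"
  have app_\<phi>: "app (\<phi> i) (length (D i)) w =
      (\<lambda>k. app (g i) (length (D' i)) (app (f i) (length (D i)) w) k - w k)"
    if "w \<in> FM X (length (D i))" for i w
  proof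
    fix k
    have "app (\<phi> i) (length (D i)) w k =
        (\<Sum>l<length (D i). mm (g i) (length (D' i)) (f i) k l * w l - (if k = l then 1 else 0) * w l)"
      unfolding app_def
    proof (rule sum.cong[OF refl])
      fix l assume "l \<in> {..<length (D i)}"
      then have "(k = l \<and> l < length (D i)) = (k = l)" by blast
      then have "\<phi> i k l = mm (g i) (length (D' i)) (f i) k l - (if k = l then 1 else 0)"
        by (simp only: \<phi>_def)
      then show "\<phi> i k l * w l = mm (g i) (length (D' i)) (f i) k l * w l - (if k = l then 1 else 0) * w l"
        by (simp only: left_diff_distrib)
    qed
    also have "\<dots> = app (mm (g i) (length (D' i)) (f i)) (length (D i)) w k -
        (\<Sum>l<length (D i). (if k = l then 1 else 0) * w l)"
      by (simp only: app_def sum_subtractf)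
    also have "(\<Sum>l<length (D i). (if k = l then 1 else 0) * w l) = w k"
      using that by (auto simp: FM_def if_distrib[of "\<lambda>x. x * _"] cong: if_cong)
    finally show "app (\<phi> i) (length (D i)) w k =
        app (g i) (length (D' i)) (app (f i) (length (D i)) w) k - w k" by (simp add: app_mm)
  qed
  have chain_\<phi>: "app (A i) (length (D (Suc i))) (app (\<phi> (Suc i)) (length (D (Suc i))) w) =
      app (\<phi> i) (length (D i)) (app (A i) (length (D (Suc i))) w)"
    if w: "w \<in> FM X (length (D (Suc i)))" for i w
  proof -
    have Aw: "app (A i) (length (D (Suc i))) w \<in> FM X (length (D i))"
      by (rule app_FM[OF resolutionD(2)[OF A] w])
    have "app (A i) (length (D (Suc i))) (app (g (Suc i)) (length (D' (Suc i)))
            (app (f (Suc i)) (length (D (Suc i))) w)) =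
          app (g i) (length (D' i)) (app (B i) (length (D' (Suc i))) (app (f (Suc i)) (length (D (Suc i))) w))"
      by (subst (1 2) app_mm) (simp add: g(2))
    also have "\<dots> = app (g i) (length (D' i)) (app (f i) (length (D i)) (app (A i) (length (D (Suc i))) w))"
      by (subst (2 4) app_mm) (simp add: f(2))
    finally show ?thesis by (simp add: app_\<phi>[OF w] app_\<phi>[OF Aw] app_diff)
  qed
  \<comment> \<open>On cycles the homotopy identity loses its term with the differential; the
    remaining equation is what the next lifting step uses.\<close>
  define P where "P = (\<lambda>i h. is_mat X (length (D (Suc i))) (length (D i)) h \<and>
    (\<forall>w \<in> cycles X J D A i. app (\<phi> i) (length (D i)) w =
       app (A i) (length (D (Suc i))) (app h (length (D i)) w)) \<and> (i = 0 \<longrightarrow> h = (\<lambda>_ _. 0)))"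
  define R where "R = (\<lambda>i h h'. \<forall>k l. \<phi> (Suc i) k l =
    mm (A (Suc i)) (length (D (Suc (Suc i)))) h' k l + mm h (length (D i)) (A i) k l)"
  have mat_\<phi>: "is_mat X (length (D i)) (length (D i)) (\<phi> i)" for i
    using ghom_is_mat[OF f(1)[of i]] ghom_is_mat[OF g(1)[of i]]
    by (auto simp: is_mat_def \<phi>_def mm_def intro!: Pol_diff Pol_sum Pol_mult)
  have "\<exists>h. \<forall>n. P n (h n) \<and> R n (h n) (h (Suc n))"
  proof (rule dependent_nat_choice)
    have "\<phi> 0 = (\<lambda>_ _. 0)"
      by (auto simp: \<phi>_def mm_def f(3) g(3) resolutionD(1)[OF A] resolutionD(1)[OF B] fun_eq_iff)
    then show "\<exists>h. P 0 h" by (intro exI[of _ "\<lambda>_ _. 0"]) (auto simp: P_def is_mat_def app_def)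
  next
    fix h n assume h: "P n h"
    have mh: "is_mat X (length (D (Suc n))) (length (D n)) h" using h by (simp add: P_def)
    have mA: "is_mat X (length (D n)) (length (D (Suc n))) (A n)"
      by (rule ghom_is_mat[OF resolutionD(2)[OF A]])
    \<comment> \<open>The part of \<open>\<phi>\<close> that the homotopy found so far does not
      account for; its columns are cycles and can be lifted.\<close>
    define C where "C = (\<lambda>k l. \<phi> (Suc n) k l - mm h (length (D n)) (A n) k l)"
    have "(\<lambda>i. C i l) \<in> app (A (Suc n)) (length (D (Suc (Suc n)))) ` FM X (length (D (Suc (Suc n))))"
      if l: "l < length (D (Suc n))" for l
    proof -
      define e where "e = (\<lambda>i. if i = l then 1 else (0 :: 'a mpoly))"
      have e: "e \<in> FM X (length (D (Suc n)))" using unit_FM[OF l] by (simp add: e_def)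
      define a where "a = app (A n) (length (D (Suc n))) e"
      have a: "a \<in> cycles X J D A n" using column_cycle[OF A l] by (simp add: a_def e_def app_unit[OF l])
      have Cl: "(\<lambda>i. C i l) = (\<lambda>i. app (\<phi> (Suc n)) (length (D (Suc n))) e i - app h (length (D n)) a i)"
        unfolding C_def a_def e_def app_unit[OF l] by (simp add: mm_def app_def)
      have "app (A n) (length (D (Suc n))) (\<lambda>i. C i l) = (\<lambda>i. 0)"
        unfolding Cl app_diff chain_\<phi>[OF e] a_def[symmetric] using h a by (simp add: P_def)
      moreover have "(\<lambda>i. C i l) \<in> FM X (length (D (Suc n)))"
        unfolding Cl using mat_\<phi> mh e a cycles_FM[OF A, of n] by (intro FM_diff app_FM_mat) auto
      ultimately show ?thesis unfolding resolutionD(3)[OF A] by (simp add: cycles_def)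
    qed
    moreover have "C i l = 0" if "l \<ge> length (D (Suc n))" for i l
      using that mat_\<phi>[of "Suc n"] mA by (simp add: C_def is_mat_def mm_def)
    ultimately obtain h' where h': "is_mat X (length (D (Suc (Suc n)))) (length (D (Suc n))) h'"
      "mm (A (Suc n)) (length (D (Suc (Suc n)))) h' = C"
      by (rule lift_columns)
    have R: "R n h h'" by (simp add: R_def h'(2) C_def)
    have "app (\<phi> (Suc n)) (length (D (Suc n))) w =
        app (A (Suc n)) (length (D (Suc (Suc n)))) (app h' (length (D (Suc n))) w)"
      if w: "w \<in> cycles X J D A (Suc n)" for w
    proof -
      have "app (\<phi> (Suc n)) (length (D (Suc n))) w = (\<lambda>i. app C (length (D (Suc n))) w i +
          app h (length (D n)) (app (A n) (length (D (Suc n))) w) i)"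
        by (simp add: app_mm C_def) (simp add: app_def left_diff_distrib sum_subtractf)
      also have "app (A n) (length (D (Suc n))) w = (\<lambda>i. 0)" using w by (simp add: cycles_def)
      finally show ?thesis by (simp add: app_mm h'(2))
    qed
    with h'(1) R show "\<exists>h'. P (Suc n) h' \<and> R n h h'"
      by (intro exI[of _ h']) (auto simp: P_def)
  qed
  then obtain h where h: "\<And>n. P n (h n)" "\<And>n. R n (h n) (h (Suc n))" by blast
  have const_mm: "lookup (mm M r N k l) 0 = (\<Sum>j<r. lookup (M k j) 0 * lookup (N j l) 0)" for M r N k l
    by (simp add: mm_def lookup_sum lookup_times_0)
  \<comment> \<open>\<open>minimal A\<close> says nothing about \<open>A 0\<close>; at this level
    the second summand vanishes because the homotopy starts with zero.\<close>
  have const_\<phi>: "lookup (\<phi> (Suc i) k l) 0 = 0" for i k l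
  proof -
    have "lookup (mm (A (Suc i)) (length (D (Suc (Suc i)))) (h (Suc i)) k l) 0 = 0"
      using min by (simp add: const_mm minimal_def)
    moreover have "lookup (mm (h i) (length (D i)) (A i) k l) 0 = 0"
      using min h(1)[of i] by (cases i) (simp_all add: const_mm minimal_def P_def)
    ultimately show ?thesis using h(2)[of i] by (simp add: R_def lookup_add)
  qed
  show ?thesis
  proof
    fix d assume "d \<in> set (D (Suc i))"
    then obtain l where l: "l < length (D (Suc i))" "d = D (Suc i) ! l" by (auto simp: in_set_conv_nth)
    \<comment> \<open>A diagonal entry of g f has constant term 1, so column \<open>l\<close> of f
      has an entry with a nonzero constant term. Homogeneity of f at the exponent 0 makes the two
      basis degrees equal.\<close>
    have "lookup (mm (g (Suc i)) (length (D' (Suc i))) (f (Suc i)) l l) 0 = 1"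
      using const_\<phi>[of i l l] l(1) by (simp add: \<phi>_def lookup_minus)
    then have "(\<Sum>k<length (D' (Suc i)). lookup (g (Suc i) l k) 0 * lookup (f (Suc i) k l) 0) \<noteq> 0"
      by (simp add: const_mm)
    then obtain k where k: "k < length (D' (Suc i))" "lookup (f (Suc i) k l) 0 \<noteq> 0"
      by (metis (no_types, lifting) lessThan_iff mult_zero_right sum.neutral)
    then have "0 \<in> keys (f (Suc i) k l)" by (simp add: in_keys_iff)
    from ghomD(4)[OF f(1) this] have "wt 0 + D' (Suc i) ! k = d" using l by simp
    moreover have "wt 0 = 0" using wt[of 0 0] by simp
    ultimately show "d \<in> set (D' (Suc i))" using k(1) by auto
  qed
qed

section \<open>Multidegrees of a minimal resolution\<close>

text \<open>Membership in the ideal generated by the variables with index in \<open>Y\<close>, so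
  that calculations modulo these variables can be done without a quotient ring.\<close>

definition touches :: "nat set \<Rightarrow> 'a::field mpoly \<Rightarrow> bool"
  where "touches Y p \<longleftrightarrow> (\<forall>m \<in> keys p. keys m \<inter> Y \<noteq> {})"

lemma touches_0 [simp]: "touches Y 0" by (simp add: touches_def)

lemma touches_mono: "touches Y p \<Longrightarrow> Y \<subseteq> Z \<Longrightarrow> touches Z p"
  by (fastforce simp: touches_def)

lemma touches_add: "touches Y p \<Longrightarrow> touches Y q \<Longrightarrow> touches Y (p + q)"
  using keys_add[of p q] by (fastforce simp: touches_def)

lemma touches_uminus: "touches Y (- p) \<longleftrightarrow> touches Y p"
  by (auto simp: touches_def in_keys_iff)

lemma touches_times: "touches Y q \<Longrightarrow> touches Y (p * q)"
  using keys_mult[of p q] by (fastforce simp: touches_def keys_add_nat)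

lemma touches_sum: "(\<And>i. i \<in> A \<Longrightarrow> touches Y (f i)) \<Longrightarrow> touches Y (sum f A)"
  by (induction A rule: infinite_finite_induct) (auto intro: touches_add)

lemma touches_app: "(\<And>k. touches Y (w k)) \<Longrightarrow> touches Y (app A r w i)"
  by (auto simp: app_def intro!: touches_sum touches_times)

lemma touches_restr: "touches Y p \<Longrightarrow> touches Y (restr P p)"
  by (auto simp: touches_def keys_restr)

lemma touches_unit_times: "x \<in> Y \<Longrightarrow> touches Y (mon (unit_exp x) * p)"
  by (auto simp: touches_def keys_mon_times keys_add_nat)

lemma touches_unit_timesD: "touches Y (mon (unit_exp x) * p) \<Longrightarrow> x \<notin> Y \<Longrightarrow> touches Y p"
  by (fastforce simp: touches_def keys_mon_times keys_add_nat)

lemma divide_by_variable: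
  fixes p :: "'a::field mpoly"
  assumes "p \<in> Pol X" "\<And>m. m \<in> keys p \<Longrightarrow> x \<in> keys m"
  obtains q where "q \<in> Pol X" "p = mon (unit_exp x) * q"
proof -
  define q where "q = (\<Sum>m \<in> keys p. Poly_Mapping.single (m - unit_exp x) (lookup p m))"
  have *: "unit_exp x + (m - unit_exp x) = m" if "m \<in> keys p" for m
    using assms(2)[OF that] by (intro exp_add_diff) (auto simp: lookup_single when_def in_keys_iff)
  have "mon (unit_exp x) * q = (\<Sum>m \<in> keys p. Poly_Mapping.single m (lookup p m))"
    unfolding q_def sum_distrib_left by (intro sum.cong) (simp_all add: mult_single *)
  then have "p = mon (unit_exp x) * q" using poly_eq_sum[of p] by simp
  moreover have "q \<in> Pol X"
    unfolding q_def
  proof (intro Pol_sum Pol_single)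
    fix m assume m: "m \<in> keys p"
    have "keys (m - unit_exp x) \<subseteq> keys m" using *[OF m] keys_add_nat by (metis Un_upper2)
    then show "keys (m - unit_exp x) \<subseteq> X" using m assms(1) by (auto simp: in_Pol_iff)
  qed
  ultimately show thesis by (intro that)
qed

text \<open>The monomials of \<open>p\<close> that avoid \<open>Y\<close> are all divisible by the
  variable \<open>x\<close>. Dividing just these keeps the degrees of the quotient under
  control.\<close>

lemma split_variable:
  fixes p :: "'a::field mpoly"
  assumes "p \<in> Pol X" "touches (insert x Y) p"
  obtains q where "q \<in> Pol X" "touches Y (p - mon (unit_exp x) * q)"
    "\<And>m. m \<in> keys q \<Longrightarrow> unit_exp x + m \<in> keys p"
proof -
  let ?P = "\<lambda>m. keys m \<inter> Y = {}"
  have "x \<in> keys m" if "m \<in> keys (restr ?P p)" for m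
    using that assms(2) by (auto simp: keys_restr touches_def)
  then obtain q where q: "q \<in> Pol X" "restr ?P p = mon (unit_exp x) * q"
    using divide_by_variable[OF restr_Pol[OF assms(1)]] by metis
  have "p - mon (unit_exp x) * q = restr (\<lambda>m. \<not> ?P m) p"
    using restr_split[of p ?P] unfolding q(2)[symmetric] by (simp add: diff_eq_eq add.commute)
  then have "touches Y (p - mon (unit_exp x) * q)" by (simp add: touches_def keys_restr)
  moreover have "unit_exp x + m \<in> keys p" if "m \<in> keys q" for m
  proof -
    have "unit_exp x + m \<in> keys (restr ?P p)" unfolding q(2) keys_mon_times using that by blast
    then show ?thesis by (simp add: keys_restr)
  qed
  ultimately show thesis using q(1) by (intro that)
qed

lemma mon_cancel: "mon u * p = 0 \<longleftrightarrow> p = (0 :: 'a::field mpoly)"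
  using keys_mon_times[of u p] by (metis image_is_empty keys_eq_empty mult_zero_right)

text \<open>If multiplication by \<open>x\<^sub>j\<close> is bijective on \<open>J\<close> in all degrees \<open>b\<close> between \<open>a - 1\<close> and \<open>a\<close>
  with \<open>b\<^sub>j = a\<^sub>j\<close>, then the resolution modulo \<open>x\<^sub>j\<close> is exact in these degrees.  Exactness is
  preserved when the remaining variables are factored out one at a time, so no basis element
  can have degree \<open>a\<close>.\<close>

lemma minimal_multidegree:
  fixes A :: "nat \<Rightarrow> nat \<Rightarrow> nat \<Rightarrow> 'a::field mpoly"
  assumes "finite X" and res: "resolution X (\<lambda>m. m) (monomial_ideal X U) D A" and min: "minimal A"
    and a: "a \<in> set (D (Suc i0))" and j: "j \<in> X"
  shows "\<exists>b. exp_le b a \<and> (\<forall>k. lookup a k \<le> lookup b k + 1) \<and> lookup b j = lookup a j \<and> b \<in> U \<and>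
    (lookup b j = 0 \<or> b - unit_exp j \<notin> U)"
proof (rule ccontr)
  \<comment> \<open>Width one is enough because each variable is factored out only once.\<close>
  define R where "R = (\<lambda>b. exp_le b a \<and> (\<forall>k. lookup a k \<le> lookup b k + 1))"
  assume neg: "\<not> ?thesis"
  \<comment> \<open>The negated claim: a monomial of \<open>J\<close> in such a degree can be
    divided by the variable \<open>j\<close> without leaving \<open>J\<close>.\<close>
  have H: "lookup b j \<noteq> 0 \<and> b - unit_exp j \<in> U" if "R b" "lookup b j = lookup a j" "b \<in> U" for b
  proof (rule ccontr)
    assume "\<not> ?thesis"
    with that have "exp_le b a \<and> (\<forall>k. lookup a k \<le> lookup b k + 1) \<and> lookup b j = lookup a j \<and> b \<in> U \<and>
      (lookup b j = 0 \<or> b - unit_exp j \<notin> U)" by (auto simp: R_def)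
    with neg show False by (rule notE[OF _ exI])
  qed
  define r where "r = (\<lambda>i. length (D i))"
  have resD: "D 0 = [0]" "\<And>i. ghom X (\<lambda>m. m) (D (Suc i)) (D i) (A i)"
    "\<And>i. app (A i) (r (Suc i)) ` FM X (r (Suc i)) = cycles X (monomial_ideal X U) D A i"
    by (simp_all only: r_def resolutionD[OF res])
  \<comment> \<open>Exactness in degree \<open>b\<close> modulo the variables in \<open>Y\<close>:
    cycles modulo \<open>Y\<close> are boundaries modulo \<open>Y\<close>. At \<open>i = 0\<close>
    every element counts as a cycle, since \<open>J\<close> modulo the variable \<open>j\<close> is
    zero in the relevant degrees.\<close>
  define E where "E = (\<lambda>i Y b. \<forall>z \<in> FM X (r (Suc i)). mpart (D (Suc i)) b z = z \<longrightarrow>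
    (i = 0 \<or> (\<forall>k. touches Y (app (A i) (r (Suc i)) z k))) \<longrightarrow>
    (\<exists>u \<in> FM X (r (Suc (Suc i))). \<forall>k. touches Y (z k - app (A (Suc i)) (r (Suc (Suc i))) u k)))"
  have E_D: "\<exists>u \<in> FM X (r (Suc (Suc i))). \<forall>k. touches Y (z k - app (A (Suc i)) (r (Suc (Suc i))) u k)"
    if "E i Y b" "z \<in> FM X (r (Suc i))" "mpart (D (Suc i)) b z = z"
      "i = 0 \<or> (\<forall>k. touches Y (app (A i) (r (Suc i)) z k))" for i Y b z
    using mp[OF mp[OF bspec[OF that(1)[unfolded E_def] that(2)] that(3)] that(4)] .
  have AA: "app (A i) (r (Suc i)) (app (A (Suc i)) (r (Suc (Suc i))) w) = (\<lambda>k. 0)"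
    if "w \<in> FM X (r (Suc (Suc i)))" for w i
  proof -
    have "app (A (Suc i)) (r (Suc (Suc i))) w \<in> cycles X (monomial_ideal X U) D A (Suc i)"
      unfolding resD(3)[symmetric] using that by (rule imageI)
    then show ?thesis by (simp add: cycles_def r_def)
  qed
  have ker: "\<exists>u \<in> FM X (r (Suc (Suc i))). w = app (A (Suc i)) (r (Suc (Suc i))) u"
    if "w \<in> FM X (r (Suc i))" "app (A i) (r (Suc i)) w = (\<lambda>k. 0)" for w i
  proof -
    have "w \<in> cycles X (monomial_ideal X U) D A (Suc i)"
      using that by (simp add: cycles_def r_def)
    then show ?thesis using resD(3)[of "Suc i"] by blast
  qed
  have appFM: "app (A i) (r (Suc i)) w \<in> FM X (r i)" if "w \<in> FM X (r (Suc i))" for w i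
    using app_FM[OF resD(2) that] by (simp add: r_def)
  have appPart: "mpart (D i) b (app (A i) (r (Suc i)) w) = app (A i) (r (Suc i)) (mpart (D (Suc i)) b w)" for b i w
    using vpart_app[OF resD(2)[of i], of b w] by (simp add: r_def)
  let ?x = "\<lambda>k. mon (unit_exp k) :: 'a mpoly"
  have xPol: "?x k \<in> Pol X" if "k \<in> X" for k using that by simp
  \<comment> \<open>The image of \<open>z\<close> is divisible by the variable \<open>j\<close>, and
    the quotient is again the image of some \<open>w\<close>: by \<open>H\<close> at the
    augmentation, by exactness at later levels. Subtracting the multiple of \<open>w\<close> from
    \<open>z\<close> then gives a cycle, hence a boundary.\<close>
  have base: "E i {j} b" if b: "R b" "lookup b j = lookup a j" for i b
    unfolding E_def
  proof (intro ballI impI)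
    fix z assume z: "z \<in> FM X (r (Suc i))" "mpart (D (Suc i)) b z = z"
      "i = 0 \<or> (\<forall>k. touches {j} (app (A i) (r (Suc i)) z k))"
    have "\<exists>w \<in> FM X (r (Suc i)). app (A i) (r (Suc i)) z = (\<lambda>k. ?x j * app (A i) (r (Suc i)) w k)"
    proof (cases i)
      case 0
      define v where "v = app (A 0) (r 1) z"
      have "v \<in> cycles X (monomial_ideal X U) D A 0"
        using resD(3)[of 0] z(1) 0 by (auto simp: v_def)
      then have v: "v \<in> FM X 1" "v 0 \<in> monomial_ideal X U" by (auto simp: cycles_def)
      have "mpart [0] b v = v"
        using appPart[of 0 b z] z(2) 0 by (simp add: v_def resD(1))
      then have kb: "keys (v 0) \<subseteq> {b}" unfolding vpart_fixed_iff by (metis (no_types, lifting) add.right_neutral insertI1 nth_Cons_0 subsetI)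
      show ?thesis
      proof (cases "v 0 = 0")
        case True
        then have "v k = 0" for k using v(1) by (cases k) (auto simp: FM_def)
        then have "v = (\<lambda>k. 0)" by blast
        then show ?thesis using 0 by (intro bexI[of _ "\<lambda>k. 0"]) (auto simp: v_def)
      next
        case False
        then have kb': "keys (v 0) = {b}" using kb by (metis keys_eq_empty subset_singletonD)
        then have "b \<in> U" using v(2) by (auto simp: monomial_ideal_def)
        from H[OF b this] have bU: "lookup b j \<noteq> 0" "b - unit_exp j \<in> U" by auto
        have bX: "keys b \<subseteq> X" using v(2) kb' by (auto simp: monomial_ideal_def in_Pol_iff)
        have bj: "unit_exp j + (b - unit_exp j) = b"
          using bU(1) by (intro exp_add_diff) (auto simp: lookup_single when_def)
        define f where "f = Poly_Mapping.single (b - unit_exp j) (lookup (v 0) b)"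
        have "keys (b - unit_exp j) \<subseteq> X" using bX bj keys_add_nat by (metis Un_subset_iff)
        then have "f \<in> monomial_ideal X U" using bU(2) by (auto simp: monomial_ideal_def f_def)
        then have "(\<lambda>k. if k = 0 then f else 0) \<in> cycles X (monomial_ideal X U) D A 0"
          by (auto simp: cycles_def FM_def monomial_ideal_def)
        then obtain w where w: "w \<in> FM X (r 1)" "(\<lambda>k. if k = 0 then f else 0) = app (A 0) (r 1) w"
          using resD(3)[of 0] by auto
        have "?x j * f = Poly_Mapping.single b (lookup (v 0) b)" by (simp add: f_def mult_single bj)
        also have "\<dots> = v 0" using poly_eq_sum[of "v 0"] kb' by simp
        finally have "v = (\<lambda>k. ?x j * app (A 0) (r 1) w k)"
          unfolding w(2)[symmetric] using v(1) by (auto simp: FM_def fun_eq_iff)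
        then show ?thesis using w(1) 0 by (intro bexI[of _ w]) (auto simp: v_def)
      qed
    next
      case (Suc i')
      define v where "v = app (A i) (r (Suc i)) z"
      have v: "v \<in> FM X (r i)" using appFM[OF z(1)] by (simp add: v_def)
      have "\<exists>q. q \<in> Pol X \<and> v k = ?x j * q" for k
      proof -
        have "v k \<in> Pol X" using v by (auto simp: FM_def)
        moreover have "j \<in> keys m" if "m \<in> keys (v k)" for m
          using z(3) Suc that by (auto simp: touches_def v_def)
        ultimately show ?thesis using divide_by_variable[of "v k" X j] by metis
      qed
      then obtain q where q: "\<And>k. q k \<in> Pol X" "\<And>k. v k = ?x j * q k" by metis
      have "q k = 0" if "k \<ge> r i" for k
      proof -
        have "v k = 0" using v that by (simp add: FM_def)
        then show ?thesis using q(2)[of k] mon_cancel by metis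
      qed
      then have qF: "q \<in> FM X (r (Suc i'))" using q(1) Suc by (auto simp: FM_def)
      have "(\<lambda>k. 0) = app (A i') (r (Suc i')) v" using AA[of z i'] z(1) Suc by (simp add: v_def)
      also have "v = (\<lambda>k. ?x j * q k)" using q(2) by blast
      finally have "(\<lambda>k. ?x j * app (A i') (r (Suc i')) q k) = (\<lambda>k. 0)" by (simp add: app_smult)
      then have "?x j * app (A i') (r (Suc i')) q k = 0" for k by meson
      then have "app (A i') (r (Suc i')) q = (\<lambda>k. 0)" using mon_cancel by blast
      then obtain w where "w \<in> FM X (r (Suc i))" "q = app (A i) (r (Suc i)) w"
        using ker[OF qF] Suc by blast
      then show ?thesis using q(2) by (intro bexI[of _ w]) (auto simp: v_def fun_eq_iff)
    qed
    then obtain w where w: "w \<in> FM X (r (Suc i))"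
      "app (A i) (r (Suc i)) z = (\<lambda>k. ?x j * app (A i) (r (Suc i)) w k)" by blast
    have "app (A i) (r (Suc i)) (\<lambda>k. z k - ?x j * w k) = (\<lambda>k. 0)"
      by (simp add: app_diff app_smult w(2))
    moreover have "(\<lambda>k. z k - ?x j * w k) \<in> FM X (r (Suc i))"
      using z(1) w(1) xPol[OF j] by (intro FM_diff FM_smult)
    ultimately obtain u where u: "u \<in> FM X (r (Suc (Suc i)))"
      "(\<lambda>k. z k - ?x j * w k) = app (A (Suc i)) (r (Suc (Suc i))) u" using ker by blast
    have "z k - app (A (Suc i)) (r (Suc (Suc i))) u k = ?x j * w k" for k
      using fun_cong[OF u(2), of k] by (simp add: algebra_simps)
    then show "\<exists>u \<in> FM X (r (Suc (Suc i))). \<forall>k. touches {j} (z k - app (A (Suc i)) (r (Suc (Suc i))) u k)"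
      using u(1) by (intro bexI[of _ u]) (auto simp: touches_unit_times)
  qed
  \<comment> \<open>\<open>b\<close> agrees with \<open>a\<close> at every variable that is factored
    out, so lowering it once by the newest one stays in \<open>R\<close>.\<close>
  have "E i (insert j Y) b"
    if "finite Y" "Y \<subseteq> X" "R b" "\<And>k. k \<in> insert j Y \<Longrightarrow> lookup b k = lookup a k" for Y i b
    using that
  proof (induction Y arbitrary: i b rule: finite_induct)
    case empty
    then show ?case using base by simp
  next
    case (insert x Y')
    show ?case
    proof (cases "x \<in> insert j Y'")
      case True
      then have "insert j (insert x Y') = insert j Y'" by blast
      with insert show ?thesis by auto
    next
      case x: False
      define Y where "Y = insert j Y'"
      have Yx: "insert j (insert x Y') = insert x Y" by (auto simp: Y_def)
      have IH: "E i Y c" if "R c" "\<And>k. k \<in> Y \<Longrightarrow> lookup c k = lookup a k" for i c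
        using insert.IH[of c i] that insert.prems(1) by (auto simp: Y_def)
      have bY: "\<And>k. k \<in> Y \<Longrightarrow> lookup b k = lookup a k" "lookup b x = lookup a x"
        using insert.prems(3) by (auto simp: Y_def)
      have EY: "E i Y b" for i using IH[OF insert.prems(2) bY(1)] .
      show ?thesis
        unfolding Yx E_def
      proof (intro ballI impI)
        fix z assume z: "z \<in> FM X (r (Suc i))" "mpart (D (Suc i)) b z = z"
          "i = 0 \<or> (\<forall>k. touches (insert x Y) (app (A i) (r (Suc i)) z k))"
        have *: "\<exists>u \<in> FM X (r (Suc (Suc i))). \<forall>k. touches (insert x Y) (z k - app (A (Suc i)) (r (Suc (Suc i))) u k)"
          if ty: "i = 0 \<or> (\<forall>k. touches Y (app (A i) (r (Suc i)) z k))"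
        proof -
          obtain u where "u \<in> FM X (r (Suc (Suc i)))"
              "\<forall>k. touches Y (z k - app (A (Suc i)) (r (Suc (Suc i))) u k)"
            using E_D[OF EY[of i] z(1,2) ty] by blast
          then show ?thesis using touches_mono[of Y _ "insert x Y"] by blast
        qed
        show "\<exists>u \<in> FM X (r (Suc (Suc i))). \<forall>k. touches (insert x Y) (z k - app (A (Suc i)) (r (Suc (Suc i))) u k)"
        proof (cases i)
          case (Suc i')
          define d where "d = app (A i) (r (Suc i)) z"
          have d: "d \<in> FM X (r i)" "mpart (D i) b d = d" "\<And>k. touches (insert x Y) (d k)"
            using appFM[OF z(1)] appPart[of i b z] z(2,3) Suc by (auto simp: d_def)
          \<comment> \<open>Modulo \<open>Y\<close>, the differential \<open>d\<close> of
            \<open>z\<close> is the variable \<open>x\<close> times a vector \<open>w\<close> whose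
            degree is \<open>b\<close> lowered by one at \<open>x\<close>.\<close>
          have "\<exists>q. q \<in> Pol X \<and> touches Y (d k - ?x x * q) \<and> (\<forall>m \<in> keys q. unit_exp x + m \<in> keys (d k))" for k
            using split_variable[OF _ d(3), of k X] d(1) by (metis (mono_tags, lifting) FM_def mem_Collect_eq)
          then obtain w where w: "\<And>k. w k \<in> Pol X" "\<And>k. touches Y (d k - ?x x * w k)"
            "\<And>k m. m \<in> keys (w k) \<Longrightarrow> unit_exp x + m \<in> keys (d k)" by metis
          show ?thesis
          proof (cases "\<forall>k. w k = 0")
            case True
            then have "\<forall>k. touches Y (d k)" using w(2) by (metis diff_zero mult_zero_right)
            then show ?thesis using * by (simp add: d_def)
          next
            case False
            then obtain k0 m0 where m0: "m0 \<in> keys (w k0)" by (metis keys_eq_empty ex_in_conv)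
            define b' where "b' = m0 + D i ! k0"
            have "(unit_exp x + m0) + D i ! k0 = b"
              using w(3)[OF m0] d(2) unfolding vpart_fixed_iff by blast
            then have b': "b = unit_exp x + b'" by (simp add: b'_def add.assoc)
            have "w k = 0" if "k \<ge> r i" for k
            proof -
              have "d k = 0" using d(1) that by (simp add: FM_def)
              then have "m \<notin> keys (w k)" for m using w(3)[of m k] by auto
              then have "keys (w k) = {}" by blast
              then show ?thesis by simp
            qed
            then have wF: "w \<in> FM X (r (Suc i'))" using w(1) Suc by (auto simp: FM_def)
            have whom: "mpart (D (Suc i')) b' w = w"
              unfolding vpart_fixed_iff
            proof (intro allI ballI)
              fix k m assume "m \<in> keys (w k)"
              then have "unit_exp x + m + D i ! k = b"
                using w(3) d(2) unfolding vpart_fixed_iff by blast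
              then have "unit_exp x + (m + D i ! k) = unit_exp x + b'" using b' by (simp add: add.assoc)
              then show "m + D (Suc i') ! k = b'" using Suc by simp
            qed
            have lb: "lookup b k = (if k = x then 1 else 0) + lookup b' k" for k
              by (auto simp: b' lookup_add lookup_single when_def)
            have Rb': "R b'"
              unfolding R_def exp_le_def
            proof (intro conjI allI)
              fix k
              have "lookup b k \<le> lookup a k" "lookup a k \<le> lookup b k + 1"
                using insert.prems(2) by (auto simp: R_def exp_le_def)
              then show "lookup b' k \<le> lookup a k" "lookup a k \<le> lookup b' k + 1"
                using lb[of k] bY(2) by (auto split: if_splits)
            qed
            have "lookup b' k = lookup a k" if "k \<in> Y" for k
              using bY(1)[OF that] lb[of k] that x by (auto simp: Y_def split: if_splits)
            then have EIH: "E i' Y b'" using IH Rb' by blast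
            \<comment> \<open>As \<open>x\<close> is not in \<open>Y\<close>, multiplication by this
              variable is injective modulo \<open>Y\<close>, so \<open>w\<close> is a cycle modulo
              \<open>Y\<close>.\<close>
            have Aw: "touches Y (app (A i') (r (Suc i')) w k)" for k
            proof -
              have "app (A i') (r (Suc i')) d k = 0" using AA[of z i'] z(1) Suc by (simp add: d_def)
              moreover have "app (A i') (r (Suc i')) (\<lambda>k. d k - ?x x * w k) k =
                  app (A i') (r (Suc i')) d k - ?x x * app (A i') (r (Suc i')) w k"
                by (simp add: app_diff app_smult)
              moreover have "touches Y (app (A i') (r (Suc i')) (\<lambda>k. d k - ?x x * w k) k)"
                using w(2) by (intro touches_app)
              ultimately have "touches Y (?x x * app (A i') (r (Suc i')) w k)"
                by (simp add: touches_uminus)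
              then show ?thesis using x by (auto simp: Y_def dest: touches_unit_timesD)
            qed
            obtain u' where u': "u' \<in> FM X (r (Suc (Suc i')))"
              "\<forall>k. touches Y (w k - app (A (Suc i')) (r (Suc (Suc i'))) u' k)"
              using E_D[OF EIH wF whom] Aw by blast
            define u where "u = mpart (D (Suc i)) b' u'"
            have uF: "u \<in> FM X (r (Suc i))" using u'(1) Suc by (simp add: u_def FM_vpart)
            have uw: "touches Y (w k - app (A i) (r (Suc i)) u k)" for k
            proof -
              have "app (A i) (r (Suc i)) u = mpart (D i) b' (app (A i) (r (Suc i)) u')"
                by (simp add: appPart u_def)
              then have "w k - app (A i) (r (Suc i)) u k =
                  mpart (D i) b' w k - mpart (D i) b' (app (A i) (r (Suc i)) u') k"
                using whom Suc by simp
              also have "\<dots> = restr (\<lambda>m. m + D i ! k = b') (w k - app (A i) (r (Suc i)) u' k)"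
                by (simp add: vpart_def restr_diff)
              finally show ?thesis using u'(2) Suc by (simp add: touches_restr)
            qed
            \<comment> \<open>Modulo \<open>Y\<close>, \<open>w\<close> is the boundary of
              \<open>u\<close>. So this correction makes \<open>z\<close> a cycle modulo
              \<open>Y\<close> and changes it only by a multiple of the variable
              \<open>x\<close>.\<close>
            define z' where "z' = (\<lambda>k. z k - ?x x * u k)"
            have xX: "x \<in> X" using insert.prems(1) by simp
            have z'F: "z' \<in> FM X (r (Suc i))"
              unfolding z'_def using z(1) uF xPol[OF xX] by (intro FM_diff FM_smult)
            have "mpart (D (Suc i)) b z' = z'"
              unfolding vpart_fixed_iff
            proof (intro allI ballI)
              fix k m assume "m \<in> keys (z' k)"
              then have "m \<in> keys (z k) \<or> m \<in> keys (?x x * u k)"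
                unfolding z'_def using keys_diff[of "z k" "?x x * u k"] by blast
              then show "m + D (Suc i) ! k = b"
              proof
                assume "m \<in> keys (?x x * u k)"
                then have "m \<in> (+) (unit_exp x) ` keys (u k)" by (simp only: keys_mon_times)
                then obtain m' where m': "m = unit_exp x + m'" "m' \<in> keys (u k)" by (rule imageE)
                then have "m' + D (Suc i) ! k = b'" by (simp add: u_def vpart_def keys_restr)
                then show ?thesis using m'(1) b' by (simp add: add.assoc)
              qed (use z(2) in \<open>auto simp: vpart_fixed_iff\<close>)
            qed
            note z'hom = this
            have "touches Y (app (A i) (r (Suc i)) z' k)" for k
            proof -
              have "app (A i) (r (Suc i)) z' k = (d k - ?x x * w k) + ?x x * (w k - app (A i) (r (Suc i)) u k)"
                by (simp add: z'_def app_diff app_smult d_def right_diff_distrib)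
              then show ?thesis using w(2) uw by (simp add: touches_add touches_times)
            qed
            then obtain u2 where u2: "u2 \<in> FM X (r (Suc (Suc i)))"
              "\<forall>k. touches Y (z' k - app (A (Suc i)) (r (Suc (Suc i))) u2 k)"
              using E_D[OF EY[of i] z'F z'hom] by blast
            have "touches (insert x Y) (z k - app (A (Suc i)) (r (Suc (Suc i))) u2 k)" for k
            proof -
              have "z k - app (A (Suc i)) (r (Suc (Suc i))) u2 k =
                  (z' k - app (A (Suc i)) (r (Suc (Suc i))) u2 k) + ?x x * u k" by (simp add: z'_def)
              moreover have "touches (insert x Y) (z' k - app (A (Suc i)) (r (Suc (Suc i))) u2 k)"
                using u2(2) touches_mono by blast
              ultimately show ?thesis by (simp only: touches_add touches_unit_times insertI1)
            qed
            then show ?thesis using u2(1) by blast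
          qed
        qed (use * in simp)
      qed
    qed
  qed
  from this[of X a] have EX: "E i0 X a"
    using \<open>finite X\<close> j by (simp add: R_def insert_absorb)
  obtain l where l: "l < r (Suc i0)" "D (Suc i0) ! l = a"
    using a by (auto simp: in_set_conv_nth r_def)
  \<comment> \<open>A basis element of degree \<open>a\<close>. For \<open>i0 > 0\<close> minimality
    makes it a cycle modulo all variables, and \<open>i0 = 0\<close> requires no cycle condition;
    but its entry 1 keeps it from being a boundary modulo the variables.\<close>
  define e where "e = (\<lambda>k. if k = l then 1 else (0 :: 'a mpoly))"
  have eF: "e \<in> FM X (r (Suc i0))" using unit_FM[OF l(1), of X] by (simp add: e_def)
  have ehom: "mpart (D (Suc i0)) a e = e" unfolding vpart_fixed_iff by (auto simp: e_def l(2))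
  have "touches X (app (A i0) (r (Suc i0)) e k)" if "i0 \<noteq> 0" for k
    unfolding touches_def
  proof
    fix m assume "m \<in> keys (app (A i0) (r (Suc i0)) e k)"
    then have m: "m \<in> keys (A i0 k l)" by (simp add: e_def app_unit[OF l(1)])
    have "m \<noteq> 0"
    proof
      assume "m = 0"
      then have "lookup (A i0 k l) 0 \<noteq> 0" using m by (simp add: in_keys_iff)
      then show False using min that by (cases i0) (auto simp: minimal_def)
    qed
    moreover have "keys m \<subseteq> X" using m ghomD(1)[OF resD(2), of i0 k l] by (auto simp: in_Pol_iff)
    ultimately show "keys m \<inter> X \<noteq> {}" by (metis inf.absorb1 keys_eq_empty)
  qed
  then have "i0 = 0 \<or> (\<forall>k. touches X (app (A i0) (r (Suc i0)) e k))" by blast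
  from E_D[OF EX eF ehom this]
  obtain u where u: "\<forall>k. touches X (e k - app (A (Suc i0)) (r (Suc (Suc i0))) u k)"
    by blast
  have "lookup (app (A (Suc i0)) (r (Suc (Suc i0))) u l) 0 = 0"
    using min by (simp add: app_def lookup_sum lookup_times_0 minimal_def)
  then have "lookup (e l - app (A (Suc i0)) (r (Suc (Suc i0))) u l) 0 = 1"
    by (simp add: lookup_minus e_def lookup_one)
  then have "0 \<in> keys (e l - app (A (Suc i0)) (r (Suc (Suc i0))) u l)" by (simp add: in_keys_iff)
  then show False using u by (fastforce simp: touches_def)
qed

section \<open>Covering polyhedra\<close>

definition cov_poly :: "nat set \<Rightarrow> nat set set \<Rightarrow> (nat \<Rightarrow>\<^sub>0 real) set"
  where "cov_poly X C = {a. keys a \<subseteq> X \<and> (\<forall>k \<in> X. 0 \<le> lookup a k) \<and>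
    (\<forall>M \<in> C. 1 \<le> (\<Sum>k \<in> M. lookup a k))}"

lemma lookup_scaleR_real: "lookup (t *\<^sub>R a) k = t * lookup a k" for a :: "nat \<Rightarrow>\<^sub>0 real"
proof -
  have "finite {i. t *\<^sub>R lookup a i \<noteq> 0}"
    by (rule finite_subset[OF _ finite_keys[of a]]) (auto simp: in_keys_iff)
  then show ?thesis by (simp add: scaleR_poly_mapping_def)
qed

lemma keys_scaleR_real: "keys (t *\<^sub>R a) \<subseteq> keys a" for a :: "nat \<Rightarrow>\<^sub>0 real"
  by (auto simp: in_keys_iff lookup_scaleR_real)

lemma coord_sum_superset: "finite X \<Longrightarrow> keys a \<subseteq> X \<Longrightarrow> coord_sum a = (\<Sum>k \<in> X. lookup a k)"
  unfolding coord_sum_def by (rule sum.mono_neutral_left) (auto simp: in_keys_iff)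

text \<open>Ratio test: the step ends at the smallest ratio among the decreasing values, where a
  value that was positive becomes zero.\<close>

lemma finite_max_step:
  fixes f g :: "'i \<Rightarrow> real"
  assumes "finite I" "\<And>i. i \<in> I \<Longrightarrow> 0 \<le> f i" "\<And>i. i \<in> I \<Longrightarrow> f i = 0 \<Longrightarrow> g i = 0"
    and neg: "\<exists>i \<in> I. g i < 0"
  obtains t i where "t > 0" "\<And>i. i \<in> I \<Longrightarrow> 0 \<le> f i + t * g i" "i \<in> I" "f i > 0" "f i + t * g i = 0"
proof -
  define N where "N = {i \<in> I. g i < 0}"
  have N: "finite N" "N \<noteq> {}" using assms by (auto simp: N_def)
  define t where "t = Min ((\<lambda>i. f i / - g i) ` N)"
  have "t \<in> (\<lambda>i. f i / - g i) ` N" unfolding t_def using N by (intro Min_in) auto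
  then obtain i where i: "i \<in> N" "t = f i / - g i" by blast
  have fN: "f i > 0" if "i \<in> N" for i using assms(2,3)[of i] that by (force simp: N_def)
  have t_le: "t \<le> f i / - g i" if "i \<in> N" for i
    unfolding t_def using N that by (intro Min_le) auto
  have t: "t > 0" using i fN[OF i(1)] by (simp add: N_def divide_pos_neg)
  have step: "0 \<le> f i' + t * g i'" if "i' \<in> I" for i'
  proof (cases "g i' < 0")
    case True
    then have "t \<le> f i' / - g i'" using t_le[of i'] that by (simp add: N_def)
    then have "t * - g i' \<le> f i'" using True by (subst (asm) pos_le_divide_eq) auto
    then show ?thesis by simp
  qed (use t assms(2)[OF that] in simp)
  have "f i + t * g i = 0" "i \<in> I" using i by (auto simp: N_def)
  then show thesis using that t step fN[OF i(1)] by blast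
qed

text \<open>Values equal to zero do not change along \<open>g\<close>, so a small step is possible
  in both directions.\<close>

lemma finite_small_step:
  fixes f g :: "'i \<Rightarrow> real"
  assumes "finite I" "\<And>i. i \<in> I \<Longrightarrow> 0 \<le> f i" "\<And>i. i \<in> I \<Longrightarrow> f i = 0 \<Longrightarrow> g i = 0"
  obtains e where "e > 0" "\<And>t i. i \<in> I \<Longrightarrow> \<bar>t\<bar> \<le> e \<Longrightarrow> 0 \<le> f i + t * g i"
proof -
  define N where "N = {i \<in> I. g i \<noteq> 0}"
  \<comment> \<open>The number 1 keeps the minimum defined when no value varies.\<close>
  define e where "e = Min (insert 1 ((\<lambda>i. f i / \<bar>g i\<bar>) ` N))"
  have N: "finite N" using assms(1) by (simp add: N_def)
  have fN: "f i > 0" if "i \<in> N" for i using assms(2,3)[of i] that by (force simp: N_def)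
  have "e > 0" unfolding e_def using N fN by (subst Min_gr_iff) (auto simp: N_def)
  moreover have "0 \<le> f i + t * g i" if "i \<in> I" "\<bar>t\<bar> \<le> e" for t i
  proof (cases "g i = 0")
    case False
    then have "e \<le> f i / \<bar>g i\<bar>" unfolding e_def using N that(1) by (intro Min_le) (auto simp: N_def)
    with that(2) have "\<bar>t\<bar> \<le> f i / \<bar>g i\<bar>" by (rule order_trans)
    then have "\<bar>t\<bar> * \<bar>g i\<bar> \<le> f i" using False by (simp add: pos_le_divide_eq)
    then have "\<bar>t * g i\<bar> \<le> f i" by (simp add: abs_mult)
    then show ?thesis by linarith
  qed (use assms(2)[OF that(1)] in simp)
  ultimately show thesis by (rule that)
qed

locale covering =
  fixes X :: "nat set" and C :: "nat set set"
  assumes finite_X: "finite X" and C_sub: "M \<in> C \<Longrightarrow> M \<subseteq> X"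
begin

abbreviation "P \<equiv> cov_poly X C"
abbreviation "msum a M \<equiv> (\<Sum>k \<in> M. lookup a k)"

text \<open>One index type for all inequalities: \<open>Inl k\<close> is nonnegativity of coordinate
  \<open>k\<close>, and \<open>Inr M\<close> is the inequality of the cover
  \<open>M\<close>.\<close>

definition con :: "(nat + nat set) set" where "con = Inl ` X \<union> Inr ` C"
definition slack :: "(nat \<Rightarrow>\<^sub>0 real) \<Rightarrow> nat + nat set \<Rightarrow> real"
  where "slack a i = (case i of Inl k \<Rightarrow> lookup a k | Inr M \<Rightarrow> msum a M - 1)"
definition slope :: "(nat \<Rightarrow>\<^sub>0 real) \<Rightarrow> nat + nat set \<Rightarrow> real"
  where "slope d i = (case i of Inl k \<Rightarrow> lookup d k | Inr M \<Rightarrow> msum d M)"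
definition tight :: "(nat \<Rightarrow>\<^sub>0 real) \<Rightarrow> (nat + nat set) set"
  where "tight a = {i \<in> con. slack a i = 0}"
text \<open>Directions parallel to the smallest face containing \<open>a\<close>. A point of
  \<open>P\<close> is a vertex exactly if 0 is the only admissible direction, as the next lemmas
  show.\<close>

definition admissible :: "(nat \<Rightarrow>\<^sub>0 real) \<Rightarrow> (nat \<Rightarrow>\<^sub>0 real) \<Rightarrow> bool"
  where "admissible a d \<longleftrightarrow> keys d \<subseteq> X \<and> (\<forall>i \<in> tight a. slope d i = 0)"

lemma finite_con: "finite con"
proof -
  have "C \<subseteq> Pow X" using C_sub by blast
  then have "finite C" using finite_X by (meson finite_Pow_iff finite_subset)
  then show ?thesis using finite_X by (simp add: con_def)
qed

lemma tight_sub: "tight a \<subseteq> con" by (auto simp: tight_def)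

lemma P_iff: "a \<in> P \<longleftrightarrow> keys a \<subseteq> X \<and> (\<forall>i \<in> con. 0 \<le> slack a i)"
  by (auto simp: cov_poly_def con_def slack_def ball_Un)

lemma P_nonneg:
  assumes "a \<in> P"
  shows "0 \<le> lookup a k"
proof (cases "k \<in> X")
  case False
  then have "k \<notin> keys a" using assms by (auto simp: P_iff)
  then show ?thesis by (simp add: in_keys_iff)
qed (use assms in \<open>auto simp: cov_poly_def\<close>)

lemma slack_move: "slack (a + t *\<^sub>R d) i = slack a i + t * slope d i"
  by (cases i) (simp_all add: slack_def slope_def lookup_add lookup_scaleR_real sum.distrib sum_distrib_left)

lemma slope_diff: "slope (b - a) i = slack b i - slack a i"
  by (cases i) (simp_all add: slack_def slope_def lookup_minus sum_subtractf)

lemma slope_uminus: "slope (- d) i = - slope d i"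
  by (cases i) (simp_all add: slope_def sum_negf)

lemma admissible_uminus: "admissible a d \<Longrightarrow> admissible a (- d)"
  by (auto simp: admissible_def slope_uminus)

lemma keys_move: "keys a \<subseteq> X \<Longrightarrow> keys d \<subseteq> X \<Longrightarrow> keys (a + t *\<^sub>R d) \<subseteq> X"
  for a d :: "nat \<Rightarrow>\<^sub>0 real"
  using keys_add[of a "t *\<^sub>R d"] keys_scaleR_real[of t d] by blast

text \<open>A slack that is zero inside a segment and nonnegative at its ends is zero at both ends,
  so the difference of the ends is admissible.\<close>

lemma not_extreme_direction:
  assumes "a \<in> P" "\<not> a extreme_point_of P"
  obtains d where "admissible a d" "d \<noteq> 0"
proof -
  obtain b c where bc: "b \<in> P" "c \<in> P" "a \<in> open_segment b c"
    using assms by (auto simp: extreme_point_of_def)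
  then obtain u where u: "b \<noteq> c" "0 < u" "u < 1" "a = (1 - u) *\<^sub>R b + u *\<^sub>R c"
    by (auto simp: in_segment)
  have "slope (c - b) i = 0" if "i \<in> tight a" for i
  proof -
    have pos: "0 \<le> slack b i" "0 \<le> slack c i"
      using bc(1,2) that by (auto simp: P_iff tight_def)
    have a_eq: "a = b + u *\<^sub>R (c - b)" by (simp add: u(4) algebra_simps)
    have "slack a i = slack b i + u * slope (c - b) i" unfolding a_eq by (rule slack_move)
    then have "slack a i = (1 - u) * slack b i + u * slack c i" by (simp add: slope_diff algebra_simps)
    then have "(1 - u) * slack b i + u * slack c i = 0" using that by (simp add: tight_def)
    moreover have "0 \<le> (1 - u) * slack b i" "0 \<le> u * slack c i" using pos u by simp_all
    ultimately have "(1 - u) * slack b i = 0" "u * slack c i = 0" by linarith+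
    then show ?thesis using u by (simp add: slope_diff)
  qed
  moreover have "keys (c - b) \<subseteq> X" using bc(1,2) keys_diff[of c b] by (auto simp: P_iff)
  ultimately show thesis using u(1) by (intro that[of "c - b"]) (auto simp: admissible_def)
qed

text \<open>Small steps along \<open>d\<close> and against it stay in \<open>P\<close>, so
  \<open>a\<close> is the midpoint of a segment.\<close>

lemma direction_not_extreme:
  assumes "a \<in> P" "admissible a d" "d \<noteq> 0"
  shows "\<not> a extreme_point_of P"
proof -
  obtain e where e: "e > 0" "\<And>t i. i \<in> con \<Longrightarrow> \<bar>t\<bar> \<le> e \<Longrightarrow> 0 \<le> slack a i + t * slope d i"
    by (rule finite_small_step[OF finite_con, of "slack a" "slope d"])
      (use assms in \<open>auto simp: P_iff admissible_def tight_def\<close>)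
  have mem: "a + t *\<^sub>R d \<in> P" if "\<bar>t\<bar> \<le> e" for t
    using e(2)[OF _ that] assms keys_move[of a d t] by (auto simp: P_iff slack_move admissible_def)
  have "a = (1 - 1/2) *\<^sub>R (a + (- e) *\<^sub>R d) + (1/2) *\<^sub>R (a + e *\<^sub>R d)"
    by (simp add: algebra_simps flip: scaleR_left.add)
  moreover have "a + (- e) *\<^sub>R d \<noteq> a + e *\<^sub>R d" using e(1) assms(3) by auto
  ultimately have "a \<in> open_segment (a + (- e) *\<^sub>R d) (a + e *\<^sub>R d)"
    unfolding in_segment by (intro conjI exI[of _ "1/2"]) auto
  then show ?thesis using mem[of "- e"] mem[of e] e(1) by (auto simp: extreme_point_of_def)
qed

text \<open>A vertex is determined by its tight inequalities: the difference of two vertices with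
  the same ones is admissible.\<close>

lemma finite_vertices: "finite (vertices P)"
proof -
  have "inj_on tight (vertices P)"
  proof (rule inj_onI)
    fix a b assume ab: "a \<in> vertices P" "b \<in> vertices P" "tight a = tight b"
    then have P: "a \<in> P" "b \<in> P" by (auto simp: vertices_def extreme_point_of_def)
    have "slope (b - a) i = 0" if "i \<in> tight a" for i
    proof -
      have "i \<in> tight b" using that ab(3) by simp
      then show ?thesis using that by (simp add: slope_diff tight_def)
    qed
    moreover have "keys (b - a) \<subseteq> X" using P keys_diff[of b a] by (auto simp: P_iff)
    ultimately have "admissible a (b - a)" by (simp add: admissible_def)
    moreover have "a extreme_point_of P" using ab(1) by (simp add: vertices_def)
    ultimately have "b - a = 0" using direction_not_extreme[OF P(1)] by blast
    then show "a = b" by simp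
  qed
  moreover have "tight ` vertices P \<subseteq> Pow con" by (rule image_subsetI) (simp add: tight_sub)
  ultimately show ?thesis by (rule inj_on_finite) (use finite_con in simp)
qed

text \<open>A negative coordinate of \<open>d\<close> bounds the ray, which therefore runs into a
  new inequality.\<close>

lemma step_to_tighter:
  assumes "a \<in> P" "admissible a d" "lookup d k < 0"
  obtains t where "t > 0" "a + t *\<^sub>R d \<in> P" "tight a \<subset> tight (a + t *\<^sub>R d)"
proof -
  have k: "k \<in> X" using assms(2,3) by (auto simp: admissible_def in_keys_iff)
  obtain t i where t: "t > 0" "\<And>i. i \<in> con \<Longrightarrow> 0 \<le> slack a i + t * slope d i" "i \<in> con"
      "slack a i > 0" "slack a i + t * slope d i = 0"
  proof (rule finite_max_step[OF finite_con, of "slack a" "slope d"])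
    show "\<exists>i \<in> con. slope d i < 0"
      using k assms(3) by (intro bexI[of _ "Inl k"]) (auto simp: con_def slope_def)
  qed (use assms(1,2) in \<open>auto simp: P_iff admissible_def tight_def\<close>)
  have "a + t *\<^sub>R d \<in> P"
    using t(2) assms(1,2) keys_move[of a d t] by (auto simp: P_iff slack_move admissible_def)
  moreover have "tight a \<subseteq> tight (a + t *\<^sub>R d)"
    using assms(2) by (auto simp: tight_def slack_move admissible_def)
  moreover have "i \<in> tight (a + t *\<^sub>R d)" "i \<notin> tight a"
    using t(3-5) by (auto simp: tight_def slack_move)
  ultimately show thesis using that[OF t(1)] by blast
qed

lemma coord_sum_move:
  "keys a \<subseteq> X \<Longrightarrow> keys d \<subseteq> X \<Longrightarrow> coord_sum (a + t *\<^sub>R d) = coord_sum a + t * coord_sum d"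
  using keys_move[of a d t]
  by (simp add: coord_sum_superset[OF finite_X] lookup_add lookup_scaleR_real sum.distrib sum_distrib_left)

lemma coord_sum_uminus: "coord_sum (- d) = - coord_sum d"
  by (simp add: coord_sum_def sum_negf)

text \<open>Descent along admissible directions with coordinate sum at most 0, each step making a
  further inequality tight. Such a direction has a negative coordinate unless it is zero, so the ray
  ends.\<close>

lemma vertex_below:
  assumes "a \<in> P"
  shows "\<exists>v \<in> vertices P. coord_sum v \<le> coord_sum a"
  using assms
proof (induction "card con - card (tight a)" arbitrary: a rule: less_induct)
  case less
  show ?case
  proof (cases "a extreme_point_of P")
    case True
    then show ?thesis by (auto simp: vertices_def)
  next
    case False
    obtain d0 where d0: "admissible a d0" "d0 \<noteq> 0" using not_extreme_direction[OF less.prems False] .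
    define d where "d = (if coord_sum d0 \<le> 0 then d0 else - d0)"
    have d: "admissible a d" "d \<noteq> 0" "coord_sum d \<le> 0"
      using d0 admissible_uminus by (auto simp: d_def coord_sum_uminus)
    have "\<exists>k. lookup d k < 0"
    proof (rule ccontr)
      assume "\<not> (\<exists>k. lookup d k < 0)"
      then have pos: "0 \<le> lookup d k" for k by (simp add: not_less)
      then have "coord_sum d = 0" using d(3) by (simp add: coord_sum_def order.antisym sum_nonneg)
      then have "\<forall>k \<in> keys d. lookup d k = 0"
        unfolding coord_sum_def by (subst (asm) sum_nonneg_eq_0_iff) (use pos in auto)
      then have "lookup d k = 0" for k by (cases "k \<in> keys d") (simp_all add: in_keys_iff)
      then have "d = 0" by (intro poly_mapping_eqI) simp
      then show False using d(2) by simp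
    qed
    then obtain k where "lookup d k < 0" ..
    then obtain t where t: "t > 0" "a + t *\<^sub>R d \<in> P" "tight a \<subset> tight (a + t *\<^sub>R d)"
      using step_to_tighter[OF less.prems d(1)] by blast
    have fin: "finite (tight b)" for b using finite_con tight_sub finite_subset by blast
    have "card (tight a) < card (tight (a + t *\<^sub>R d))" using t(3) fin by (simp add: psubset_card_mono)
    moreover have "card (tight (a + t *\<^sub>R d)) \<le> card con" using tight_sub finite_con by (simp add: card_mono)
    ultimately obtain v where v: "v \<in> vertices P" "coord_sum v \<le> coord_sum (a + t *\<^sub>R d)"
      using less.hyps[OF _ t(2)] by (metis diff_less_mono2 less_le_trans)
    have "coord_sum (a + t *\<^sub>R d) = coord_sum a + t * coord_sum d"
    proof (rule coord_sum_move)
      show "keys a \<subseteq> X" using less.prems by (simp add: P_iff)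
      show "keys d \<subseteq> X" using d(1) by (simp add: admissible_def)
    qed
    also have "\<dots> \<le> coord_sum a" using t(1) d(3) by (simp add: mult_nonneg_nonpos)
    finally have "coord_sum v \<le> coord_sum a" using v(2) by linarith
    then show ?thesis using v(1) by blast
  qed
qed

text \<open>For a point of \<open>P\<close> this says that the smallest face containing it is
  bounded: a coordinate can grow along that face only if it is nonzero and in no tight
  cover.\<close>

definition compact_face :: "(nat \<Rightarrow>\<^sub>0 real) \<Rightarrow> bool"
  where "compact_face a \<longleftrightarrow> (\<forall>k \<in> X. lookup a k = 0 \<or> (\<exists>M \<in> C. k \<in> M \<and> msum a M = 1))"

text \<open>Ascent in the manner of \<open>vertex_below\<close>. Here \<open>compact_face\<close>
  rules out nonzero nonnegative admissible directions, and it is inherited because tight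
  inequalities stay tight.\<close>

lemma vertex_above:
  assumes "a \<in> P" "compact_face a"
  shows "\<exists>v \<in> vertices P. coord_sum a \<le> coord_sum v"
  using assms
proof (induction "card con - card (tight a)" arbitrary: a rule: less_induct)
  case less
  show ?case
  proof (cases "a extreme_point_of P")
    case True
    then show ?thesis by (auto simp: vertices_def)
  next
    case False
    obtain d0 where d0: "admissible a d0" "d0 \<noteq> 0" using not_extreme_direction[OF less.prems(1) False] .
    define d where "d = (if 0 \<le> coord_sum d0 then d0 else - d0)"
    have d: "admissible a d" "d \<noteq> 0" "0 \<le> coord_sum d"
      using d0 admissible_uminus by (auto simp: d_def coord_sum_uminus)
    have "\<exists>k. lookup d k < 0"
    proof (rule ccontr)
      assume "\<not> (\<exists>k. lookup d k < 0)"
      then have pos: "0 \<le> lookup d k" for k by (simp add: not_less)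
      obtain k where k: "lookup d k \<noteq> 0" using d(2) by (metis poly_mapping_eqI lookup_zero)
      then have kX: "k \<in> X" using d(1) by (auto simp: admissible_def in_keys_iff)
      have "lookup a k \<noteq> 0"
      proof
        assume "lookup a k = 0"
        then have "Inl k \<in> tight a" using kX by (simp add: tight_def con_def slack_def)
        then show False using d(1) k by (auto simp: admissible_def slope_def)
      qed
      then obtain M where M: "M \<in> C" "k \<in> M" "msum a M = 1"
        using less.prems(2) kX by (auto simp: compact_face_def)
      then have "Inr M \<in> tight a" by (simp add: tight_def con_def slack_def)
      then have "msum d M = 0" using d(1) by (auto simp: admissible_def slope_def)
      moreover have "finite M" using C_sub[OF M(1)] finite_X finite_subset by blast
      ultimately have "lookup d k = 0" using pos M(2) by (simp add: sum_nonneg_eq_0_iff)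
      then show False using k by simp
    qed
    then obtain k where "lookup d k < 0" ..
    then obtain t where t: "t > 0" "a + t *\<^sub>R d \<in> P" "tight a \<subset> tight (a + t *\<^sub>R d)"
      using step_to_tighter[OF less.prems(1) d(1)] by blast
    have fin: "finite (tight b)" for b using finite_con tight_sub finite_subset by blast
    have "card (tight a) < card (tight (a + t *\<^sub>R d))" using t(3) fin by (simp add: psubset_card_mono)
    moreover have "card (tight (a + t *\<^sub>R d)) \<le> card con" using tight_sub finite_con by (simp add: card_mono)
    moreover have "compact_face (a + t *\<^sub>R d)"
      unfolding compact_face_def
    proof
      fix k assume k: "k \<in> X"
      consider "Inl k \<in> tight a" | M where "M \<in> C" "k \<in> M" "Inr M \<in> tight a"
        using less.prems(2) k by (auto simp: compact_face_def tight_def con_def slack_def)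
      then show "lookup (a + t *\<^sub>R d) k = 0 \<or> (\<exists>M \<in> C. k \<in> M \<and> msum (a + t *\<^sub>R d) M = 1)"
      proof cases
        case 1
        then have "Inl k \<in> tight (a + t *\<^sub>R d)" using t(3) by blast
        then show ?thesis by (simp add: tight_def slack_def)
      next
        case 2
        then have "Inr M \<in> tight (a + t *\<^sub>R d)" using t(3) by blast
        then have "msum (a + t *\<^sub>R d) M = 1" by (simp add: tight_def slack_def)
        then show ?thesis using 2 by blast
      qed
    qed
    ultimately obtain v where v: "v \<in> vertices P" "coord_sum (a + t *\<^sub>R d) \<le> coord_sum v"
      using less.hyps[OF _ t(2)] by (metis diff_less_mono2 less_le_trans)
    have "coord_sum (a + t *\<^sub>R d) = coord_sum a + t * coord_sum d"
    proof (rule coord_sum_move)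
      show "keys a \<subseteq> X" using less.prems by (simp add: P_iff)
      show "keys d \<subseteq> X" using d(1) by (simp add: admissible_def)
    qed
    moreover have "0 \<le> t * coord_sum d" using t(1) d(3) by simp
    ultimately have "coord_sum a \<le> coord_sum v" using v(2) by linarith
    then show ?thesis using v(1) by blast
  qed
qed

text \<open>Otherwise a single nonzero coordinate \<open>k\<close> could be moved in both
  directions.\<close>

lemma vertex_compact_face:
  assumes "v \<in> vertices P"
  shows "compact_face v"
proof (rule ccontr)
  assume "\<not> compact_face v"
  then obtain k where k: "k \<in> X" "lookup v k \<noteq> 0" "\<And>M. M \<in> C \<Longrightarrow> k \<in> M \<Longrightarrow> msum v M \<noteq> 1"
    by (auto simp: compact_face_def)
  define d :: "nat \<Rightarrow>\<^sub>0 real" where "d = Poly_Mapping.single k 1"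
  have "slope d i = 0" if "i \<in> tight v" for i
    using that k by (cases i) (auto simp: tight_def con_def slack_def slope_def d_def lookup_single when_def intro!: sum.neutral)
  moreover have "keys d \<subseteq> X" using k(1) by (simp add: d_def)
  moreover have "d \<noteq> 0" by (simp add: d_def) (metis lookup_single_eq lookup_zero zero_neq_one)
  ultimately show False
    using direction_not_extreme[of v d] assms by (auto simp: admissible_def vertices_def extreme_point_of_def)
qed

text \<open>Let \<open>t Y\<close> be the least sum of \<open>v\<close> over the part of a cover in
  \<open>Y\<close>. Since parts of two covers can be combined, \<open>t Y1 + t Y2\<close> is at
  least 1, so every tight cover attains both minima. Trading weight between the two parts of
  \<open>v\<close> then keeps tight covers tight, against extremality.\<close>

lemma vertex_not_split:
  assumes v: "v \<in> vertices P" and Y: "keys v \<subseteq> Y1 \<union> Y2" "Y1 \<inter> Y2 = {}"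
    and split: "\<And>M1 M2. M1 \<in> C \<Longrightarrow> M2 \<in> C \<Longrightarrow>
      \<exists>M \<in> C. M \<inter> (Y1 \<union> Y2) \<subseteq> (M1 \<inter> Y1) \<union> (M2 \<inter> Y2)"
  shows "keys v \<subseteq> Y1 \<or> keys v \<subseteq> Y2"
proof (rule ccontr)
  assume contra: "\<not> ?thesis"
  have vP: "v \<in> P" using v by (auto simp: vertices_def extreme_point_of_def)
  then have pos: "0 \<le> lookup v k" for k by (rule P_nonneg)
  have vX: "keys v \<subseteq> X" using vP by (simp add: P_iff)
  obtain k1 where k1: "k1 \<in> keys v" "k1 \<notin> Y2" using contra by blast
  obtain k2 where k2: "k2 \<in> keys v" "k2 \<notin> Y1" using contra by blast
  have k: "k1 \<in> keys v" "k1 \<in> Y1" "k2 \<in> keys v" "k2 \<in> Y2" using k1 k2 Y(1) by auto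
  have "C \<noteq> {}"
  proof -
    have "k1 \<in> X" "lookup v k1 \<noteq> 0" using k(1) vX by (auto simp: in_keys_iff)
    then show ?thesis using vertex_compact_face[OF v] unfolding compact_face_def by blast
  qed
  have finC: "finite C" using finite_con by (simp add: con_def finite_image_iff)
  have finM: "finite M" if "M \<in> C" for M using C_sub[OF that] finite_X finite_subset by blast
  define s where "s = (\<lambda>Y M. \<Sum>k \<in> M \<inter> Y. lookup v k)"
  define t where "t = (\<lambda>Y. Min (s Y ` C))"
  have t_le: "t Y \<le> s Y M" if "M \<in> C" for Y M unfolding t_def using finC that by (intro Min_le) auto
  have t_ex: "\<exists>M \<in> C. s Y M = t Y" for Y
  proof -
    have "t Y \<in> s Y ` C" unfolding t_def using finC \<open>C \<noteq> {}\<close> by (intro Min_in) auto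
    then show ?thesis by auto
  qed
  have s_nonneg: "0 \<le> s Y M" for Y M unfolding s_def using pos by (simp add: sum_nonneg)
  have msum_eq: "msum v M = s Y1 M + s Y2 M" if "M \<in> C" for M
  proof -
    have "msum v M = (\<Sum>k \<in> M \<inter> Y1 \<union> M \<inter> Y2. lookup v k)"
      using finM[OF that] Y(1) by (intro sum.mono_neutral_right) (auto simp: in_keys_iff)
    also have "\<dots> = s Y1 M + s Y2 M"
      unfolding s_def using finM[OF that] Y(2) by (intro sum.union_disjoint) auto
    finally show ?thesis .
  qed
  have t1: "1 \<le> t Y1 + t Y2"
  proof -
    obtain M1 M2 where M12: "M1 \<in> C" "s Y1 M1 = t Y1" "M2 \<in> C" "s Y2 M2 = t Y2" using t_ex by meson
    obtain M where M: "M \<in> C" "M \<inter> (Y1 \<union> Y2) \<subseteq> (M1 \<inter> Y1) \<union> (M2 \<inter> Y2)"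
      using split[OF M12(1,3)] by blast
    have "s Y1 M \<le> s Y1 M1" unfolding s_def
      using finM[OF M12(1)] M(2) Y(2) pos by (intro sum_mono2) auto
    moreover have "s Y2 M \<le> s Y2 M2" unfolding s_def
      using finM[OF M12(3)] M(2) Y(2) pos by (intro sum_mono2) auto
    moreover have "1 \<le> msum v M" using vP M(1) by (auto simp: cov_poly_def)
    ultimately show ?thesis using msum_eq[OF M(1)] M12 by linarith
  qed
  have tight_eq: "s Y1 M = t Y1" "s Y2 M = t Y2" "t Y1 + t Y2 = 1" if "M \<in> C" "msum v M = 1" for M
    using t1 t_le[OF that(1), of Y1] t_le[OF that(1), of Y2] msum_eq[OF that(1)] that(2) by linarith+
  \<comment> \<open>With these factors the gain and the loss on a tight cover are both
    \<open>t Y1 * t Y2\<close> and cancel; zero coordinates stay zero.\<close>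
  define d :: "nat \<Rightarrow>\<^sub>0 real"
    where "d = Poly_Mapping.mapp (\<lambda>k c. if k \<in> Y1 then t Y2 * c else - t Y1 * c) v"
  have lookup_d: "lookup d k = (if k \<in> Y1 then t Y2 * lookup v k else - t Y1 * lookup v k)" for k
    by (auto simp: d_def lookup_mapp when_def in_keys_iff)
  have "slope d i = 0" if i: "i \<in> tight v" for i
  proof (cases i)
    case (Inl k)
    then show ?thesis using i by (simp add: tight_def slack_def slope_def lookup_d)
  next
    case (Inr M)
    then have M: "M \<in> C" "msum v M = 1" using i by (auto simp: tight_def con_def slack_def)
    have "msum d M = (\<Sum>k \<in> M \<inter> Y1 \<union> M \<inter> Y2. lookup d k)"
      using finM[OF M(1)] Y(1) by (intro sum.mono_neutral_right) (auto simp: in_keys_iff lookup_d)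
    also have "\<dots> = (\<Sum>k \<in> M \<inter> Y1. lookup d k) + (\<Sum>k \<in> M \<inter> Y2. lookup d k)"
      using finM[OF M(1)] Y(2) by (intro sum.union_disjoint) auto
    also have "(\<Sum>k \<in> M \<inter> Y1. lookup d k) = t Y2 * s Y1 M"
      by (simp add: s_def sum_distrib_left lookup_d)
    also have "(\<Sum>k \<in> M \<inter> Y2. lookup d k) = (\<Sum>k \<in> M \<inter> Y2. - t Y1 * lookup v k)"
      using Y(2) by (intro sum.cong) (auto simp: lookup_d)
    also have "\<dots> = - t Y1 * s Y2 M" by (simp add: s_def sum_distrib_left)
    finally have "msum d M = 0" using tight_eq[OF M] by simp
    then show ?thesis using Inr by (simp add: slope_def)
  qed
  moreover have "keys d \<subseteq> X" unfolding d_def by (rule order_trans[OF keys_mapp_subset vX])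
  moreover have "d \<noteq> 0"
  proof
    assume "d = 0"
    then have d0: "lookup d k = 0" for k by (simp only: lookup_zero)
    have "t Y2 * lookup v k1 = 0" using d0[of k1] k(2) by (simp add: lookup_d)
    moreover have "t Y1 * lookup v k2 = 0" using d0[of k2] k2(2) by (simp add: lookup_d)
    ultimately have "t Y1 = 0" "t Y2 = 0" using k(1,3) by (auto simp: in_keys_iff)
    then show False using t1 by simp
  qed
  ultimately show False
    using direction_not_extreme[OF vP, of d] v by (auto simp: admissible_def vertices_def)
qed

end

text \<open>Nonnegativity makes this a face: a coordinate that vanishes inside a segment of
  \<open>S\<close> vanishes at its ends.\<close>

lemma vertices_face:
  assumes "\<And>a k. a \<in> S \<Longrightarrow> 0 \<le> lookup a k"
  shows "vertices {a \<in> S. keys a \<subseteq> Y} = {a \<in> vertices S. keys a \<subseteq> Y}"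
proof (intro equalityI subsetI)
  fix a assume a: "a \<in> vertices {a \<in> S. keys a \<subseteq> Y}"
  have "a \<notin> open_segment b c" if bc: "b \<in> S" "c \<in> S" for b c
  proof
    assume seg: "a \<in> open_segment b c"
    then obtain u where u: "0 < u" "u < 1" "a = (1 - u) *\<^sub>R b + u *\<^sub>R c" by (auto simp: in_segment)
    have "lookup b k = 0 \<and> lookup c k = 0" if "k \<notin> Y" for k
    proof -
      have "lookup a k = 0"
        using a that by (auto simp: vertices_def extreme_point_of_def in_keys_iff subset_iff)
      then have "(1 - u) * lookup b k + u * lookup c k = 0"
        by (simp add: u(3) lookup_add lookup_scaleR_real)
      moreover have "0 \<le> (1 - u) * lookup b k" "0 \<le> u * lookup c k"
        using assms[OF bc(1), of k] assms[OF bc(2), of k] u by simp_all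
      ultimately have "(1 - u) * lookup b k = 0" "u * lookup c k = 0" by linarith+
      then show ?thesis using u by simp
    qed
    then have "keys b \<subseteq> Y" "keys c \<subseteq> Y" by (auto simp: in_keys_iff)
    then show False using a seg bc by (auto simp: vertices_def extreme_point_of_def)
  qed
  then show "a \<in> {a \<in> vertices S. keys a \<subseteq> Y}"
    using a by (auto simp: vertices_def extreme_point_of_def)
qed (auto simp: vertices_def extreme_point_of_def)

section \<open>Monomial ideals and their minimal primes\<close>

lemma polyring_ops:
  "monoid.mult (polyring X) = (*)" "one (polyring X) = 1" "zero (polyring X) = 0" "add (polyring X) = (+)"
  by (simp_all add: polyring_def)

lemma polyring_minus: "p \<in> Pol X \<Longrightarrow> \<ominus>\<^bsub>polyring X\<^esub> p = - p"
  using abelian_group.minus_equality[OF ring.is_abelian_group[OF cring.axioms(1)[OF cring_polyring]], of X "- p" p]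
  by (simp add: polyring_ops Pol_uminus)

lemma ideal_polyringI:
  fixes I :: "'a::field mpoly set"
  assumes "I \<subseteq> Pol X" "0 \<in> I" "\<And>f g. f \<in> I \<Longrightarrow> g \<in> I \<Longrightarrow> f + g \<in> I"
    "\<And>p f. p \<in> Pol X \<Longrightarrow> f \<in> I \<Longrightarrow> p * f \<in> I"
  shows "ideal I (polyring X)"
proof (rule idealI)
  show "ring (polyring X)" by (rule cring.axioms(1)[OF cring_polyring])
  have "inv\<^bsub>add_monoid (polyring X)\<^esub> f \<in> I" if "f \<in> I" for f
  proof -
    have "inv\<^bsub>add_monoid (polyring X)\<^esub> f = - f"
      using polyring_minus[of f X, unfolded a_inv_def] that assms(1) by blast
    moreover have "- 1 \<in> (Pol X :: 'a mpoly set)" by (simp add: Pol_uminus)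
    ultimately show ?thesis using assms(4)[of "- 1" f] that by simp
  qed
  then show "subgroup I (add_monoid (polyring X))"
    using assms(1-3) by (intro subgroup.intro) (auto simp: polyring_ops)
  have "f * p \<in> I" if "p \<in> Pol X" "f \<in> I" for p f
    using assms(4)[OF that] by (simp add: mult.commute)
  then show "a \<in> I \<Longrightarrow> x \<in> Pol X \<Longrightarrow> a \<otimes>\<^bsub>polyring X\<^esub> x \<in> I" for a x
    by (simp add: polyring_ops)
qed (use assms(4) in \<open>simp add: polyring_ops\<close>)

lemma ideal_polyringD:
  assumes "ideal I (polyring X)"
  shows "I \<subseteq> Pol X" "0 \<in> I" "f \<in> I \<Longrightarrow> g \<in> I \<Longrightarrow> f + g \<in> I"
    "p \<in> Pol X \<Longrightarrow> f \<in> I \<Longrightarrow> p * f \<in> I" "finite A \<Longrightarrow> (\<And>i. i \<in> A \<Longrightarrow> h i \<in> I) \<Longrightarrow> sum h A \<in> I"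
proof -
  note add = ideal.axioms(1)[OF assms]
  show *: "I \<subseteq> Pol X" "0 \<in> I" "\<And>f g. f \<in> I \<Longrightarrow> g \<in> I \<Longrightarrow> f + g \<in> I"
    "p \<in> Pol X \<Longrightarrow> f \<in> I \<Longrightarrow> p * f \<in> I"
    using additive_subgroup.a_subset[OF add] additive_subgroup.zero_closed[OF add]
      additive_subgroup.a_closed[OF add] ideal.I_l_closed[OF assms] by (auto simp: polyring_ops)
  show "finite A \<Longrightarrow> (\<And>i. i \<in> A \<Longrightarrow> h i \<in> I) \<Longrightarrow> sum h A \<in> I"
    by (induction A rule: finite_induct) (auto intro: *)
qed

lemma monomial_ideal_ideal:
  assumes "\<And>u v. u \<in> U \<Longrightarrow> keys v \<subseteq> X \<Longrightarrow> v + u \<in> U"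
  shows "ideal (monomial_ideal X U :: 'a::field mpoly set) (polyring X)"
proof (rule ideal_polyringI)
  fix f g :: "'a mpoly" assume fg: "f \<in> monomial_ideal X U" "g \<in> monomial_ideal X U"
  then show "f + g \<in> monomial_ideal X U"
    using keys_add[of f g] by (auto simp: monomial_ideal_def Pol_add)
next
  fix p f :: "'a mpoly" assume p: "p \<in> Pol X" and f: "f \<in> monomial_ideal X U"
  have "keys (p * f) \<subseteq> U"
  proof
    fix m assume "m \<in> keys (p * f)"
    then obtain a b where "m = a + b" "a \<in> keys p" "b \<in> keys f" using keys_mult[of p f] by blast
    then show "m \<in> U" using assms[of b a] p f by (auto simp: monomial_ideal_def in_Pol_iff)
  qed
  then show "p * f \<in> monomial_ideal X U" using p f by (simp add: monomial_ideal_def Pol_mult)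
qed (auto simp: monomial_ideal_def)

lemma mono_le_add: "u \<in> {v. \<exists>w \<in> B. exp_le w v} \<Longrightarrow> v + u \<in> {v. \<exists>w \<in> B. exp_le w v}"
  using exp_le_trans exp_le_add(2) by blast

lemma PolD: "p \<in> Pol X \<Longrightarrow> m \<in> keys p \<Longrightarrow> keys m \<subseteq> X"
  by (simp add: in_Pol_iff)

lemma monomial_idealD:
  "f \<in> monomial_ideal X U \<Longrightarrow> f \<in> Pol X"
  "f \<in> monomial_ideal X U \<Longrightarrow> m \<in> keys f \<Longrightarrow> m \<in> U"
  "f \<in> monomial_ideal X U \<Longrightarrow> m \<in> keys f \<Longrightarrow> keys m \<subseteq> X"
  by (auto simp: monomial_ideal_def in_Pol_iff)

lemma monomial_ideal_mono: "U \<subseteq> V \<Longrightarrow> monomial_ideal X U \<subseteq> monomial_ideal X V"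
  by (auto simp: monomial_ideal_def)

lemma mon_in_monomial_ideal:
  "u \<in> B \<Longrightarrow> keys u \<subseteq> X \<Longrightarrow> mon u \<in> monomial_ideal X {v. \<exists>u \<in> B. exp_le u v}"
  unfolding monomial_ideal_def by (simp, rule bexI[of _ u], rule exp_le_refl)

lemma Idl_monomials:
  assumes "\<And>u. u \<in> B \<Longrightarrow> keys u \<subseteq> X"
  shows "Idl\<^bsub>polyring X\<^esub> (mon ` B) = (monomial_ideal X {v. \<exists>u \<in> B. exp_le u v} :: 'a::field mpoly set)"
    (is "?I = ?J")
proof
  interpret cring "polyring X :: 'a mpoly ring" by (rule cring_polyring)
  have sub: "mon ` B \<subseteq> carrier (polyring X)" using assms by auto
  have idJ: "ideal ?J (polyring X)" by (rule monomial_ideal_ideal) (rule mono_le_add)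
  have "mon ` B \<subseteq> ?J" using assms mon_in_monomial_ideal by blast
  then show "?I \<subseteq> ?J" by (rule genideal_minimal[OF idJ])
  have idI: "ideal ?I (polyring X)" by (rule genideal_ideal[OF sub])
  show "?J \<subseteq> ?I"
  proof
    fix f assume f: "f \<in> ?J"
    have "Poly_Mapping.single m c \<in> ?I" if m: "m \<in> keys f" for m c
    proof -
      obtain u where u: "u \<in> B" "exp_le u m" using monomial_idealD(2)[OF f m] by blast
      obtain w where w: "m = u + w" using exp_le_addE[OF u(2)] by metis
      have "keys m \<subseteq> X" using f m by (rule monomial_idealD(3))
      then have "keys w \<subseteq> X" using w by (simp add: keys_add_nat)
      moreover have "mon u \<in> ?I" using genideal_self[OF sub] u(1) by blast
      ultimately have "Poly_Mapping.single w c * mon u \<in> ?I" using ideal_polyringD(4)[OF idI] by simp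
      then show ?thesis by (simp add: mult_single w add.commute)
    qed
    then have "(\<Sum>m \<in> keys f. Poly_Mapping.single m (lookup f m)) \<in> ?I"
      by (intro ideal_polyringD(5)[OF idI]) auto
    then show "f \<in> ?I" using poly_eq_sum[of f] by simp
  qed
qed

section \<open>Primes generated by variables\<close>

abbreviation var_ideal :: "nat set \<Rightarrow> nat set \<Rightarrow> 'a::field mpoly set"
  where "var_ideal X M \<equiv> Idl\<^bsub>polyring X\<^esub> (var ` M)"

lemma var_eq_mon: "var k = mon (unit_exp k)"
  by (simp add: var_def)

lemma var_ideal_eq:
  assumes "M \<subseteq> X"
  shows "(var_ideal X M :: 'a::field mpoly set) = monomial_ideal X {u. keys u \<inter> M \<noteq> {}}"
proof -
  have "exp_le (unit_exp k) v \<longleftrightarrow> k \<in> keys v" for k v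
    by (force simp: exp_le_def lookup_single when_def in_keys_iff)
  then have "{v. \<exists>u \<in> unit_exp ` M. exp_le u v} = {u. keys u \<inter> M \<noteq> {}}" by auto
  moreover have "(var ` M :: 'a mpoly set) = mon ` unit_exp ` M" by (simp add: image_image var_eq_mon)
  moreover have "keys u \<subseteq> X" if "u \<in> unit_exp ` M" for u using that assms by auto
  ultimately show ?thesis using Idl_monomials[of "unit_exp ` M" X] by simp
qed

lemma var_in_var_ideal: "M \<subseteq> X \<Longrightarrow> k \<in> X \<Longrightarrow> var k \<in> var_ideal X M \<longleftrightarrow> k \<in> M"
  by (simp only: var_ideal_eq) (simp add: monomial_ideal_def var_eq_mon)

text \<open>Dropping all monomials that involve \<open>M\<close> is the substitution of 0 for these
  variables, a ring homomorphism.\<close>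

lemma restr_avoiding_times:
  fixes p q :: "'a::field mpoly"
  shows "restr (\<lambda>m. keys m \<inter> M = {}) (p * q) =
    restr (\<lambda>m. keys m \<inter> M = {}) p * restr (\<lambda>m. keys m \<inter> M = {}) q"
proof -
  let ?P = "\<lambda>m :: nat \<Rightarrow>\<^sub>0 nat. keys m \<inter> M = {}"
  define av :: "'a mpoly \<Rightarrow> 'a mpoly" where "av = restr ?P"
  have "p * q = av p * q + restr (\<lambda>m. \<not> ?P m) p * q"
    unfolding distrib_right[symmetric] av_def restr_split[symmetric] ..
  from arg_cong[OF this, of av]
  have "av (p * q) = av (av p * q) + av (restr (\<lambda>m. \<not> ?P m) p * q)"
    unfolding av_def restr_add .
  also have "av (av p * q) = av p * av q"
    unfolding av_def by (rule restr_times) (auto simp: keys_restr keys_add_nat)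
  also have "av (restr (\<lambda>m. \<not> ?P m) p * q) = 0"
    unfolding av_def
  proof (rule restr_none)
    fix m assume "m \<in> keys (restr (\<lambda>m. \<not> ?P m) p * q)"
    then obtain a b where "m = a + b" "a \<in> keys (restr (\<lambda>m. \<not> ?P m) p)"
      using keys_mult[of "restr (\<lambda>m. \<not> ?P m) p" q] by blast
    then show "\<not> ?P m" by (auto simp: keys_restr keys_add_nat)
  qed
  finally show ?thesis by (simp add: av_def)
qed

text \<open>It is the kernel of the substitution in \<open>restr_avoiding_times\<close>, and
  products of nonzero polynomials are nonzero.\<close>

lemma var_ideal_prime:
  assumes "M \<subseteq> X"
  shows "primeideal (var_ideal X M :: 'a::field mpoly set) (polyring X)"
proof (rule primeidealI)
  let ?I = "var_ideal X M :: 'a mpoly set"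
  let ?P = "\<lambda>m :: nat \<Rightarrow>\<^sub>0 nat. keys m \<inter> M = {}"
  interpret cring "polyring X :: 'a mpoly ring" by (rule cring_polyring)
  show "cring (polyring X :: 'a mpoly ring)" by (rule cring_polyring)
  show "ideal ?I (polyring X)" by (rule genideal_ideal) (use assms in \<open>auto simp: var_eq_mon\<close>)
  have mem: "p \<in> ?I \<longleftrightarrow> p \<in> Pol X \<and> restr ?P p = 0" for p
  proof -
    have "restr ?P p = 0 \<longleftrightarrow> keys (restr ?P p) = {}" by simp
    also have "\<dots> \<longleftrightarrow> keys p \<subseteq> {u. keys u \<inter> M \<noteq> {}}" by (auto simp: keys_restr)
    finally show ?thesis by (auto simp: var_ideal_eq[OF assms] monomial_ideal_def)
  qed
  have "restr ?P (1 :: 'a mpoly) = 1" by (rule restr_id) simp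
  then have "1 \<notin> ?I" unfolding mem by simp
  then show "carrier (polyring X) \<noteq> ?I" using Pol_1[of X] by blast
  fix p q assume "p \<in> Pol X" "q \<in> Pol X" "p \<otimes>\<^bsub>polyring X\<^esub> q \<in> ?I"
  then show "p \<in> ?I \<or> q \<in> ?I" by (auto simp: mem polyring_ops restr_avoiding_times)
qed

text \<open>Minimal vertex covers of the hypergraph with edge set \<open>S\<close>.\<close>

definition min_covers :: "nat set \<Rightarrow> nat set set \<Rightarrow> nat set set"
  where "min_covers X S = {M. M \<subseteq> X \<and> (\<forall>s \<in> S. s \<inter> M \<noteq> {}) \<and> (\<forall>M' \<subset> M. \<exists>s \<in> S. s \<inter> M' = {})}"

lemma min_cover_below:
  assumes "finite M" "M \<subseteq> X" "\<And>s. s \<in> S \<Longrightarrow> s \<inter> M \<noteq> {}"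
  shows "\<exists>M' \<in> min_covers X S. M' \<subseteq> M"
  using assms
proof (induction M rule: finite_psubset_induct)
  case (psubset M)
  show ?case
  proof (cases "\<forall>M' \<subset> M. \<exists>s \<in> S. s \<inter> M' = {}")
    case True
    then have "M \<in> min_covers X S" using psubset.prems by (auto simp: min_covers_def)
    then show ?thesis by blast
  next
    case False
    then obtain M' where M': "M' \<subset> M" "\<And>s. s \<in> S \<Longrightarrow> s \<inter> M' \<noteq> {}" by blast
    then have "M' \<subseteq> X" using psubset.prems(1) by blast
    then show ?thesis using psubset.IH[OF M'(1)] M' by blast
  qed
qed

lemma exp_split: "lookup u k \<noteq> 0 \<Longrightarrow> unit_exp k + (u - unit_exp k) = u"
  by (rule exp_add_diff) (auto simp: lookup_single when_def)

lemma prime_contains_variable: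
  assumes Q: "primeideal Q (polyring X)" and "keys u \<subseteq> X" "mon u \<in> Q"
  shows "\<exists>k \<in> keys u. var k \<in> Q"
  using assms(2,3)
proof (induction "mdeg u" arbitrary: u rule: less_induct)
  case less
  have idQ: "ideal Q (polyring X)" using Q by (rule primeideal.axioms(1))
  show ?case
  proof (cases "u = 0")
    case True
    then have "1 \<in> Q" using less.prems(2) by simp
    then have "Q = carrier (polyring X)"
      using ideal_polyringD(1,4)[OF idQ] by (metis mult.right_neutral subsetI subset_antisym)
    then show ?thesis using primeideal.I_notcarr[OF Q] by simp
  next
    case False
    then obtain k where k: "k \<in> keys u" by (metis keys_eq_empty ex_in_conv)
    define v where "v = u - unit_exp k"
    have uv: "u = unit_exp k + v"
      unfolding v_def using k by (intro exp_split[symmetric]) (simp add: in_keys_iff)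
    have v: "keys v \<subseteq> keys u" unfolding uv keys_add_nat by blast
    have "mdeg u = Suc (mdeg v)"
    proof -
      have "mdeg u = (\<Sum>i \<in> keys u. lookup (unit_exp k) i + lookup v i)"
        unfolding mdeg_def by (rule sum.cong) (auto simp: uv lookup_add)
      also have "\<dots> = (\<Sum>i \<in> keys u. lookup (unit_exp k) i) + (\<Sum>i \<in> keys u. lookup v i)"
        by (rule sum.distrib)
      also have "(\<Sum>i \<in> keys u. lookup (unit_exp k) i) = 1"
        using k by (simp add: lookup_single when_def)
      also have "(\<Sum>i \<in> keys u. lookup v i) = mdeg v"
        unfolding mdeg_def using v by (intro sum.mono_neutral_right) (auto simp: in_keys_iff)
      finally show ?thesis by simp
    qed
    moreover have "var k * mon v \<in> Q" using less.prems(2) by (simp add: var_eq_mon mult_single flip: uv)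
    then have "var k \<in> Q \<or> mon v \<in> Q"
      using primeideal.I_prime[OF Q, of "var k" "mon v"] less.prems(1) v k
      by (auto simp: polyring_ops var_eq_mon)
    ultimately show ?thesis using less.hyps[of v] less.prems(1) v k by auto
  qed
qed

section \<open>Minimal primes over an ideal generated by monomials\<close>

context
  fixes X :: "nat set" and B :: "(nat \<Rightarrow>\<^sub>0 nat) set" and I :: "'a::field mpoly set"
  assumes X: "finite X" and B: "\<And>u. u \<in> B \<Longrightarrow> keys u \<subseteq> X" "0 \<notin> B"
    and I: "I = Idl\<^bsub>polyring X\<^esub> (mon ` B)"
begin

lemma Idl_eq: "Idl\<^bsub>polyring X\<^esub> (mon ` B) = (monomial_ideal X {v. \<exists>u \<in> B. exp_le u v} :: 'a mpoly set)"
  by (rule Idl_monomials) (rule B(1))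

lemma covers_iff:
  assumes "M \<subseteq> X"
  shows "I \<subseteq> var_ideal X M \<longleftrightarrow> (\<forall>s \<in> keys ` B. s \<inter> M \<noteq> {})"
proof
  assume sub: "I \<subseteq> var_ideal X M"
  have "mon u \<in> I" if "u \<in> B" for u
    unfolding I Idl_eq using that B(1)[OF that] by (rule mon_in_monomial_ideal)
  then have "mon u \<in> (monomial_ideal X {u. keys u \<inter> M \<noteq> {}} :: 'a mpoly set)" if "u \<in> B" for u
    using sub that unfolding var_ideal_eq[OF assms] by blast
  then have "keys u \<inter> M \<noteq> {}" if "u \<in> B" for u
    using monomial_idealD(2)[of "mon u :: 'a mpoly" X "{u. keys u \<inter> M \<noteq> {}}" u] that by simp
  then show "\<forall>s \<in> keys ` B. s \<inter> M \<noteq> {}" by (simp add: ball_simps)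
next
  assume cov: "\<forall>s \<in> keys ` B. s \<inter> M \<noteq> {}"
  have "keys u \<inter> M \<noteq> {}" if "w \<in> B" "exp_le w u" for u w
    using cov that exp_le_keys[OF that(2)] by blast
  then have "{v. \<exists>w \<in> B. exp_le w v} \<subseteq> {u. keys u \<inter> M \<noteq> {}}" by blast
  then show "I \<subseteq> var_ideal X M"
    unfolding I Idl_eq var_ideal_eq[OF assms] by (rule monomial_ideal_mono)
qed

text \<open>Reduces the search for minimal primes to primes generated by variables: every generator
  has a variable in \<open>Q\<close>, so the variables in \<open>Q\<close> already cover all
  supports.\<close>

lemma prime_over:
  assumes Q: "primeideal Q (polyring X)" "I \<subseteq> Q"
  defines "M \<equiv> {k \<in> X. var k \<in> Q}"
  shows "I \<subseteq> var_ideal X M" "var_ideal X M \<subseteq> Q"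
proof -
  interpret cring "polyring X :: 'a mpoly ring" by (rule cring_polyring)
  have MX: "M \<subseteq> X" by (auto simp: M_def)
  have "keys u \<inter> M \<noteq> {}" if u: "u \<in> B" for u
  proof -
    have "mon u \<in> I" unfolding I Idl_eq using u B(1)[OF u] by (rule mon_in_monomial_ideal)
    then obtain k where "k \<in> keys u" "var k \<in> Q"
      using prime_contains_variable[OF Q(1) B(1)[OF u]] Q(2) by blast
    then show ?thesis using B(1)[OF u] by (auto simp: M_def)
  qed
  then show "I \<subseteq> var_ideal X M" using covers_iff[OF MX] by blast
  show "var_ideal X M \<subseteq> Q"
    by (rule genideal_minimal[OF primeideal.axioms(1)[OF Q(1)]]) (auto simp: M_def)
qed

text \<open>By \<open>prime_over\<close> a minimal prime is generated by variables. For such primes,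
  containing \<open>I\<close> means covering all supports, and inclusion of primes is inclusion of
  index sets.\<close>

lemma minimal_primes_eq: "minimal_primes (polyring X) I = var_ideal X ` min_covers X (keys ` B)"
proof (intro equalityI subsetI)
  fix P assume P: "P \<in> minimal_primes (polyring X) I"
  define M where "M = {k \<in> X. var k \<in> P}"
  have MX: "M \<subseteq> X" by (auto simp: M_def)
  have Pp: "primeideal P (polyring X)" "I \<subseteq> P" using P by (auto simp: minimal_primes_def)
  note PM = prime_over[OF Pp, folded M_def]
  have Pmin: "Q = P" if "primeideal Q (polyring X)" "I \<subseteq> Q" "Q \<subseteq> P" for Q
    using P that by (auto simp: minimal_primes_def)
  have P_eq: "var_ideal X M = P" using Pmin[OF var_ideal_prime[OF MX] PM] .
  have "\<exists>s \<in> keys ` B. s \<inter> M' = {}" if M': "M' \<subset> M" for M'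
  proof (rule ccontr)
    assume "\<not> ?thesis"
    then have "I \<subseteq> var_ideal X M'" using covers_iff[of M'] M' MX by blast
    moreover have "var_ideal X M' \<subseteq> P"
      unfolding P_eq[symmetric] var_ideal_eq[OF MX] var_ideal_eq[OF order_trans[OF psubset_imp_subset[OF M'] MX]]
      by (rule monomial_ideal_mono) (use M' in blast)
    ultimately have "var_ideal X M' = P" using Pmin var_ideal_prime[of M' X] M' MX by blast
    obtain k where k: "k \<in> M" "k \<notin> M'" using M' by blast
    then have "var k \<notin> var_ideal X M'" using var_in_var_ideal[of M' X k] M' MX by blast
    then show False using k(1) \<open>var_ideal X M' = P\<close> by (auto simp: M_def)
  qed
  then have "M \<in> min_covers X (keys ` B)"
    using MX covers_iff[OF MX] PM(1) by (auto simp: min_covers_def)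
  then show "P \<in> var_ideal X ` min_covers X (keys ` B)" using P_eq by blast
next
  fix P :: "'a mpoly set" assume "P \<in> var_ideal X ` min_covers X (keys ` B)"
  then obtain M where M: "M \<in> min_covers X (keys ` B)" "P = var_ideal X M" by blast
  then have MX: "M \<subseteq> X" and IP: "I \<subseteq> P" using covers_iff[of M] by (auto simp: min_covers_def)
  have "Q = P" if Q: "primeideal Q (polyring X)" "I \<subseteq> Q" "Q \<subseteq> P" for Q
  proof -
    define M' where "M' = {k \<in> X. var k \<in> Q}"
    note QM = prime_over[OF Q(1,2), folded M'_def]
    have "M' \<subseteq> X" by (auto simp: M'_def)
    have "M' \<subseteq> M"
    proof
      fix k assume "k \<in> M'"
      then have k: "k \<in> X" "var k \<in> Q" by (simp_all add: M'_def)
      have "var k \<in> (var_ideal X M :: 'a mpoly set)" using Q(3) k(2) unfolding M(2) by (rule subsetD)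
      then show "k \<in> M" by (rule var_in_var_ideal[OF MX k(1), THEN iffD1])
    qed
    moreover have "\<forall>s \<in> keys ` B. s \<inter> M' \<noteq> {}" by (rule covers_iff[OF \<open>M' \<subseteq> X\<close>, THEN iffD1, OF QM(1)])
    moreover have "\<exists>s \<in> keys ` B. s \<inter> M' = {}" if "M' \<subset> M"
      using M(1) that by (simp add: min_covers_def)
    ultimately have "M' = M" by blast
    then have "P \<subseteq> Q" using QM(2) M(2) by simp
    with Q(3) show ?thesis by (rule equalityI)
  qed
  then show "P \<in> minimal_primes (polyring X) I"
    using IP var_ideal_prime[OF MX] M(2) by (auto simp: minimal_primes_def)
qed

lemma symbolic_polyhedron_eq: "symbolic_polyhedron X I = cov_poly X (min_covers X (keys ` B))"
proof -
  have "var_ideal X M \<in> minimal_primes (polyring X) I \<longleftrightarrow> M \<in> min_covers X (keys ` B)" if MX: "M \<subseteq> X" for M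
  proof -
    have "M = M'" if "M' \<in> min_covers X (keys ` B)" "var_ideal X M = (var_ideal X M' :: 'a mpoly set)" for M'
    proof -
      have "M' \<subseteq> X" using that(1) by (simp add: min_covers_def)
      have "k \<in> M \<longleftrightarrow> k \<in> M'" if "k \<in> X" for k
        using var_in_var_ideal[OF MX that, where 'a='a] var_in_var_ideal[OF \<open>M' \<subseteq> X\<close> that, where 'a='a]
          \<open>var_ideal X M = var_ideal X M'\<close> by simp
      then show ?thesis using MX \<open>M' \<subseteq> X\<close> by blast
    qed
    then show ?thesis unfolding minimal_primes_eq by blast
  qed
  moreover have "M \<subseteq> X" if "M \<in> min_covers X (keys ` B)" for M
    using that by (simp add: min_covers_def)
  ultimately show ?thesis unfolding symbolic_polyhedron_def cov_poly_def by blast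
qed

end

section \<open>Symbolic powers\<close>

text \<open>Degrees in the variables of \<open>M\<close> add up under multiplication; conversely a
  term of degree at least \<open>Suc m\<close> in these variables splits off one of them.\<close>

lemma var_ideal_power:
  assumes "M \<subseteq> X" "finite X"
  shows "var_ideal X M [^]\<^bsub>ideals_set (polyring X)\<^esub> (m::nat) =
    (monomial_ideal X {u. m \<le> (\<Sum>k \<in> M. lookup u k)} :: 'a::field mpoly set)"
proof (induction m)
  case 0
  show ?case by (simp add: nat_pow_def ideals_set_def monomial_ideal_def)
next
  case (Suc m)
  let ?P = "var_ideal X M :: 'a mpoly set"
  let ?J = "\<lambda>m. monomial_ideal X {u. m \<le> (\<Sum>k \<in> M. lookup u k)} :: 'a mpoly set"
  have "?P [^]\<^bsub>ideals_set (polyring X)\<^esub> Suc m = ideal_prod (polyring X) (?J m) ?P"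
    using Suc by (simp add: nat_pow_def ideals_set_def)
  also have "\<dots> = ?J (Suc m)"
  proof (intro equalityI subsetI)
    fix f assume "f \<in> ideal_prod (polyring X) (?J m) ?P"
    then show "f \<in> ?J (Suc m)"
    proof induction
      case (prod f g)
      have "Suc m \<le> (\<Sum>k \<in> M. lookup u k)" if "u \<in> keys (f * g)" for u
      proof -
        obtain a b where ab: "u = a + b" "a \<in> keys f" "b \<in> keys g" using keys_mult[of f g] \<open>u \<in> _\<close> by blast
        have "m \<le> (\<Sum>k \<in> M. lookup a k)" using prod(1) ab(2) by (auto simp: monomial_ideal_def)
        moreover obtain k where k: "k \<in> keys b" "k \<in> M"
          using prod(2) ab(3) by (auto simp: var_ideal_eq[OF assms(1)] monomial_ideal_def)
        moreover have "lookup b k \<le> (\<Sum>k \<in> M. lookup b k)"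
          using k(2) assms finite_subset by (intro member_le_sum) auto
        ultimately show ?thesis by (auto simp: ab(1) lookup_add sum.distrib in_keys_iff)
      qed
      then show ?case using prod
        by (auto simp: polyring_ops monomial_ideal_def Pol_mult var_ideal_eq[OF assms(1)])
    next
      case (sum f g)
      then show ?case using keys_add[of f g] by (auto simp: polyring_ops monomial_ideal_def Pol_add)
    qed
  next
    fix f assume f: "f \<in> ?J (Suc m)"
    have mem: "Poly_Mapping.single u c \<in> ideal_prod (polyring X) (?J m) ?P" if u: "u \<in> keys f" for u c
    proof -
      have "Suc m \<le> (\<Sum>k \<in> M. lookup u k)" using f u by (auto simp: monomial_ideal_def)
      then obtain k where k: "k \<in> M" "lookup u k \<noteq> 0"
        by (metis not_less_eq_eq sum.neutral zero_le)
      define v where "v = u - unit_exp k"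
      have uv: "u = v + unit_exp k"
        unfolding v_def using exp_split[OF k(2)] by (simp only: add.commute)
      have "keys u \<subseteq> X" using f u by (auto simp: monomial_ideal_def in_Pol_iff)
      then have "keys v \<subseteq> X" by (simp add: uv keys_add_nat)
      moreover have "(\<Sum>i \<in> M. lookup u i) = (\<Sum>i \<in> M. lookup v i) + 1"
        using k(1) assms finite_subset[OF assms] by (simp add: uv lookup_add sum.distrib lookup_single when_def)
      ultimately have "Poly_Mapping.single v c \<in> ?J m"
        using \<open>Suc m \<le> _\<close> by (auto simp: monomial_ideal_def split: if_splits)
      moreover have "var k \<in> ?P" using var_in_var_ideal[OF assms(1)] k(1) assms(1) by blast
      ultimately have "Poly_Mapping.single v c \<otimes>\<^bsub>polyring X\<^esub> var k \<in> ideal_prod (polyring X) (?J m) ?P"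
        by (rule ideal_prod.prod)
      then show ?thesis by (simp add: polyring_ops var_eq_mon mult_single uv)
    qed
    have "(\<Sum>u \<in> A. Poly_Mapping.single u (lookup f u)) \<in> ideal_prod (polyring X) (?J m) ?P"
      if "finite A" "A \<subseteq> keys f" for A
      using that
    proof (induction A rule: finite_induct)
      case empty
      have "0 \<otimes>\<^bsub>polyring X\<^esub> 0 \<in> ideal_prod (polyring X) (?J m) ?P"
        by (rule ideal_prod.prod) (auto simp: monomial_ideal_def var_ideal_eq[OF assms(1)])
      then show ?case by (simp add: polyring_ops)
    next
      case (insert u A)
      then show ?case
        using ideal_prod.sum[OF mem[of u "lookup f u"], of "\<Sum>u \<in> A. Poly_Mapping.single u (lookup f u)"]
        by (simp add: polyring_ops)
    qed
    from this[of "keys f"] show "f \<in> ideal_prod (polyring X) (?J m) ?P"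
      using poly_eq_sum[of f] by simp
  qed
  finally show ?case .
qed

text \<open>Lattice points of \<open>m\<close> times the polyhedron; the support in \<open>X\<close>
  is imposed separately by \<open>monomial_ideal\<close>.\<close>

definition sym_exps :: "nat set set \<Rightarrow> nat \<Rightarrow> (nat \<Rightarrow>\<^sub>0 nat) set"
  where "sym_exps C m = {u. \<forall>M \<in> C. m \<le> (\<Sum>k \<in> M. lookup u k)}"

lemma symbolic_power_eq:
  assumes X: "finite X" and B: "\<And>u. u \<in> B \<Longrightarrow> keys u \<subseteq> X" "0 \<notin> B"
  shows "symbolic_power (polyring X) (Idl\<^bsub>polyring X\<^esub> (mon ` B)) m =
    (monomial_ideal X (sym_exps (min_covers X (keys ` B)) m) :: 'a::field mpoly set)"
proof -
  have *: "var_ideal X M [^]\<^bsub>ideals_set (polyring X)\<^esub> m =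
      (monomial_ideal X {u. m \<le> (\<Sum>k \<in> M. lookup u k)} :: 'a mpoly set)"
    if "M \<in> min_covers X (keys ` B)" for M
    by (rule var_ideal_power[OF _ X]) (use that in \<open>simp add: min_covers_def\<close>)
  have mp: "minimal_primes (polyring X) (Idl\<^bsub>polyring X\<^esub> (mon ` B) :: 'a mpoly set) =
      var_ideal X ` min_covers X (keys ` B)"
    by (rule minimal_primes_eq[OF X _ B(2) refl]) (rule B(1))
  have "symbolic_power (polyring X) (Idl\<^bsub>polyring X\<^esub> (mon ` B) :: 'a mpoly set) m =
      Pol X \<inter> (\<Inter>M \<in> min_covers X (keys ` B). monomial_ideal X {u. m \<le> (\<Sum>k \<in> M. lookup u k)})"
    unfolding symbolic_power_def mp image_image
    by (simp only: * cong: INF_cong)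
  also have "\<dots> = (monomial_ideal X (sym_exps (min_covers X (keys ` B)) m) :: 'a mpoly set)"
    by (auto simp: monomial_ideal_def sym_exps_def)
  finally show ?thesis .
qed

section \<open>Regularity of monomial ideals\<close>

lemma mdeg_superset: "finite X \<Longrightarrow> keys u \<subseteq> X \<Longrightarrow> mdeg u = (\<Sum>k \<in> X. lookup u k)"
  unfolding mdeg_def by (rule sum.mono_neutral_left) (auto simp: in_keys_iff)

lemma mdeg_add: "mdeg (u + v) = mdeg u + mdeg v"
proof -
  have *: "keys u \<subseteq> keys (u + v)" "keys v \<subseteq> keys (u + v)" by (auto simp: keys_add_nat)
  show ?thesis
    unfolding mdeg_superset[OF finite_keys *(1)] mdeg_superset[OF finite_keys *(2)]
    by (simp add: mdeg_def lookup_add sum.distrib)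
qed

lemma mdeg_eq_0_iff: "mdeg u = 0 \<longleftrightarrow> u = 0"
proof
  assume "mdeg u = 0"
  then have "\<forall>k \<in> keys u. lookup u k = 0" by (simp add: mdeg_def)
  then have "lookup u k = 0" for k by (cases "k \<in> keys u") (simp_all add: in_keys_iff)
  then show "u = 0" by (intro poly_mapping_eqI) simp
qed (simp add: mdeg_def)

lemma minimal_exponent_below:
  assumes "u \<in> U"
  obtains v where "v \<in> U" "exp_le v u" "\<And>w. w \<in> U \<Longrightarrow> exp_le w v \<Longrightarrow> w = v"
proof -
  obtain v where v: "v \<in> U \<and> exp_le v u" "\<And>w. w \<in> U \<and> exp_le w u \<Longrightarrow> mdeg v \<le> mdeg w"
    using ex_has_least_nat[of "\<lambda>v. v \<in> U \<and> exp_le v u" u mdeg] assms by auto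
  have "w = v" if w: "w \<in> U" "exp_le w v" for w
  proof -
    obtain x where x: "v = w + x" using exp_le_addE[OF w(2)] by metis
    have "exp_le w u" using exp_le_trans[OF w(2)] v(1) by blast
    then have "mdeg v \<le> mdeg w" using v(2) w(1) by blast
    then have "x = 0" by (simp add: x mdeg_add mdeg_eq_0_iff)
    then show ?thesis by (simp add: x)
  qed
  with v(1) show thesis by (intro that[of v]) auto
qed

section \<open>Translation between matrices and functions of indices\<close>

definition vfun :: "nat \<Rightarrow> 'b::zero Matrix.vec \<Rightarrow> nat \<Rightarrow> 'b"
  where "vfun r v = (\<lambda>i. if i < r then vec_index v i else 0)"

definition mfun :: "nat \<Rightarrow> nat \<Rightarrow> 'b::zero Matrix.mat \<Rightarrow> nat \<Rightarrow> nat \<Rightarrow> 'b"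
  where "mfun r s M = (\<lambda>i j. if i < r \<and> j < s then M $$ (i, j) else 0)"

lemma vfun_inj: "inj_on (vfun r) (carrier_vec r)"
proof (rule inj_onI)
  fix v w :: "'a Matrix.vec" assume vw: "v \<in> carrier_vec r" "w \<in> carrier_vec r" "vfun r v = vfun r w"
  show "v = w"
  proof (rule eq_vecI)
    fix i assume "i < dim_vec w"
    moreover have "vfun r v i = vfun r w i" using vw(3) by simp
    ultimately show "vec_index v i = vec_index w i" using vw(2) by (simp add: vfun_def)
  qed (use vw in auto)
qed

lemma vfun_free_module: "vfun r ` free_module X r = FM X r"
proof (intro equalityI subsetI)
  fix w assume w: "w \<in> FM X r"
  have "vfun r (Matrix.vec r w) = w" using w by (auto simp: vfun_def FM_def fun_eq_iff)
  moreover have "Matrix.vec r w \<in> free_module X r" using w by (auto simp: free_module_def FM_def)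
  ultimately show "w \<in> vfun r ` free_module X r" by (metis image_eqI)
qed (auto simp: vfun_def free_module_def FM_def)

lemma vfun_mult:
  assumes "M \<in> carrier_mat r s" "v \<in> carrier_vec s"
  shows "vfun r (M *\<^sub>v v) = app (mfun r s M) s (vfun s v)"
proof
  fix i
  show "vfun r (M *\<^sub>v v) i = app (mfun r s M) s (vfun s v) i"
    using assms by (auto simp: vfun_def mfun_def app_def scalar_prod_def lessThan_atLeast0 intro!: sum.cong)
qed

lemma vfun_image:
  assumes "M \<in> carrier_mat r s"
  shows "vfun r ` (\<lambda>w. M *\<^sub>v w) ` free_module X s = app (mfun r s M) s ` FM X s"
proof -
  have "vfun r ` (\<lambda>w. M *\<^sub>v w) ` free_module X s = (\<lambda>w. app (mfun r s M) s (vfun s w)) ` free_module X s"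
    unfolding image_image by (rule image_cong) (auto simp: vfun_mult[OF assms] free_module_def)
  also have "\<dots> = app (mfun r s M) s ` vfun s ` free_module X s" by (simp add: image_image)
  finally show ?thesis by (simp only: vfun_free_module)
qed

lemma vfun_kernel:
  fixes M :: "'a::field mpoly Matrix.mat"
  assumes "M \<in> carrier_mat r s"
  shows "vfun s ` {w \<in> free_module X s. M *\<^sub>v w = 0\<^sub>v (dim_row M)} =
    {w \<in> FM X s. app (mfun r s M) s w = (\<lambda>i. 0)}"
proof -
  have *: "M *\<^sub>v w = 0\<^sub>v (dim_row M) \<longleftrightarrow> app (mfun r s M) s (vfun s w) = (\<lambda>i. 0)"
    if "w \<in> free_module X s" for w
  proof -
    have w: "w \<in> carrier_vec s" using that by (simp add: free_module_def)
    have z: "vfun r (0\<^sub>v r) = (\<lambda>i. 0 :: 'a mpoly)" by (auto simp: vfun_def)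
    have "M *\<^sub>v w = 0\<^sub>v r \<longleftrightarrow> vfun r (M *\<^sub>v w) = vfun r (0\<^sub>v r)"
      by (rule inj_on_eq_iff[OF vfun_inj[of r], symmetric]) (use assms w in auto)
    then show ?thesis unfolding z vfun_mult[OF assms w] using assms by auto
  qed
  show ?thesis
    unfolding vfun_free_module[symmetric] using * by auto
qed

text \<open>The shift arises because \<open>D\<close> carries an extra level \<open>[0]\<close> for
  the polynomial ring itself, which makes the augmentation one more matrix.\<close>

lemma minimal_free_resolution_iff:
  fixes M :: "nat \<Rightarrow> 'a::field mpoly Matrix.mat"
  assumes M: "\<And>i. M i \<in> carrier_mat (length (D i)) (length (D (Suc i)))" and D0: "D 0 = [0]"
    and J: "J \<subseteq> Pol X"
  defines "A \<equiv> (\<lambda>i. mfun (length (D i)) (length (D (Suc i))) (M i))"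
  shows "minimal_free_resolution X J (\<lambda>i. D (Suc i)) M \<longleftrightarrow> resolution X mdeg J D A \<and> minimal A"
proof -
  have gh: "graded_hom X (D (Suc i)) (D i) (M i) \<longleftrightarrow> ghom X mdeg (D (Suc i)) (D i) (A i)" for i
  proof
    assume "graded_hom X (D (Suc i)) (D i) (M i)"
    then show "ghom X mdeg (D (Suc i)) (D i) (A i)"
      unfolding graded_hom_def ghom_def A_def mfun_def by auto
  next
    assume g: "ghom X mdeg (D (Suc i)) (D i) (A i)"
    show "graded_hom X (D (Suc i)) (D i) (M i)"
      unfolding graded_hom_def
    proof (intro conjI allI impI ballI M)
      fix k l assume kl: "k < length (D i)" "l < length (D (Suc i))"
      then have eq: "A i k l = M i $$ (k, l)" by (simp add: A_def mfun_def)
      show "M i $$ (k, l) \<in> Pol X" using ghomD(1)[OF g, of k l] by (simp only: eq)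
      fix m assume "m \<in> keys (M i $$ (k, l))"
      then show "mdeg m + D i ! k = D (Suc i) ! l" using ghomD(4)[OF g, of m k l] by (simp only: eq)
    qed
  qed
  have aug: "(\<lambda>w. vec_index (M 0 *\<^sub>v w) 0) ` free_module X (length (D 1)) = J \<longleftrightarrow>
      app (A 0) (length (D 1)) ` FM X (length (D 1)) = {w \<in> FM X 1. w 0 \<in> J}"
  proof -
    \<comment> \<open>One formulation has polynomials where the other has vectors of length one;
      this embedding is injective and so transports the equation of images.\<close>
    let ?e = "\<lambda>f :: 'a mpoly. \<lambda>i :: nat. if i = 0 then f else 0"
    have "app (A 0) (length (D 1)) ` FM X (length (D 1)) =
        vfun 1 ` (\<lambda>w. M 0 *\<^sub>v w) ` free_module X (length (D 1))"
      using vfun_image[OF M[of 0], of X] by (simp add: A_def D0)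
    also have "\<dots> = ?e ` (\<lambda>w. vec_index (M 0 *\<^sub>v w) 0) ` free_module X (length (D 1))"
      unfolding image_image by (rule image_cong) (auto simp: vfun_def)
    finally have 1: "app (A 0) (length (D 1)) ` FM X (length (D 1)) =
        ?e ` (\<lambda>w. vec_index (M 0 *\<^sub>v w) 0) ` free_module X (length (D 1))" .
    have 2: "{w \<in> FM X 1. w 0 \<in> J} = ?e ` J"
    proof (intro equalityI subsetI)
      fix w assume w: "w \<in> {w \<in> FM X 1. w 0 \<in> J}"
      then have "w = ?e (w 0)" by (auto simp: FM_def fun_eq_iff)
      then show "w \<in> ?e ` J" using w by blast
    qed (use J in \<open>auto simp: FM_def\<close>)
    have "inj ?e"
    proof (rule injI)
      fix f g assume "?e f = ?e g"
      from fun_cong[OF this, of 0] show "f = g" by simp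
    qed
    then show ?thesis unfolding 1 2 by (rule inj_image_eq_iff[symmetric])
  qed
  have ex: "(\<lambda>w. M (Suc i) *\<^sub>v w) ` free_module X (length (D (Suc (Suc i)))) =
        {w \<in> free_module X (length (D (Suc i))). M i *\<^sub>v w = 0\<^sub>v (dim_row (M i))} \<longleftrightarrow>
      app (A (Suc i)) (length (D (Suc (Suc i)))) ` FM X (length (D (Suc (Suc i)))) =
        {w \<in> FM X (length (D (Suc i))). app (A i) (length (D (Suc i))) w = (\<lambda>i. 0)}" for i
    unfolding A_def vfun_image[OF M, symmetric] vfun_kernel[OF M, symmetric]
    by (rule inj_on_image_eq_iff[OF vfun_inj, symmetric])
      (use M[of "Suc i"] in \<open>auto simp: free_module_def\<close>)
  have mn: "minimal A \<longleftrightarrow>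
      (\<forall>i. \<forall>k < length (D (Suc i)). \<forall>l < length (D (Suc (Suc i))). lookup (M (Suc i) $$ (k, l)) 0 = 0)"
    unfolding minimal_def A_def mfun_def by auto
  have all_nat: "(\<forall>i. Q i) \<longleftrightarrow> Q 0 \<and> (\<forall>i. Q (Suc i))" for Q :: "nat \<Rightarrow> bool"
  proof (intro iffI conjI allI)
    fix i assume "Q 0 \<and> (\<forall>i. Q (Suc i))"
    then show "Q i" by (cases i) auto
  qed auto
  show ?thesis
    unfolding minimal_free_resolution_def resolution_def mn gh[symmetric] ex[symmetric]
      aug[symmetric, unfolded One_nat_def] One_nat_def
      all_nat[of "\<lambda>i. graded_hom X (D (Suc i)) (D i) (M i)"] D0
    by blast
qed

section \<open>Degrees in minimal resolutions and bounds for the regularity\<close>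

lemma resolution_mdeg:
  assumes "resolution X (\<lambda>m. m) J D A"
  shows "resolution X mdeg J (\<lambda>i. map mdeg (D i)) A"
proof -
  have "ghom X mdeg (map mdeg (D (Suc i))) (map mdeg (D i)) (A i)" for i
    unfolding ghom_def
  proof (intro allI conjI ballI)
    fix k l
    note gh = resolutionD(2)[OF assms, of i]
    show "A i k l \<in> Pol X" by (rule ghomD(1)[OF gh])
    fix m assume m: "m \<in> keys (A i k l)"
    show "k < length (map mdeg (D i))" "l < length (map mdeg (D (Suc i)))"
      using ghomD(2,3)[OF gh m] by simp_all
    then show "mdeg m + map mdeg (D i) ! k = map mdeg (D (Suc i)) ! l"
      using ghomD(4)[OF gh m] by (simp add: mdeg_add[symmetric])
  qed
  moreover have "mdeg 0 = 0" by (simp add: mdeg_eq_0_iff)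
  ultimately show ?thesis using assms unfolding resolution_def length_map by simp
qed

text \<open>Ensures that the choice in \<open>regularity\<close> returns an actual
  resolution.\<close>

lemma exists_minimal_free_resolution:
  assumes "finite X" and U: "\<And>u v. u \<in> U \<Longrightarrow> keys v \<subseteq> X \<Longrightarrow> v + u \<in> U"
  shows "\<exists>D A. minimal_free_resolution X (monomial_ideal X U :: 'a::field mpoly set) D A"
proof -
  obtain D and A :: "nat \<Rightarrow> nat \<Rightarrow> nat \<Rightarrow> 'a mpoly"
    where res: "resolution X (\<lambda>m. m) (monomial_ideal X U) D A" and min: "minimal A"
    using exists_minimal_multigraded_resolution[OF assms] by metis
  define E where "E = (\<lambda>i. map mdeg (D i))"
  note res' = resolution_mdeg[OF res, folded E_def]
  define M where "M = (\<lambda>i. Matrix.mat (length (E i)) (length (E (Suc i))) (\<lambda>(k, l). A i k l))"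
  have A_eq: "mfun (length (E i)) (length (E (Suc i))) (M i) = A i" for i
  proof (intro ext)
    fix k l
    show "mfun (length (E i)) (length (E (Suc i))) (M i) k l = A i k l"
      using ghomD(5,6)[OF resolutionD(2)[OF res', of i], of k l] ghomD(6)[OF resolutionD(2)[OF res', of i], of l k]
      by (auto simp: mfun_def M_def)
  qed
  have "minimal_free_resolution X (monomial_ideal X U) (\<lambda>i. E (Suc i)) M"
  proof (subst minimal_free_resolution_iff)
    show "M i \<in> carrier_mat (length (E i)) (length (E (Suc i)))" for i by (simp add: M_def)
    show "E 0 = [0]" by (rule resolutionD(1)[OF res'])
    show "monomial_ideal X U \<subseteq> (Pol X :: 'a mpoly set)" by (auto simp: monomial_ideal_def)
    show "resolution X mdeg (monomial_ideal X U) E (\<lambda>i. mfun (length (E i)) (length (E (Suc i))) (M i)) \<and>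
        minimal (\<lambda>i. mfun (length (E i)) (length (E (Suc i))) (M i))"
      unfolding A_eq using res' min by simp
  qed
  then show ?thesis by blast
qed

text \<open>Entries without constant term raise degrees by at least one, and no column is zero: a
  basis vector that is a cycle would be a boundary, but boundaries have no constant terms. The
  estimate bounds the set in \<open>regularity\<close> from below, so that its maximum
  exists.\<close>

lemma minimal_resolution_degree_ge:
  fixes A :: "nat \<Rightarrow> nat \<Rightarrow> nat \<Rightarrow> 'a::field mpoly"
  assumes res: "resolution X mdeg J D A" and min: "minimal A"
  shows "d \<in> set (D (Suc i)) \<Longrightarrow> i \<le> d"
proof (induction i arbitrary: d)
  case (Suc i)
  then obtain l where l: "l < length (D (Suc (Suc i)))" "d = D (Suc (Suc i)) ! l"
    by (auto simp: in_set_conv_nth)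
  let ?e = "\<lambda>k. if k = l then 1 else (0 :: 'a mpoly)"
  have "\<exists>k. A (Suc i) k l \<noteq> 0"
  proof (rule ccontr)
    assume "\<nexists>k. A (Suc i) k l \<noteq> 0"
    then have "app (A (Suc i)) (length (D (Suc (Suc i)))) ?e = (\<lambda>k. 0)"
      by (simp add: app_unit[OF l(1)])
    then have "?e \<in> cycles X J D A (Suc (Suc i))"
      using unit_FM[OF l(1), of X] by (simp add: cycles_def)
    then obtain u where u: "?e = app (A (Suc (Suc i))) (length (D (Suc (Suc (Suc i))))) u"
      using resolutionD(3)[OF res, of "Suc (Suc i)"] by blast
    have "1 = (\<Sum>j < length (D (Suc (Suc (Suc i)))). A (Suc (Suc i)) l j * u j)"
      using fun_cong[OF u, of l] by (simp add: app_def)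
    from arg_cong[OF this, of "\<lambda>p. lookup p 0"] have "lookup (1 :: 'a mpoly) 0 =
        (\<Sum>j < length (D (Suc (Suc (Suc i)))). lookup (A (Suc (Suc i)) l j) 0 * lookup (u j) 0)"
      by (simp only: lookup_sum lookup_times_0)
    also have "\<dots> = 0" using min by (simp add: minimal_def)
    finally show False by (simp add: lookup_one)
  qed
  then obtain k where "A (Suc i) k l \<noteq> 0" by blast
  then have "keys (A (Suc i) k l) \<noteq> {}" by simp
  then obtain m where m: "m \<in> keys (A (Suc i) k l)" by blast
  have "m \<noteq> 0"
  proof
    assume "m = 0"
    with m have "lookup (A (Suc i) k l) 0 \<noteq> 0" by (simp add: in_keys_iff)
    then show False using min by (simp add: minimal_def)
  qed
  then have "1 \<le> mdeg m" using mdeg_eq_0_iff[of m] by linarith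
  note gh = resolutionD(2)[OF res, of "Suc i"]
  have "i \<le> D (Suc i) ! k" using Suc.IH[of "D (Suc i) ! k"] ghomD(2)[OF gh m] by simp
  with ghomD(4)[OF gh m] l(2) \<open>1 \<le> mdeg m\<close> show ?case by simp
qed simp

text \<open>The monomial is a combination of the entries of the augmentation, so one entry has a
  monomial dividing it. That monomial lies in \<open>U\<close>, hence equals \<open>u\<close> by
  minimality.\<close>

lemma minimal_generator_degree:
  fixes A :: "nat \<Rightarrow> nat \<Rightarrow> nat \<Rightarrow> 'a::field mpoly"
  assumes res: "resolution X mdeg (monomial_ideal X U) D A"
    and u: "u \<in> U" "keys u \<subseteq> X" "\<And>w. w \<in> U \<Longrightarrow> exp_le w u \<Longrightarrow> w = u"
  shows "mdeg u \<in> set (D 1)"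
proof -
  let ?J = "monomial_ideal X U :: 'a mpoly set"
  let ?e = "\<lambda>k. if k = 0 then mon u else (0 :: 'a mpoly)"
  have "mon u \<in> ?J" using u(1,2) by (simp add: monomial_ideal_def)
  then have "?e \<in> cycles X ?J D A 0" by (simp add: cycles_def FM_def u(2))
  then have "?e \<in> app (A 0) (length (D (Suc 0))) ` FM X (length (D (Suc 0)))"
    unfolding resolutionD(3)[OF res, of 0] .
  then obtain w where w: "?e = app (A 0) (length (D (Suc 0))) w" by (rule imageE)
  have "mon u = app (A 0) (length (D (Suc 0))) w 0" using fun_cong[OF w, of 0] by simp
  then have eq: "mon u = (\<Sum>j < length (D (Suc 0)). A 0 0 j * w j)" by (simp add: app_def)
  have "u \<in> keys (mon u :: 'a mpoly)" by simp
  then have "u \<in> (\<Union>j \<in> {..<length (D (Suc 0))}. keys (A 0 0 j * w j))"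
    unfolding eq using keys_sum by (rule subsetD[rotated])
  then obtain j where j: "j < length (D (Suc 0))" "u \<in> keys (A 0 0 j * w j)" by blast
  then obtain a b where ab: "u = a + b" "a \<in> keys (A 0 0 j)" using keys_mult[of "A 0 0 j" "w j"] by blast
  have "(\<lambda>k. A 0 k j) \<in> cycles X ?J D A 0" by (rule column_cycle[OF res j(1)])
  then have "A 0 0 j \<in> ?J" by (simp add: cycles_def)
  then have "a \<in> U" using ab(2) by (rule monomial_idealD(2))
  then have "a = u" using u(3)[of a] by (simp add: ab(1))
  then have "mdeg u + D 0 ! 0 = D (Suc 0) ! j"
    using ghomD(4)[OF resolutionD(2)[OF res, of 0] ab(2)] by simp
  then show ?thesis using j(1) by (simp add: resolutionD(1)[OF res])
qed

text \<open>A minimal generator bounds the maximum from below. From above, d - i is at most d, which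
  is the total degree of some multidegree; \<open>bound\<close> is phrased for exactly what
  \<open>minimal_multidegree\<close> says about it.\<close>

lemma regularity_bounds:
  assumes "finite X" and U: "\<And>u v. u \<in> U \<Longrightarrow> keys v \<subseteq> X \<Longrightarrow> v + u \<in> U"
    and u: "u \<in> U" "keys u \<subseteq> X" "\<And>w. w \<in> U \<Longrightarrow> exp_le w u \<Longrightarrow> w = u"
    and bound: "\<And>a. keys a \<subseteq> X \<Longrightarrow> (\<And>j. j \<in> X \<Longrightarrow> \<exists>b. exp_le b a \<and>
      (\<forall>k. lookup a k \<le> lookup b k + 1) \<and> lookup b j = lookup a j \<and> b \<in> U \<and>
      (lookup b j = 0 \<or> b - unit_exp j \<notin> U)) \<Longrightarrow> real (mdeg a) \<le> B"
  shows "real (mdeg u) \<le> real_of_int (regularity X (monomial_ideal X U :: 'a::field mpoly set)) \<and>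
    real_of_int (regularity X (monomial_ideal X U :: 'a::field mpoly set)) \<le> B"
proof -
  let ?J = "monomial_ideal X U :: 'a mpoly set"
  define D0 where "D0 = (SOME D. \<exists>A. minimal_free_resolution X ?J D A)"
  have "\<exists>D A. minimal_free_resolution X ?J D A"
    by (rule exists_minimal_free_resolution[OF assms(1,2)])
  from someI_ex[OF this] have "\<exists>A. minimal_free_resolution X ?J D0 A" unfolding D0_def .
  then obtain M where M: "minimal_free_resolution X ?J D0 M" ..
  define D where "D = (\<lambda>i. case i of 0 \<Rightarrow> [0] | Suc i \<Rightarrow> D0 i)"
  define A where "A = (\<lambda>i. mfun (length (D i)) (length (D (Suc i))) (M i))"
  have D_simps: "D 0 = [0]" "(\<lambda>i. D (Suc i)) = D0" by (simp_all add: D_def)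
  have dim: "M i \<in> carrier_mat (length (D i)) (length (D (Suc i)))" for i
    using M by (cases i) (simp_all add: minimal_free_resolution_def graded_hom_def D_def)
  have JP: "?J \<subseteq> Pol X" by (auto simp: monomial_ideal_def)
  have "resolution X mdeg ?J D A \<and> minimal A"
    using minimal_free_resolution_iff[OF dim D_simps(1) JP] M unfolding D_simps(2) A_def by blast
  then have res: "resolution X mdeg ?J D A" and min: "minimal A" by auto
  obtain D' and A' :: "nat \<Rightarrow> nat \<Rightarrow> nat \<Rightarrow> 'a mpoly"
    where res': "resolution X (\<lambda>m. m) ?J D' A'" and min': "minimal A'"
      and D'X: "\<And>i d. d \<in> set (D' i) \<Longrightarrow> keys d \<subseteq> X"
  proof (rule exists_minimal_multigraded_resolution[where 'a='a, OF assms(1,2)])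
    fix D' and A' :: "nat \<Rightarrow> nat \<Rightarrow> nat \<Rightarrow> 'a mpoly"
    assume "resolution X (\<lambda>m. m) ?J D' A'" "minimal A'" "\<And>i d. d \<in> set (D' i) \<Longrightarrow> keys d \<subseteq> X"
    then show thesis by (rule that)
  qed
  have le_B: "real d \<le> B" if "d \<in> set (D (Suc i))" for d i
  proof -
    \<comment> \<open>All degrees of the chosen resolution occur among the total degrees of the
      multigraded one.\<close>
    have "d \<in> set (map mdeg (D' (Suc i)))"
      using minimal_resolution_degrees[OF res min resolution_mdeg[OF res'] mdeg_add] that by (rule subsetD)
    then obtain a where a: "a \<in> set (D' (Suc i))" "d = mdeg a" by auto
    show ?thesis
      unfolding a(2) using D'X[OF a(1)] minimal_multidegree[OF assms(1) res' min' a(1)] by (rule bound)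
  qed
  define S where "S = {int d - int i | d i. d \<in> set (D0 i)}"
  have S_bounds: "0 \<le> s \<and> real_of_int s \<le> B" if sS: "s \<in> S" for s
  proof -
    obtain d i where di: "s = int d - int i" "d \<in> set (D (Suc i))" using sS by (auto simp: S_def D_def)
    have "i \<le> d" "real d \<le> B" using minimal_resolution_degree_ge[OF res min di(2)] le_B[OF di(2)] by auto
    then show ?thesis by (simp add: di(1))
  qed
  \<comment> \<open>Finiteness over all levels at once comes from bounds that do not depend on the
    level.\<close>
  have "S \<subseteq> {0..\<lfloor>B\<rfloor>}" using S_bounds by (auto simp: le_floor_iff)
  then have finS: "finite S" by (rule finite_subset) simp
  have "mdeg u \<in> set (D0 0)" using minimal_generator_degree[OF res u] by (simp add: D_def)
  then have uS: "int (mdeg u) \<in> S" unfolding S_def by force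
  have reg: "regularity X ?J = Max S" by (simp add: regularity_def D0_def S_def)
  have "int (mdeg u) \<le> Max S" using finS uS by (rule Max_ge)
  moreover have "Max S \<in> S" using finS uS by (intro Max_in) auto
  ultimately show ?thesis unfolding reg using S_bounds[of "Max S"] by linarith
qed

section \<open>Asymptotic invariants\<close>

lemma linear_growth_limit:
  fixes x :: "nat \<Rightarrow> real"
  assumes "\<And>m. m \<ge> 1 \<Longrightarrow> real m * c - K \<le> x m" "\<And>m. m \<ge> 1 \<Longrightarrow> x m \<le> real m * c + K"
  shows "(\<lambda>m. x m / real m) \<longlonglongrightarrow> c"
proof -
  have lim: "(\<lambda>m. K / real m) \<longlonglongrightarrow> 0" by (rule lim_const_over_n)
  have lower: "(\<lambda>m. c - K / real m) \<longlonglongrightarrow> c" using tendsto_diff[OF tendsto_const lim, of c] by simp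
  have upper: "(\<lambda>m. c + K / real m) \<longlonglongrightarrow> c" using tendsto_add[OF tendsto_const lim, of c] by simp
  have "c - K / real m \<le> x m / real m" if "m \<ge> 1" for m
  proof -
    have "(real m * c - K) / real m \<le> x m / real m"
      by (rule divide_right_mono[OF assms(1)[OF that]]) simp
    then show ?thesis using that by (simp add: diff_divide_distrib)
  qed
  moreover have "x m / real m \<le> c + K / real m" if "m \<ge> 1" for m
  proof -
    have "x m / real m \<le> (real m * c + K) / real m"
      by (rule divide_right_mono[OF assms(2)[OF that]]) simp
    then show ?thesis using that by (simp add: add_divide_distrib)
  qed
  ultimately show ?thesis
    by (intro tendsto_sandwich[OF _ _ lower upper] eventually_sequentiallyI[of 1])
qed

section \<open>Passing between exponents and points of the polyhedron\<close>

definition scale_exp :: "real \<Rightarrow> (nat \<Rightarrow>\<^sub>0 nat) \<Rightarrow> nat \<Rightarrow>\<^sub>0 real"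
  where "scale_exp t u = Poly_Mapping.mapp (\<lambda>k c. t * real c) u"

lemma lookup_scale_exp: "lookup (scale_exp t u) k = t * real (lookup u k)"
  by (auto simp: scale_exp_def lookup_mapp when_def in_keys_iff)

lemma keys_scale_exp: "keys (scale_exp t u) \<subseteq> keys u"
  unfolding scale_exp_def by (rule keys_mapp_subset)

definition ceil_exp :: "nat \<Rightarrow> (nat \<Rightarrow>\<^sub>0 real) \<Rightarrow> nat \<Rightarrow>\<^sub>0 nat"
  where "ceil_exp m v = Poly_Mapping.mapp (\<lambda>k c. nat \<lceil>real m * c\<rceil>) v"

lemma lookup_ceil_exp: "lookup (ceil_exp m v) k = nat \<lceil>real m * lookup v k\<rceil>"
  by (auto simp: ceil_exp_def lookup_mapp when_def in_keys_iff)

lemma keys_ceil_exp: "keys (ceil_exp m v) \<subseteq> keys v"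
  unfolding ceil_exp_def by (rule keys_mapp_subset)

context covering
begin

lemma finite_M: "M \<in> C \<Longrightarrow> finite M" using C_sub finite_X finite_subset by blast

lemma scale_exp_P:
  assumes "m \<ge> 1" "u \<in> sym_exps C m" "keys u \<subseteq> X"
  shows "scale_exp (1 / real m) u \<in> P"
proof -
  have "keys (scale_exp (1 / real m) u) \<subseteq> X"
    by (rule order_trans[OF keys_scale_exp assms(3)])
  moreover have "1 \<le> (\<Sum>k \<in> M. lookup (scale_exp (1 / real m) u) k)" if "M \<in> C" for M
  proof -
    have "m \<le> (\<Sum>k \<in> M. lookup u k)" using assms(2) that by (simp add: sym_exps_def)
    then have "real m \<le> real (\<Sum>k \<in> M. lookup u k)" by (simp only: of_nat_le_iff)
    moreover have "(\<Sum>k \<in> M. lookup (scale_exp (1 / real m) u) k) = real (\<Sum>k \<in> M. lookup u k) / real m"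
      by (simp add: lookup_scale_exp sum_divide_distrib)
    ultimately show ?thesis using assms(1) by (simp add: le_divide_eq)
  qed
  ultimately show ?thesis by (simp add: cov_poly_def lookup_scale_exp)
qed

lemma coord_sum_scale_exp:
  assumes "keys u \<subseteq> X"
  shows "coord_sum (scale_exp t u) = t * real (mdeg u)"
  using order_trans[OF keys_scale_exp assms]
  by (simp add: coord_sum_superset[OF finite_X] mdeg_superset[OF finite_X assms] lookup_scale_exp sum_distrib_left)

lemma ceil_exp_bounds:
  assumes "v \<in> P"
  shows "real m * lookup v k \<le> real (lookup (ceil_exp m v) k)"
    "real (lookup (ceil_exp m v) k) \<le> real m * lookup v k + 1"
proof -
  have "0 \<le> real m * lookup v k" using P_nonneg[OF assms] by simp
  then have "real (lookup (ceil_exp m v) k) = of_int \<lceil>real m * lookup v k\<rceil>"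
    by (simp add: lookup_ceil_exp)
  then show "real m * lookup v k \<le> real (lookup (ceil_exp m v) k)"
    "real (lookup (ceil_exp m v) k) \<le> real m * lookup v k + 1"
    by linarith+
qed

lemma ceil_exp_sym:
  assumes "v \<in> P"
  shows "ceil_exp m v \<in> sym_exps C m" "keys (ceil_exp m v) \<subseteq> X"
proof -
  have "m \<le> (\<Sum>k \<in> M. lookup (ceil_exp m v) k)" if "M \<in> C" for M
  proof -
    have "1 \<le> msum v M" using assms that by (simp add: cov_poly_def)
    then have "real m * 1 \<le> real m * msum v M" by (rule mult_left_mono) simp
    also have "\<dots> \<le> (\<Sum>k \<in> M. real (lookup (ceil_exp m v) k))"
      unfolding sum_distrib_left by (rule sum_mono) (rule ceil_exp_bounds[OF assms])
    finally have "real m \<le> real (\<Sum>k \<in> M. lookup (ceil_exp m v) k)" by simp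
    then show ?thesis by (simp only: of_nat_le_iff)
  qed
  then show "ceil_exp m v \<in> sym_exps C m" by (simp add: sym_exps_def)
  have "keys v \<subseteq> X" using assms by (simp add: cov_poly_def)
  then show "keys (ceil_exp m v) \<subseteq> X" by (rule order_trans[OF keys_ceil_exp])
qed

lemma sym_exps_up: "u \<in> sym_exps C m \<Longrightarrow> v + u \<in> sym_exps C m"
  unfolding sym_exps_def by (auto simp: lookup_add sum.distrib intro: trans_le_add2)

text \<open>Lowering \<open>u\<close> at \<open>j\<close> violates the inequality of some cover;
  this cover must contain \<open>j\<close> and have had sum exactly \<open>m\<close>.\<close>

lemma minimal_sym_exp:
  assumes u: "u \<in> sym_exps C m" "\<And>w. w \<in> sym_exps C m \<Longrightarrow> exp_le w u \<Longrightarrow> w = u"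
    and j: "lookup u j \<noteq> 0"
  shows "\<exists>M \<in> C. j \<in> M \<and> (\<Sum>k \<in> M. lookup u k) = m"
proof -
  define w where "w = u - unit_exp j"
  have uw: "u = unit_exp j + w" using exp_split[OF j] by (simp add: w_def)
  have lu: "lookup u k = (if k = j then 1 else 0) + lookup w k" for k
    by (simp add: uw lookup_add lookup_single when_def)
  have "w \<noteq> u" using lu[of j] by auto
  moreover have "exp_le w u" unfolding uw by simp
  ultimately have "w \<notin> sym_exps C m" using u(2) by blast
  then obtain M where M: "M \<in> C" "(\<Sum>k \<in> M. lookup w k) < m" by (auto simp: sym_exps_def not_le)
  have mM: "m \<le> (\<Sum>k \<in> M. lookup u k)" using u(1) M(1) by (simp add: sym_exps_def)
  have "(\<Sum>k \<in> M. lookup u k) = (if j \<in> M then 1 else 0) + (\<Sum>k \<in> M. lookup w k)"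
    using finite_M[OF M(1)] by (simp add: lu sum.distrib)
  then have "j \<in> M \<and> (\<Sum>k \<in> M. lookup u k) = m" using M(2) mM by (auto split: if_splits)
  then show ?thesis using M(1) by blast
qed

lemma alpha_limit:
  assumes v: "v \<in> vertices P" "\<And>w. w \<in> vertices P \<Longrightarrow> coord_sum v \<le> coord_sum w"
  shows "(\<lambda>m. real (alpha (monomial_ideal X (sym_exps C m) :: 'a::field mpoly set)) / real m)
    \<longlonglongrightarrow> coord_sum v"
proof (rule linear_growth_limit)
  fix m :: nat assume m: "m \<ge> 1"
  let ?J = "monomial_ideal X (sym_exps C m) :: 'a mpoly set"
  have vP: "v \<in> P" using v(1) by (simp add: vertices_def extreme_point_of_def)
  define u where "u = ceil_exp m v"
  have u: "u \<in> sym_exps C m" "keys u \<subseteq> X" using ceil_exp_sym[OF vP] by (simp_all add: u_def)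
  have uJ: "mon u \<in> ?J" using u by (simp add: monomial_ideal_def)
  have "keys (mon u :: 'a mpoly) \<noteq> {}" by simp
  then have u0: "mon u \<noteq> (0 :: 'a mpoly)" by (simp only: keys_eq_empty not_False_eq_True)
  have ut: "tdeg (mon u :: 'a mpoly) = mdeg u" by (simp add: tdeg_def)
  have ex: "\<exists>f \<in> ?J. f \<noteq> 0 \<and> tdeg f = mdeg u" using uJ u0 ut by blast
  have "alpha ?J \<le> mdeg u" unfolding alpha_def
    by (rule Least_le[of "\<lambda>d. \<exists>f \<in> ?J. f \<noteq> 0 \<and> tdeg f = d", OF ex])
  then have "real (alpha ?J) \<le> real (mdeg u)" by simp
  also have "real (mdeg u) = (\<Sum>k \<in> X. real (lookup u k))" by (simp add: mdeg_superset[OF finite_X u(2)])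
  \<comment> \<open>Rounding costs at most one per coordinate, so the error term of the limit is
    \<open>card X\<close>.\<close>
  also have "\<dots> \<le> (\<Sum>k \<in> X. real m * lookup v k + 1)"
    unfolding u_def by (rule sum_mono) (rule ceil_exp_bounds[OF vP])
  also have "\<dots> = real m * (\<Sum>k \<in> X. lookup v k) + real (card X)"
    by (simp add: sum.distrib sum_distrib_left)
  also have "(\<Sum>k \<in> X. lookup v k) = coord_sum v"
    using vP by (intro coord_sum_superset[symmetric] finite_X) (simp add: cov_poly_def)
  finally show "real (alpha ?J) \<le> real m * coord_sum v + real (card X)" .
  have "\<exists>f \<in> ?J. f \<noteq> 0 \<and> tdeg f = alpha ?J"
    unfolding alpha_def by (rule LeastI[of "\<lambda>d. \<exists>f \<in> ?J. f \<noteq> 0 \<and> tdeg f = d", OF ex])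
  then obtain f where f: "f \<in> ?J" "f \<noteq> 0" "tdeg f = alpha ?J" by blast
  then have "keys f \<noteq> {}" by simp
  then obtain w where w: "w \<in> keys f" by blast
  have wU: "w \<in> sym_exps C m" "keys w \<subseteq> X" using monomial_idealD(2,3)[OF f(1) w] by auto
  obtain v' where v': "v' \<in> vertices P" "coord_sum v' \<le> coord_sum (scale_exp (1 / real m) w)"
    using vertex_below[OF scale_exp_P[OF m wU]] by blast
  have "coord_sum v \<le> 1 / real m * real (mdeg w)"
    using v(2)[OF v'(1)] v'(2) unfolding coord_sum_scale_exp[OF wU(2)] by linarith
  then have "real m * coord_sum v \<le> real (mdeg w)" using m by (simp add: field_simps)
  moreover have "mdeg w \<le> alpha ?J" unfolding f(3)[symmetric] tdeg_def using w by (intro Max_ge) auto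
  ultimately show "real m * coord_sum v - real (card X) \<le> real (alpha ?J)" by linarith
qed

text \<open>The error term is \<open>N * N\<close> with N the number of variables: in both estimates
  each coordinate is off by at most N, since it is controlled by a tight or nearly tight cover with
  at most N elements.\<close>

lemma regularity_limit:
  assumes v: "v \<in> vertices P" "\<And>w. w \<in> vertices P \<Longrightarrow> coord_sum w \<le> coord_sum v"
  shows "(\<lambda>m. real_of_int (regularity X (monomial_ideal X (sym_exps C m) :: 'a::field mpoly set)) / real m)
    \<longlonglongrightarrow> coord_sum v"
proof (rule linear_growth_limit)
  fix m :: nat assume m: "m \<ge> 1"
  let ?U = "sym_exps C m"
  let ?J = "monomial_ideal X ?U :: 'a mpoly set"
  define N where "N = real (card X)"
  have cardM: "real (card M) \<le> N" if "M \<in> C" for M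
    unfolding N_def using card_mono[OF finite_X C_sub[OF that]] by simp
  have vP: "v \<in> P" using v(1) by (simp add: vertices_def extreme_point_of_def)
  have vX: "keys v \<subseteq> X" using vP by (simp add: cov_poly_def)
  obtain u where u: "u \<in> ?U" "exp_le u (ceil_exp m v)" "\<And>w. w \<in> ?U \<Longrightarrow> exp_le w u \<Longrightarrow> w = u"
    by (rule minimal_exponent_below[OF ceil_exp_sym(1)[OF vP]]) blast
  have uX: "keys u \<subseteq> X" using exp_le_keys[OF u(2)] ceil_exp_sym(2)[OF vP] by (rule order_trans)
  have u_le: "real (lookup u k) \<le> real m * lookup v k + 1" for k
  proof -
    have "lookup u k \<le> lookup (ceil_exp m v) k" using u(2) by (simp add: exp_le_def)
    then show ?thesis using ceil_exp_bounds(2)[OF vP, of m k] by linarith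
  qed
  \<comment> \<open>On a tight cover of \<open>v\<close> containing \<open>j\<close> the sum of
    \<open>u\<close> is at least \<open>m\<close>, while every other coordinate of \<open>u\<close>
    exceeds that of \<open>m\<close> times \<open>v\<close> by at most one.\<close>
  have u_ge: "real m * lookup v j - N \<le> real (lookup u j)" if j: "j \<in> X" for j
  proof (cases "lookup v j = 0")
    case False
    then obtain M where M: "M \<in> C" "j \<in> M" "msum v M = 1"
      using vertex_compact_face[OF v(1)] j unfolding compact_face_def by blast
    have "m \<le> (\<Sum>k \<in> M. lookup u k)" using u(1) M(1) by (simp add: sym_exps_def)
    then have "real m \<le> real (\<Sum>k \<in> M. lookup u k)" by (simp only: of_nat_le_iff)
    also have "\<dots> = (\<Sum>k \<in> M. real (lookup u k))" by simp
    also have "\<dots> = real (lookup u j) + (\<Sum>k \<in> M - {j}. real (lookup u k))"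
      using finite_M[OF M(1)] M(2) by (rule sum.remove)
    also have "(\<Sum>k \<in> M - {j}. real (lookup u k)) \<le> (\<Sum>k \<in> M - {j}. real m * lookup v k + 1)"
      by (rule sum_mono) (rule u_le)
    also have "(\<Sum>k \<in> M - {j}. real m * lookup v k + 1) =
        real m * (\<Sum>k \<in> M - {j}. lookup v k) + real (card (M - {j}))"
      by (simp add: sum.distrib sum_distrib_left)
    also have "(\<Sum>k \<in> M - {j}. lookup v k) = 1 - lookup v j"
      using sum.remove[OF finite_M[OF M(1)] M(2), of "lookup v"] M(3) by simp
    also have "real (card (M - {j})) \<le> N"
    proof -
      have "card (M - {j}) \<le> card M" by (rule card_mono[OF finite_M[OF M(1)]]) blast
      then show ?thesis using cardM[OF M(1)] by linarith
    qed
    finally show ?thesis by (simp add: right_diff_distrib)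
  qed (simp add: N_def)
  have "real m * coord_sum v - N * N = (\<Sum>j \<in> X. real m * lookup v j - N)"
    by (simp add: coord_sum_superset[OF finite_X vX] sum_subtractf sum_distrib_left N_def)
  also have "\<dots> \<le> (\<Sum>j \<in> X. real (lookup u j))" by (rule sum_mono) (rule u_ge)
  also have "\<dots> = real (mdeg u)" by (simp add: mdeg_superset[OF finite_X uX])
  finally have lower: "real m * coord_sum v - N * N \<le> real (mdeg u)" .
  \<comment> \<open>\<open>a\<close> is compared with a minimal exponent \<open>b\<close> below it.
    Divided by \<open>m\<close>, \<open>b\<close> lies on a compact face, so its coordinate sum is
    at most that of \<open>v\<close>.\<close>
  have upper: "real (mdeg a) \<le> real m * coord_sum v + N * N"
    if aX: "keys a \<subseteq> X" and a: "\<And>j. j \<in> X \<Longrightarrow> \<exists>b. exp_le b a \<and>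
      (\<forall>k. lookup a k \<le> lookup b k + 1) \<and> lookup b j = lookup a j \<and> b \<in> ?U \<and>
      (lookup b j = 0 \<or> b - unit_exp j \<notin> ?U)" for a
  proof (cases "X = {}")
    \<comment> \<open>Without variables there is no index \<open>j\<close> to provide an element of
      \<open>?U\<close> below \<open>a\<close>.\<close>
    case True
    then have "keys a = {}" "keys v = {}" using aX vX by auto
    then show ?thesis by (simp add: mdeg_def coord_sum_def N_def)
  next
    case False
    then obtain j0 where "j0 \<in> X" by blast
    from a[OF this] obtain b0 where b0: "exp_le b0 a" "b0 \<in> ?U" by blast
    obtain x0 where "a = b0 + x0" using exp_le_addE[OF b0(1)] by blast
    then have aU: "a \<in> ?U" using sym_exps_up[OF b0(2), of x0] by (simp only: add.commute)
    obtain b where b: "b \<in> ?U" "exp_le b a" "\<And>w. w \<in> ?U \<Longrightarrow> exp_le w b \<Longrightarrow> w = b"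
      by (rule minimal_exponent_below[OF aU]) blast
    have bX: "keys b \<subseteq> X" using exp_le_keys[OF b(2)] aX by (rule order_trans)
    have "compact_face (scale_exp (1 / real m) b)"
      unfolding compact_face_def
    proof
      fix k assume "k \<in> X"
      show "lookup (scale_exp (1 / real m) b) k = 0 \<or>
          (\<exists>M \<in> C. k \<in> M \<and> msum (scale_exp (1 / real m) b) M = 1)"
      proof (cases "lookup b k = 0")
        case False
        obtain M where M: "M \<in> C" "k \<in> M" "(\<Sum>k \<in> M. lookup b k) = m"
          using minimal_sym_exp[OF b(1,3) False] by blast
        have "msum (scale_exp (1 / real m) b) M = real (\<Sum>k \<in> M. lookup b k) / real m"
          by (simp add: lookup_scale_exp sum_divide_distrib)
        then have "msum (scale_exp (1 / real m) b) M = 1" using m unfolding M(3) by simp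
        then show ?thesis using M(1,2) by blast
      qed (simp add: lookup_scale_exp)
    qed
    then obtain v' where v': "v' \<in> vertices P" "coord_sum (scale_exp (1 / real m) b) \<le> coord_sum v'"
      using vertex_above[OF scale_exp_P[OF m b(1) bX]] by blast
    have "1 / real m * real (mdeg b) \<le> coord_sum v"
      using v(2)[OF v'(1)] v'(2) unfolding coord_sum_scale_exp[OF bX] by linarith
    then have mb: "real (mdeg b) \<le> real m * coord_sum v" using m by (simp add: field_simps)
    \<comment> \<open>Lowering \<open>c\<close> at \<open>j\<close> leaves \<open>?U\<close>, so
      some cover \<open>M\<close> containing \<open>j\<close> has sum exactly \<open>m\<close> in
      \<open>c\<close>. On \<open>M\<close> the sum of \<open>a\<close> is at most
      \<open>m + card M\<close> and that of \<open>b\<close> at least \<open>m\<close>; as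
      \<open>b\<close> lies below \<open>a\<close>, coordinate \<open>j\<close> differs by at most
      \<open>card M\<close>.\<close>
    have diff: "real (lookup a j) \<le> real (lookup b j) + N" if j: "j \<in> X" for j
    proof (cases "lookup a j = 0")
      case False
      obtain c where c: "\<forall>k. lookup a k \<le> lookup c k + 1" "lookup c j = lookup a j" "c \<in> ?U"
          "lookup c j = 0 \<or> c - unit_exp j \<notin> ?U"
        using a[OF j] by blast
      have cj0: "lookup c j \<noteq> 0" "c - unit_exp j \<notin> ?U" using c(2,4) False by auto
      define d where "d = c - unit_exp j"
      have lc: "lookup c k = (if k = j then 1 else 0) + lookup d k" for k
        using arg_cong[OF exp_split[OF cj0(1)], of "\<lambda>u. lookup u k"]
        by (auto simp: lookup_add lookup_single when_def d_def split: if_splits)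
      obtain M where M: "M \<in> C" "(\<Sum>k \<in> M. lookup d k) < m"
        using cj0(2) unfolding d_def[symmetric] sym_exps_def by (auto simp: not_le)
      have "m \<le> (\<Sum>k \<in> M. lookup c k)" using c(3) M(1) by (simp add: sym_exps_def)
      moreover have "(\<Sum>k \<in> M. lookup c k) = (if j \<in> M then 1 else 0) + (\<Sum>k \<in> M. lookup d k)"
        using finite_M[OF M(1)] by (simp add: lc sum.distrib)
      ultimately have jM: "j \<in> M" and cm: "(\<Sum>k \<in> M. lookup c k) = m" using M(2) by (auto split: if_splits)
      have "(\<Sum>k \<in> M. lookup a k) \<le> (\<Sum>k \<in> M. lookup c k + 1)"
        by (rule sum_mono) (rule c(1)[rule_format])
      also have "\<dots> = (\<Sum>k \<in> M. lookup c k) + card M" by (simp only: sum.distrib card_eq_sum)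
      finally have am: "(\<Sum>k \<in> M. lookup a k) \<le> m + card M" unfolding cm .
      have bm: "m \<le> (\<Sum>k \<in> M. lookup b k)" using b(1) M(1) by (simp add: sym_exps_def)
      have "(\<Sum>k \<in> M - {j}. lookup b k) \<le> (\<Sum>k \<in> M - {j}. lookup a k)"
        using b(2) by (intro sum_mono) (simp add: exp_le_def)
      then have "lookup a j \<le> lookup b j + card M"
        using am bm sum.remove[OF finite_M[OF M(1)] jM, of "lookup a"]
          sum.remove[OF finite_M[OF M(1)] jM, of "lookup b"] by linarith
      then show ?thesis using cardM[OF M(1)] by linarith
    qed (simp add: N_def)
    have "real (mdeg a) = (\<Sum>j \<in> X. real (lookup a j))" by (simp add: mdeg_superset[OF finite_X aX])
    also have "\<dots> \<le> (\<Sum>j \<in> X. real (lookup b j) + N)" by (rule sum_mono) (rule diff)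
    also have "\<dots> = real (mdeg b) + N * N"
      by (simp add: mdeg_superset[OF finite_X bX] sum.distrib N_def)
    finally show ?thesis using mb by linarith
  qed
  have bounds: "real (mdeg u) \<le> real_of_int (regularity X ?J) \<and>
      real_of_int (regularity X ?J) \<le> real m * coord_sum v + N * N"
    using finite_X sym_exps_up u(1) uX u(3) upper by (rule regularity_bounds)
  then show "real m * coord_sum v - N * N \<le> real_of_int (regularity X ?J)"
    using lower by linarith
  show "real_of_int (regularity X ?J) \<le> real m * coord_sum v + N * N" using bounds ..
qed

end

section \<open>Symbolic polyhedra of graph ideals\<close>

text \<open>With nonnegative coordinates the inequality of a cover follows from that of a minimal
  cover inside it. Arbitrary covers are easier to restrict, extend and combine than minimal
  ones.\<close>

lemma cov_poly_min_covers:
  assumes "finite X"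
  shows "a \<in> cov_poly X (min_covers X S) \<longleftrightarrow> keys a \<subseteq> X \<and> (\<forall>k \<in> X. 0 \<le> lookup a k) \<and>
    (\<forall>M. M \<subseteq> X \<longrightarrow> (\<forall>s \<in> S. s \<inter> M \<noteq> {}) \<longrightarrow> 1 \<le> (\<Sum>k \<in> M. lookup a k))"
proof -
  have "(\<forall>M \<in> min_covers X S. 1 \<le> (\<Sum>k \<in> M. lookup a k)) \<longleftrightarrow>
      (\<forall>M. M \<subseteq> X \<longrightarrow> (\<forall>s \<in> S. s \<inter> M \<noteq> {}) \<longrightarrow> 1 \<le> (\<Sum>k \<in> M. lookup a k))"
    if pos: "\<forall>k \<in> X. 0 \<le> lookup a k"
  proof (intro iffI allI impI ballI)
    fix M assume *: "\<forall>M \<in> min_covers X S. 1 \<le> (\<Sum>k \<in> M. lookup a k)"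
      and M: "M \<subseteq> X" "\<forall>s \<in> S. s \<inter> M \<noteq> {}"
    have fM: "finite M" using M(1) assms by (rule finite_subset)
    obtain M' where M': "M' \<in> min_covers X S" "M' \<subseteq> M"
      using min_cover_below[OF fM M(1), of S] M(2) by blast
    have "1 \<le> (\<Sum>k \<in> M'. lookup a k)" using * M'(1) by blast
    also have "\<dots> \<le> (\<Sum>k \<in> M. lookup a k)"
      using M(1) pos by (intro sum_mono2[OF fM M'(2)]) blast
    finally show "1 \<le> (\<Sum>k \<in> M. lookup a k)" .
  next
    fix M assume *: "\<forall>M. M \<subseteq> X \<longrightarrow> (\<forall>s \<in> S. s \<inter> M \<noteq> {}) \<longrightarrow> 1 \<le> (\<Sum>k \<in> M. lookup a k)"
      and "M \<in> min_covers X S"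
    then have "M \<subseteq> X" "\<forall>s \<in> S. s \<inter> M \<noteq> {}" by (simp_all add: min_covers_def)
    with * show "1 \<le> (\<Sum>k \<in> M. lookup a k)" by blast
  qed
  then show ?thesis unfolding cov_poly_def by blast
qed

text \<open>Traces of covers on \<open>Y\<close> are the covers of the members contained in \<open>Y\<close>, so a coordinate face
  of the polyhedron is the polyhedron of the restricted family.\<close>

lemma cov_poly_face:
  assumes X: "finite X" "Y \<subseteq> X" and S: "\<And>s. s \<in> S \<Longrightarrow> s \<subseteq> X"
  shows "{a \<in> cov_poly X (min_covers X S). keys a \<subseteq> Y} =
    cov_poly Y (min_covers Y {s \<in> S. s \<subseteq> Y})" (is "?L = ?R")
proof (intro equalityI subsetI)
  have fY: "finite Y" using X(2,1) by (rule finite_subset)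
  fix a assume "a \<in> ?L"
  then have aY: "keys a \<subseteq> Y" and aP: "a \<in> cov_poly X (min_covers X S)" by simp_all
  note aX = aP[unfolded cov_poly_min_covers[OF X(1)]]
  have "1 \<le> (\<Sum>k \<in> M. lookup a k)" if M: "M \<subseteq> Y" "\<forall>s \<in> {s \<in> S. s \<subseteq> Y}. s \<inter> M \<noteq> {}" for M
  proof -
    \<comment> \<open>A cover of the members inside \<open>Y\<close> becomes a cover of all of
      \<open>S\<close> when every index outside \<open>Y\<close> is added, and \<open>a\<close>
      vanishes at these indices.\<close>
    have "s \<inter> (M \<union> (X - Y)) \<noteq> {}" if s: "s \<in> S" for s
    proof (cases "s \<subseteq> Y")
      case True
      then have "s \<inter> M \<noteq> {}" using M(2) s by simp
      then show ?thesis by blast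
    next
      case False
      then show ?thesis using S[OF s] by blast
    qed
    moreover have "M \<union> (X - Y) \<subseteq> X" using M(1) X(2) by blast
    ultimately have "1 \<le> (\<Sum>k \<in> M \<union> (X - Y). lookup a k)" using aX by blast
    also have "\<dots> = (\<Sum>k \<in> M. lookup a k)"
      using finite_subset[OF M(1) fY] X(1) aY by (intro sum.mono_neutral_right) (auto simp: in_keys_iff)
    finally show ?thesis .
  qed
  moreover have "\<forall>k \<in> Y. 0 \<le> lookup a k" using aX X(2) by blast
  ultimately show "a \<in> ?R" unfolding cov_poly_min_covers[OF fY] using aY by blast
next
  have fY: "finite Y" using X(2,1) by (rule finite_subset)
  fix a assume a: "a \<in> ?R"
  note aR = a[unfolded cov_poly_min_covers[OF fY]]
  have aY: "keys a \<subseteq> Y" using aR by blast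
  have "1 \<le> (\<Sum>k \<in> M. lookup a k)" if M: "M \<subseteq> X" "\<forall>s \<in> S. s \<inter> M \<noteq> {}" for M
  proof -
    have "\<forall>s \<in> {s \<in> S. s \<subseteq> Y}. s \<inter> (M \<inter> Y) \<noteq> {}"
    proof
      fix s assume s: "s \<in> {s \<in> S. s \<subseteq> Y}"
      then have "s \<inter> M \<noteq> {}" using M(2) by simp
      then show "s \<inter> (M \<inter> Y) \<noteq> {}" using s by blast
    qed
    then have "1 \<le> (\<Sum>k \<in> M \<inter> Y. lookup a k)" using aR by blast
    also have "\<dots> = (\<Sum>k \<in> M. lookup a k)"
      using finite_subset[OF M(1) X(1)] aY by (intro sum.mono_neutral_left) (auto simp: in_keys_iff)
    finally show ?thesis .
  qed
  moreover have "0 \<le> lookup a k" for k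
  proof (cases "k \<in> Y")
    case False
    then have "k \<notin> keys a" using aY by blast
    then show ?thesis by (simp add: in_keys_iff)
  qed (use aR in blast)
  ultimately show "a \<in> ?L" using aY X(2) unfolding mem_Collect_eq cov_poly_min_covers[OF X(1)] by blast
qed

lemma covering_min_covers: "finite X \<Longrightarrow> covering X (min_covers X S)"
  by unfold_locales (auto simp: min_covers_def)

lemma coord_inclusion_id: "keys a \<subseteq> X \<Longrightarrow> coord_inclusion X a = a"
  by (intro poly_mapping_eqI) (auto simp: coord_inclusion_def lookup_mapp when_def in_keys_iff)

section \<open>Induced subgraphs and their variables\<close>

definition induced :: "nat pair_pre_digraph \<Rightarrow> nat set \<Rightarrow> nat pair_pre_digraph"
  where "induced G W = \<lparr>pverts = W, parcs = {e \<in> parcs G. fst e \<in> W \<and> snd e \<in> W}\<rparr>"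

lemma induced_simps [simp]:
  "pverts (induced G W) = W" "parcs (induced G W) = {e \<in> parcs G. fst e \<in> W \<and> snd e \<in> W}"
  by (simp_all add: induced_def)

definition vars :: "nat \<Rightarrow> nat set \<Rightarrow> nat set"
  where "vars n W = W \<union> (\<lambda>j. n + j) ` W"

lemma var_idx_eq: "var_idx n H = vars n (pverts H)"
  by (simp add: var_idx_def vars_def)

locale simple_graph =
  fixes n :: nat and G :: "nat pair_pre_digraph"
  assumes G: "pair_graph G" and verts_G: "pverts G = {1..n}"
begin

lemma arcs_G: "(i, j) \<in> parcs G \<Longrightarrow> i \<in> {1..n}" "(i, j) \<in> parcs G \<Longrightarrow> j \<in> {1..n}"
  "(i, j) \<in> parcs G \<Longrightarrow> i \<noteq> j"
proof -
  interpret pair_graph G by (rule G)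
  show "(i, j) \<in> parcs G \<Longrightarrow> i \<in> {1..n}" "(i, j) \<in> parcs G \<Longrightarrow> j \<in> {1..n}"
    using in_arcsD1 in_arcsD2 verts_G by blast+
  show "(i, j) \<in> parcs G \<Longrightarrow> i \<noteq> j" using no_loops' by blast
qed

lemma induced_V: "induced G {1..n} = G"
proof -
  have "parcs G = {e \<in> parcs G. fst e \<in> {1..n} \<and> snd e \<in> {1..n}}"
    using arcs_G by force
  then show ?thesis using verts_G by (intro pair_pre_digraph.equality) simp_all
qed

lemma conn_induced_iff:
  "H \<in> conn_induced_subgraphs G \<longleftrightarrow> (\<exists>W \<subseteq> {1..n}. H = induced G W \<and>
    Digraph_Component.connected (with_proj H) \<and> parcs H \<noteq> {})"
proof
  assume "H \<in> conn_induced_subgraphs G"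
  then have H: "induced_subgraph (with_proj H) (with_proj G)"
    "Digraph_Component.connected (with_proj H)" "parcs H \<noteq> {}"
    by (auto simp: conn_induced_subgraphs_def)
  then have "pverts H \<subseteq> {1..n}" "parcs H = {e \<in> parcs G. fst e \<in> pverts H \<and> snd e \<in> pverts H}"
    using verts_G by (auto simp: induced_subgraph_def subgraph_def)
  moreover from this(2) have "H = induced G (pverts H)"
    by (intro pair_pre_digraph.equality) simp_all
  ultimately show "\<exists>W \<subseteq> {1..n}. H = induced G W \<and>
      Digraph_Component.connected (with_proj H) \<and> parcs H \<noteq> {}"
    using H(2,3) by blast
next
  assume "\<exists>W \<subseteq> {1..n}. H = induced G W \<and> Digraph_Component.connected (with_proj H) \<and> parcs H \<noteq> {}"
  then obtain W where W: "W \<subseteq> {1..n}" "H = induced G W"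
    "Digraph_Component.connected (with_proj H)" "parcs H \<noteq> {}" by blast
  interpret pair_graph G by (rule G)
  have "wf_digraph (with_proj (induced G W))"
    by unfold_locales auto
  then have "induced_subgraph (with_proj H) (with_proj G)"
    using W(1) verts_G wf_digraph by (auto simp: W(2) induced_subgraph_def subgraph_def compatible_def)
  then show "H \<in> conn_induced_subgraphs G" using W(3,4) by (simp add: conn_induced_subgraphs_def)
qed

text \<open>One side of the partition is the set of vertices reachable from a suitable vertex.\<close>

lemma disconnected_partition:
  assumes "\<not> Digraph_Component.connected (with_proj (induced G W))" "W \<noteq> {}"
  obtains W1 W2 where "W = W1 \<union> W2" "W1 \<inter> W2 = {}" "W1 \<noteq> {}" "W2 \<noteq> {}"
    "\<And>i j. (i, j) \<in> parcs (induced G W) \<Longrightarrow> i \<in> W1 \<and> j \<in> W1 \<or> i \<in> W2 \<and> j \<in> W2"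
proof -
  define r where "r = parcs (mk_symmetric (with_proj (induced G W)))"
  have reach: "reachable (with_proj (mk_symmetric (with_proj (induced G W)))) u v \<longleftrightarrow> (u, v) \<in> rtrancl_on W r" for u v
    by (simp add: reachable_def r_def)
  obtain u v where uv: "u \<in> W" "v \<in> W" "(u, v) \<notin> rtrancl_on W r"
    using assms unfolding Digraph_Component.connected_def strongly_connected_def reach by auto
  define W1 where "W1 = {w \<in> W. (u, w) \<in> rtrancl_on W r}"
  show thesis
  proof (rule that[of W1 "W - W1"])
    show "W = W1 \<union> (W - W1)" "W1 \<inter> (W - W1) = {}" by (auto simp: W1_def)
    show "W1 \<noteq> {}" using uv(1) by (auto simp: W1_def)
    show "W - W1 \<noteq> {}" using uv(2,3) by (auto simp: W1_def)
    fix i j assume ij: "(i, j) \<in> parcs (induced G W)"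
    have W: "i \<in> W" "j \<in> W" using ij by simp_all
    have r: "(i, j) \<in> r" "(j, i) \<in> r" using ij unfolding r_def parcs_mk_symmetric by force+
    have "(u, i) \<in> rtrancl_on W r \<longleftrightarrow> (u, j) \<in> rtrancl_on W r"
      using rtrancl_on_into_rtrancl_on[OF _ r(1) W(2)] rtrancl_on_into_rtrancl_on[OF _ r(2) W(1)] by blast
    then show "i \<in> W1 \<and> j \<in> W1 \<or> i \<in> W - W1 \<and> j \<in> W - W1" using W by (simp add: W1_def)
  qed
qed

lemma vars_disjoint:
  assumes "W1 \<subseteq> {1..n}" "W2 \<subseteq> {1..n}" "W1 \<inter> W2 = {}"
  shows "vars n W1 \<inter> vars n W2 = {}"
proof -
  \<comment> \<open>An index up to \<open>n\<close> belongs to an x-variable, a larger one to a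
    y-variable; either way its vertex is recovered.\<close>
  have *: "(if k \<le> n then k else k - n) \<in> W" if "k \<in> vars n W" "W \<subseteq> {1..n}" for k W
    using that by (auto simp: vars_def)
  show ?thesis
  proof (rule equals0I)
    fix k assume "k \<in> vars n W1 \<inter> vars n W2"
    then have "(if k \<le> n then k else k - n) \<in> W1 \<inter> W2" using *[of k W1] *[of k W2] assms(1,2) by simp
    then show False unfolding assms(3) by simp
  qed
qed

lemma finite_vars: "W \<subseteq> {1..n} \<Longrightarrow> finite (vars n W)"
  unfolding vars_def using finite_subset[of W "{1..n}"] by simp

lemma vars_mono: "W \<subseteq> W' \<Longrightarrow> vars n W \<subseteq> vars n W'"
  by (auto simp: vars_def)

end

text \<open>What both families of ideals have in common, in terms of exponents of generators.
  \<open>split_B\<close> asks only for a smaller support, because \<open>B\<close> may consist of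
  all leading exponents, including those of products that mix the two parts.\<close>

locale graph_ideals = simple_graph +
  fixes B :: "nat pair_pre_digraph \<Rightarrow> (nat \<Rightarrow>\<^sub>0 nat) set"
  assumes keys_B: "W \<subseteq> {1..n} \<Longrightarrow> u \<in> B (induced G W) \<Longrightarrow> keys u \<subseteq> vars n W"
    and zero_B: "W \<subseteq> {1..n} \<Longrightarrow> 0 \<notin> B (induced G W)"
    and restrict_B: "W \<subseteq> {1..n} \<Longrightarrow>
      keys ` B (induced G W) = {s \<in> keys ` B G. s \<subseteq> vars n W}"
    and split_B: "\<lbrakk>W \<subseteq> {1..n}; W = W1 \<union> W2; W1 \<inter> W2 = {};
        \<And>i j. (i, j) \<in> parcs (induced G W) \<Longrightarrow> i \<in> W1 \<and> j \<in> W1 \<or> i \<in> W2 \<and> j \<in> W2;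
        s \<in> keys ` B (induced G W)\<rbrakk>
      \<Longrightarrow> \<exists>s' \<in> keys ` B (induced G W). s' \<subseteq> s \<and> (s' \<subseteq> vars n W1 \<or> s' \<subseteq> vars n W2)"
    and edges_B: "W \<subseteq> {1..n} \<Longrightarrow> B (induced G W) \<noteq> {} \<longleftrightarrow> parcs (induced G W) \<noteq> {}"
begin

definition SP :: "nat set \<Rightarrow> (nat \<Rightarrow>\<^sub>0 real) set"
  where "SP W = cov_poly (vars n W) (min_covers (vars n W) (keys ` B (induced G W)))"

lemma keys_BG: "u \<in> B G \<Longrightarrow> keys u \<subseteq> vars n {1..n}"
  using keys_B[OF subset_refl] unfolding induced_V .

lemma zero_BG: "0 \<notin> B G"
  using zero_B[OF subset_refl] unfolding induced_V .

lemma SP_face: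
  assumes W: "W \<subseteq> {1..n}"
  shows "SP W = {a \<in> SP {1..n}. keys a \<subseteq> vars n W}"
  unfolding SP_def induced_V restrict_B[OF W]
  by (rule cov_poly_face[symmetric, OF finite_vars[OF subset_refl] vars_mono[OF W]])
    (use keys_BG in blast)

lemma SP_nonneg: "a \<in> SP {1..n} \<Longrightarrow> 0 \<le> lookup a k"
  unfolding SP_def by (rule covering.P_nonneg[OF covering_min_covers[OF finite_vars[OF subset_refl]]])

lemma vertices_SP: "W \<subseteq> {1..n} \<Longrightarrow> vertices (SP W) = {a \<in> vertices (SP {1..n}). keys a \<subseteq> vars n W}"
  by (subst SP_face, assumption) (rule vertices_face, rule SP_nonneg)

text \<open>If the graph falls apart, covers can be combined along the parts, since every support
  contains one that lies in a single part. By \<open>vertex_not_split\<close> the vertex then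
  vanishes on one part, contrary to fullness.\<close>

lemma full_vertex_support_connected:
  assumes W: "W \<subseteq> {1..n}" and v: "v \<in> vertices (SP W)"
    and full: "\<And>j. j \<in> W \<Longrightarrow> lookup v j + lookup v (n + j) \<noteq> 0"
  shows "Digraph_Component.connected (with_proj (induced G W))" "parcs (induced G W) \<noteq> {}"
proof -
  let ?S = "keys ` B (induced G W)"
  interpret covering "vars n W" "min_covers (vars n W) ?S"
    by (rule covering_min_covers[OF finite_vars[OF W]])
  have vP: "v \<in> SP W" using v by (simp add: vertices_def extreme_point_of_def)
  have vX: "keys v \<subseteq> vars n W" using vP by (simp add: SP_def cov_poly_def)
  show edges: "parcs (induced G W) \<noteq> {}"
  proof
    assume "parcs (induced G W) = {}"
    \<comment> \<open>Without edges the empty set is a cover, and its inequality reads 1 <=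
      0.\<close>
    then have "?S = {}" using edges_B[OF W] by blast
    then have "1 \<le> (\<Sum>k \<in> {}. lookup v k)"
      using vP unfolding SP_def cov_poly_min_covers[OF finite_vars[OF W]] by blast
    then show False by simp
  qed
  show "Digraph_Component.connected (with_proj (induced G W))"
  proof (rule ccontr)
    assume disc: "\<not> Digraph_Component.connected (with_proj (induced G W))"
    have "W \<noteq> {}" using edges by auto
    then obtain W1 W2 where P: "W = W1 \<union> W2" "W1 \<inter> W2 = {}" "W1 \<noteq> {}" "W2 \<noteq> {}"
      "\<And>i j. (i, j) \<in> parcs (induced G W) \<Longrightarrow> i \<in> W1 \<and> j \<in> W1 \<or> i \<in> W2 \<and> j \<in> W2"
      by (rule disconnected_partition[OF disc]) blast
    have W12: "W1 \<subseteq> {1..n}" "W2 \<subseteq> {1..n}" using W P(1) by auto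
    have vars12: "vars n W = vars n W1 \<union> vars n W2" by (auto simp: vars_def P(1))
    have disj: "vars n W1 \<inter> vars n W2 = {}" by (rule vars_disjoint[OF W12 P(2)])
    have "keys v \<subseteq> vars n W1 \<or> keys v \<subseteq> vars n W2"
    proof (rule vertex_not_split[OF v[unfolded SP_def] _ disj])
      show "keys v \<subseteq> vars n W1 \<union> vars n W2" using vX vars12 by simp
      fix M1 M2 assume M: "M1 \<in> min_covers (vars n W) ?S" "M2 \<in> min_covers (vars n W) ?S"
      define M where "M = (M1 \<inter> vars n W1) \<union> (M2 \<inter> vars n W2)"
      have MX: "M \<subseteq> vars n W" unfolding M_def vars12 by blast
      have "s \<inter> M \<noteq> {}" if s: "s \<in> ?S" for s
      proof -
        obtain s' where s': "s' \<in> ?S" "s' \<subseteq> s" "s' \<subseteq> vars n W1 \<or> s' \<subseteq> vars n W2"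
          using split_B[OF W P(1,2) P(5) s] by blast
        have 1: "s' \<inter> M1 \<noteq> {}" using M(1) s'(1) unfolding min_covers_def by blast
        have 2: "s' \<inter> M2 \<noteq> {}" using M(2) s'(1) unfolding min_covers_def by blast
        from s'(3) show ?thesis
        proof
          assume "s' \<subseteq> vars n W1"
          then show ?thesis using 1 s'(2) unfolding M_def by blast
        next
          assume "s' \<subseteq> vars n W2"
          then show ?thesis using 2 s'(2) unfolding M_def by blast
        qed
      qed
      then obtain M' where "M' \<in> min_covers (vars n W) ?S" "M' \<subseteq> M"
        using min_cover_below[OF finite_subset[OF MX finite_vars[OF W]] MX] by blast
      then show "\<exists>M \<in> min_covers (vars n W) ?S. M \<inter> (vars n W1 \<union> vars n W2) \<subseteq>
          (M1 \<inter> vars n W1) \<union> (M2 \<inter> vars n W2)"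
        unfolding M_def by blast
    qed
    moreover have "\<not> keys v \<subseteq> vars n W'" if W': "W'' \<noteq> {}" "W'' \<subseteq> W" "vars n W' \<inter> vars n W'' = {}" for W' W''
    proof
      assume sub: "keys v \<subseteq> vars n W'"
      obtain j where j: "j \<in> W''" using W'(1) by blast
      have "j \<in> vars n W''" "n + j \<in> vars n W''" using j by (auto simp: vars_def)
      then have "j \<notin> keys v" "n + j \<notin> keys v" using sub W'(3) by blast+
      then show False using full[of j] j W'(2) by (auto simp: in_keys_iff)
    qed
    ultimately show False using P(1,3,4) disj by blast
  qed
qed

text \<open>A vertex is full for the subgraph induced on the indices \<open>j\<close> that it
  involves; conversely, vertices of coordinate faces are vertices.\<close>

lemma vertices_union:
  "vertices (SP {1..n}) = (\<Union>H \<in> conn_induced_subgraphs G.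
    {a \<in> vertices (SP (pverts H)). \<forall>j \<in> pverts H. lookup a j + lookup a (n + j) \<noteq> 0})"
proof (intro equalityI subsetI)
  fix v assume v: "v \<in> vertices (SP {1..n})"
  then have vP: "v \<in> SP {1..n}" by (simp add: vertices_def extreme_point_of_def)
  then have vX: "keys v \<subseteq> vars n {1..n}" by (simp add: SP_def cov_poly_def)
  define W where "W = {j \<in> {1..n}. lookup v j + lookup v (n + j) \<noteq> 0}"
  have W: "W \<subseteq> {1..n}" by (auto simp: W_def)
  have "keys v \<subseteq> vars n W"
  proof
    fix k assume k: "k \<in> keys v"
    then have pos: "0 < lookup v k" using SP_nonneg[OF vP, of k] by (simp add: in_keys_iff)
    have "k \<in> vars n {1..n}" using vX k by (rule subsetD)
    then obtain j where j: "j \<in> {1..n}" "k = j \<or> k = n + j" unfolding vars_def by blast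
    have "0 \<le> lookup v j" "0 \<le> lookup v (n + j)" by (rule SP_nonneg[OF vP])+
    then have "lookup v j + lookup v (n + j) \<noteq> 0" using pos j(2) by auto
    then show "k \<in> vars n W" using j by (auto simp: W_def vars_def)
  qed
  then have vW: "v \<in> vertices (SP W)" using v vertices_SP[OF W] by simp
  have full: "\<And>j. j \<in> W \<Longrightarrow> lookup v j + lookup v (n + j) \<noteq> 0" by (simp add: W_def)
  have "induced G W \<in> conn_induced_subgraphs G"
    unfolding conn_induced_iff using W full_vertex_support_connected[OF W vW full] by blast
  then show "v \<in> (\<Union>H \<in> conn_induced_subgraphs G.
      {a \<in> vertices (SP (pverts H)). \<forall>j \<in> pverts H. lookup a j + lookup a (n + j) \<noteq> 0})"
    using vW full by (intro UN_I[of "induced G W"]) simp_all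
next
  fix v assume "v \<in> (\<Union>H \<in> conn_induced_subgraphs G.
    {a \<in> vertices (SP (pverts H)). \<forall>j \<in> pverts H. lookup a j + lookup a (n + j) \<noteq> 0})"
  then obtain H where H: "H \<in> conn_induced_subgraphs G" "v \<in> vertices (SP (pverts H))" by blast
  then have "pverts H \<subseteq> {1..n}" unfolding conn_induced_iff by auto
  then show "v \<in> vertices (SP {1..n})" using H(2) vertices_SP by blast
qed

theorem vertices_and_asymptotics:
  fixes I :: "nat pair_pre_digraph \<Rightarrow> 'a::field mpoly set"
  assumes conn: "Digraph_Component.connected (with_proj G)" "parcs G \<noteq> {}"
    and I: "\<And>H. H \<in> conn_induced_subgraphs G \<Longrightarrow> I H = Idl\<^bsub>polyring (var_idx n H)\<^esub> (mon ` B H)"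
  shows "let U = (\<Union>H \<in> conn_induced_subgraphs G.
                    coord_inclusion (var_idx n H) ` full_vertices n H (I H))
         in vertices (symbolic_polyhedron (var_idx n G) (I G)) = U \<and>
            ((\<exists>v \<in> U. alpha_hat (var_idx n G) (I G) = coord_sum v) \<and>
             (\<forall>v \<in> U. alpha_hat (var_idx n G) (I G) \<le> coord_sum v)) \<and>
            ((\<exists>v \<in> U. reg_hat (var_idx n G) (I G) = coord_sum v) \<and>
             (\<forall>v \<in> U. coord_sum v \<le> reg_hat (var_idx n G) (I G)))"
proof -
  have GH: "G \<in> conn_induced_subgraphs G"
    unfolding conn_induced_iff using conn induced_V by (intro exI[of _ "{1..n}"]) simp
  have SP_eq: "symbolic_polyhedron (var_idx n H) (I H) = SP (pverts H)"
    if H: "H \<in> conn_induced_subgraphs G" for H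
  proof -
    obtain W where W: "W \<subseteq> {1..n}" "H = induced G W" using H unfolding conn_induced_iff by blast
    have "symbolic_polyhedron (vars n W) (I H) = cov_poly (vars n W) (min_covers (vars n W) (keys ` B H))"
      using I[OF H] W(2) keys_B[OF W(1)] zero_B[OF W(1)]
      by (intro symbolic_polyhedron_eq finite_vars[OF W(1)]) (simp_all add: var_idx_eq)
    then show ?thesis by (simp add: var_idx_eq SP_def W(2))
  qed
  have V: "pverts G = {1..n}" by (rule verts_G)
  define U where "U = (\<Union>H \<in> conn_induced_subgraphs G.
                    coord_inclusion (var_idx n H) ` full_vertices n H (I H))"
  have incl: "coord_inclusion (var_idx n H) ` full_vertices n H (I H) =
      {a \<in> vertices (SP (pverts H)). \<forall>j \<in> pverts H. lookup a j + lookup a (n + j) \<noteq> 0}"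
    if H: "H \<in> conn_induced_subgraphs G" for H
  proof -
    have "coord_inclusion (var_idx n H) a = a" if "a \<in> full_vertices n H (I H)" for a
    proof (rule coord_inclusion_id)
      have "a \<in> SP (pverts H)"
        using that by (simp add: full_vertices_def SP_eq[OF H] vertices_def extreme_point_of_def)
      then show "keys a \<subseteq> var_idx n H" by (simp add: SP_def cov_poly_def var_idx_eq)
    qed
    then have "coord_inclusion (var_idx n H) ` full_vertices n H (I H) = full_vertices n H (I H)"
      by (simp cong: image_cong)
    then show ?thesis by (simp add: full_vertices_def SP_eq[OF H])
  qed
  have U_eq: "U = vertices (SP {1..n})"
    unfolding U_def vertices_union by (rule SUP_cong[OF refl incl])
  let ?X = "vars n {1..n}" and ?S = "keys ` B G"
  have fX: "finite ?X" by (rule finite_vars[OF subset_refl])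
  interpret covering ?X "min_covers ?X ?S" by (rule covering_min_covers[OF fX])
  have SP_V: "SP {1..n} = cov_poly ?X (min_covers ?X ?S)" unfolding SP_def induced_V ..
  have U_P: "U = vertices P" unfolding U_eq SP_V ..
  have finU: "finite U" unfolding U_P by (rule finite_vertices)
  have "U \<noteq> {}"
  proof -
    \<comment> \<open>The all-ones vector lies in the polyhedron: some support exists, so every
      cover is nonempty. By \<open>vertex_below\<close> there is then a vertex.\<close>
    define a :: "nat \<Rightarrow>\<^sub>0 real" where "a = Poly_Mapping.mapp (\<lambda>_ _. 1) (\<Sum>k \<in> ?X. Poly_Mapping.single k (1::nat))"
    have la: "lookup a k = (if k \<in> ?X then 1 else 0)" for k
      using fX by (simp add: a_def lookup_mapp when_def in_keys_iff lookup_sum lookup_single)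
    have "1 \<le> (\<Sum>k \<in> M. lookup a k)" if M: "M \<in> min_covers ?X ?S" for M
    proof -
      have "?S \<noteq> {}" using edges_B[OF subset_refl] conn(2) unfolding induced_V by blast
      then obtain s where "s \<in> ?S" by blast
      then have "s \<inter> M \<noteq> {}" using M unfolding min_covers_def by blast
      then have "M \<noteq> {}" by blast
      have "M \<subseteq> ?X" using M unfolding min_covers_def by blast
      have "(\<Sum>k \<in> M. lookup a k) = real (card M)"
        using \<open>M \<subseteq> ?X\<close> by (simp add: la subset_iff)
      moreover have "1 \<le> card M" using \<open>M \<noteq> {}\<close> finite_subset[OF \<open>M \<subseteq> ?X\<close> fX] by (simp add: Suc_le_eq card_gt_0_iff)
      ultimately show ?thesis by simp
    qed
    moreover have "keys a \<subseteq> ?X" by (auto simp: in_keys_iff la split: if_splits)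
    ultimately have "a \<in> cov_poly ?X (min_covers ?X ?S)" by (simp add: cov_poly_def la)
    then show ?thesis using vertex_below unfolding U_eq SP_V by blast
  qed
  have sym: "symbolic_power (polyring ?X) (I G) m = monomial_ideal ?X (sym_exps (min_covers ?X ?S) m)" for m
  proof -
    have IG: "I G = Idl\<^bsub>polyring ?X\<^esub> (mon ` B G)" using I[OF GH] unfolding var_idx_eq V .
    show ?thesis unfolding IG by (rule symbolic_power_eq[OF fX _ zero_BG]) (rule keys_BG)
  qed
  obtain v where v: "v \<in> U" "\<And>w. w \<in> U \<Longrightarrow> coord_sum v \<le> coord_sum w"
  proof -
    have "Min (coord_sum ` U) \<in> coord_sum ` U" using finU \<open>U \<noteq> {}\<close> by (intro Min_in) auto
    then obtain v where "v \<in> U" "coord_sum v = Min (coord_sum ` U)" by auto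
    then show thesis using that[of v] finU by simp
  qed
  have alpha: "alpha_hat ?X (I G) = coord_sum v"
    unfolding alpha_hat_def sym
    by (rule limI, rule alpha_limit[OF v[unfolded U_P]])
  obtain w where w: "w \<in> U" "\<And>v. v \<in> U \<Longrightarrow> coord_sum v \<le> coord_sum w"
  proof -
    have "Max (coord_sum ` U) \<in> coord_sum ` U" using finU \<open>U \<noteq> {}\<close> by (intro Max_in) auto
    then obtain w where "w \<in> U" "coord_sum w = Max (coord_sum ` U)" by auto
    then show thesis using that[of w] finU by simp
  qed
  have reg: "reg_hat ?X (I G) = coord_sum w"
    unfolding reg_hat_def sym
    by (rule limI, rule regularity_limit[OF w[unfolded U_P]])
  have XG: "var_idx n G = ?X" by (simp add: var_idx_eq V)
  have "vertices (symbolic_polyhedron ?X (I G)) = U"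
    using SP_eq[OF GH] by (simp add: U_eq XG V)
  then show ?thesis
    unfolding Let_def U_def[symmetric] XG alpha reg using v w by blast
qed

end

section \<open>The multigraded generic initial ideal\<close>

definition path_exps :: "nat \<Rightarrow> nat pair_pre_digraph \<Rightarrow> (nat \<Rightarrow>\<^sub>0 nat) set"
  where "path_exps n H = {(\<Sum>v\<leftarrow>vs. unit_exp (n + v)) + unit_exp i + unit_exp j | i vs j.
    vpath (i # vs @ [j]) (with_proj H)}"

lemma prod_var: "(\<Prod>v\<leftarrow>vs. var (n + v)) = mon (\<Sum>v\<leftarrow>vs. unit_exp (n + v))"
  by (induction vs) (simp_all add: var_eq_mon mult_single)

lemma gin_eq: "gin n H = Idl\<^bsub>polyring (var_idx n H)\<^esub> (mon ` path_exps n H :: 'a::field mpoly set)"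
proof -
  have eq: "(\<Prod>v\<leftarrow>vs. var (n + v)) * var i * var j =
      (mon ((\<Sum>v\<leftarrow>vs. unit_exp (n + v)) + unit_exp i + unit_exp j) :: 'a mpoly)" for vs i j
    unfolding prod_var by (simp add: var_eq_mon mult_single)
  have "{(\<Prod>v\<leftarrow>vs. var (n + v)) * var i * var j | i vs j. vpath (i # vs @ [j]) (with_proj H)} =
      (mon ` path_exps n H :: 'a mpoly set)"
    unfolding path_exps_def eq by blast
  then show ?thesis by (simp add: gin_def)
qed

lemma keys_path_exp:
  "keys ((\<Sum>v\<leftarrow>vs. unit_exp (n + v)) + unit_exp i + unit_exp j) = {i, j} \<union> (\<lambda>v. n + v) ` set vs"
proof -
  have "keys (\<Sum>v\<leftarrow>vs. unit_exp (n + v)) = (\<lambda>v. n + v) ` set vs"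
    by (induction vs) (simp_all add: keys_add_nat)
  then show ?thesis by (auto simp: keys_add_nat)
qed

lemma vwalk_arcs_set: "set (vwalk_arcs p) \<subseteq> set p \<times> set p"
  by (induction p rule: vwalk_arcs.induct) auto

lemma vwalk_one_side:
  assumes "set (vwalk_arcs p) \<subseteq> E" "p \<noteq> []" "hd p \<in> W1"
    and "\<And>i j. (i, j) \<in> E \<Longrightarrow> i \<in> W1 \<Longrightarrow> j \<in> W1"
  shows "set p \<subseteq> W1"
  using assms(1-3)
proof (induction p rule: vwalk_arcs.induct)
  case (3 x y xs)
  have "(x, y) \<in> E" using "3.prems"(1) by simp
  then have "y \<in> W1" using assms(4) "3.prems"(3) by simp
  then have "set (y # xs) \<subseteq> W1" using "3.IH" "3.prems"(1) by simp
  then show ?case using "3.prems"(3) by simp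
qed simp_all

context simple_graph
begin

lemma vpath_induced:
  assumes "W \<subseteq> {1..n}"
  shows "vpath p (with_proj (induced G W)) \<longleftrightarrow> vpath p (with_proj G) \<and> set p \<subseteq> W"
proof -
  have "set (vwalk_arcs p) \<subseteq> parcs (induced G W) \<longleftrightarrow> set (vwalk_arcs p) \<subseteq> parcs G" if "set p \<subseteq> W"
    using vwalk_arcs_set[of p] that by fastforce
  then show ?thesis using assms verts_G unfolding vpath_def vwalk_def by auto
qed

lemma vars_subset_iff:
  assumes "W \<subseteq> {1..n}" "A \<subseteq> {1..n}" "A' \<subseteq> {1..n}"
  shows "A \<union> (\<lambda>v. n + v) ` A' \<subseteq> vars n W \<longleftrightarrow> A \<subseteq> W \<and> A' \<subseteq> W"
proof
  assume sub: "A \<union> (\<lambda>v. n + v) ` A' \<subseteq> vars n W"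
  have "k \<in> W" if "k \<in> A" for k
  proof -
    have "k \<in> vars n W" using sub that by blast
    moreover have "k \<le> n" using assms(2) that by auto
    ultimately show ?thesis using assms(1) by (auto simp: vars_def)
  qed
  moreover have "k \<in> W" if "k \<in> A'" for k
  proof -
    have "n + k \<in> vars n W" using sub that by blast
    moreover have "1 \<le> k" using assms(3) that by auto
    ultimately show ?thesis using assms(1) by (auto simp: vars_def)
  qed
  ultimately show "A \<subseteq> W \<and> A' \<subseteq> W" by blast
qed (auto simp: vars_def)

lemma path_exps_cases:
  assumes "W \<subseteq> {1..n}" "s \<in> keys ` path_exps n (induced G W)"
  obtains i vs j where "vpath (i # vs @ [j]) (with_proj (induced G W))"
    "s = {i, j} \<union> (\<lambda>v. n + v) ` set vs" "set (i # vs @ [j]) \<subseteq> W"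
proof -
  obtain u where u: "u \<in> path_exps n (induced G W)" "s = keys u" using assms(2) by blast
  then obtain i vs j where p: "vpath (i # vs @ [j]) (with_proj (induced G W))"
    "u = (\<Sum>v\<leftarrow>vs. unit_exp (n + v)) + unit_exp i + unit_exp j"
    unfolding path_exps_def by blast
  show thesis
    by (rule that[OF p(1)]) (use p(1) vpath_induced[OF assms(1)] in \<open>simp_all only: u(2) p(2) keys_path_exp\<close>)
qed

lemma path_exps_intro:
  assumes "vpath (i # vs @ [j]) (with_proj H)"
  shows "{i, j} \<union> (\<lambda>v. n + v) ` set vs \<in> keys ` path_exps n H"
proof -
  have "(\<Sum>v\<leftarrow>vs. unit_exp (n + v)) + unit_exp i + unit_exp j \<in> path_exps n H"
    using assms unfolding path_exps_def by blast
  then show ?thesis unfolding keys_path_exp[symmetric] by (rule imageI)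
qed

text \<open>The monomial of a path involves all its vertices, the ends by x and the inner ones by y.
  Hence its support lies over \<open>W\<close> exactly if the path stays in \<open>W\<close>, and a
  path cannot cross between parts that no edge joins.\<close>

lemma path_exps_graph_ideals: "graph_ideals n G (path_exps n)"
proof unfold_locales
  fix W u assume W: "W \<subseteq> {1..n}" and u: "u \<in> path_exps n (induced G W)"
  obtain i vs j where s: "keys u = {i, j} \<union> (\<lambda>v. n + v) ` set vs" "set (i # vs @ [j]) \<subseteq> W"
    using path_exps_cases[OF W imageI[OF u]] by metis
  then show "keys u \<subseteq> vars n W" by (auto simp: vars_def)
next
  fix W assume W: "W \<subseteq> {1..n}"
  show "0 \<notin> path_exps n (induced G W)"
  proof
    assume "0 \<in> path_exps n (induced G W)"
    then have "keys (0 :: nat \<Rightarrow>\<^sub>0 nat) \<in> keys ` path_exps n (induced G W)" by (rule imageI)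
    then show False by (rule path_exps_cases[OF W]) simp
  qed
  have VV: "{1..n} \<subseteq> {1..n}" by simp
  show "keys ` path_exps n (induced G W) = {s \<in> keys ` path_exps n G. s \<subseteq> vars n W}"
  proof (intro equalityI subsetI)
    fix s assume "s \<in> keys ` path_exps n (induced G W)"
    then obtain i vs j where p: "vpath (i # vs @ [j]) (with_proj (induced G W))"
      "s = {i, j} \<union> (\<lambda>v. n + v) ` set vs" "set (i # vs @ [j]) \<subseteq> W"
      by (rule path_exps_cases[OF W])
    then have "vpath (i # vs @ [j]) (with_proj G)" using vpath_induced[OF W] by blast
    then have "s \<in> keys ` path_exps n G" unfolding p(2) by (rule path_exps_intro)
    moreover have "s \<subseteq> vars n W" using p(2,3) by (auto simp: vars_def)
    ultimately show "s \<in> {s \<in> keys ` path_exps n G. s \<subseteq> vars n W}" by simp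
  next
    fix s assume s: "s \<in> {s \<in> keys ` path_exps n G. s \<subseteq> vars n W}"
    then have "s \<in> keys ` path_exps n (induced G {1..n})" by (simp only: induced_V mem_Collect_eq)
    then obtain i vs j where p: "vpath (i # vs @ [j]) (with_proj (induced G {1..n}))"
      "s = {i, j} \<union> (\<lambda>v. n + v) ` set vs" "set (i # vs @ [j]) \<subseteq> {1..n}"
      by (rule path_exps_cases[OF VV])
    have "{i, j} \<subseteq> W \<and> set vs \<subseteq> W"
      using s p(3) unfolding p(2) by (subst vars_subset_iff[OF W, symmetric]) auto
    then have "vpath (i # vs @ [j]) (with_proj (induced G W))"
      using p(1) unfolding vpath_induced[OF W] induced_V by simp
    then show "s \<in> keys ` path_exps n (induced G W)" unfolding p(2) by (rule path_exps_intro)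
  qed
  show "path_exps n (induced G W) \<noteq> {} \<longleftrightarrow> parcs (induced G W) \<noteq> {}"
  proof
    assume "path_exps n (induced G W) \<noteq> {}"
    then obtain i vs j where "vpath (i # vs @ [j]) (with_proj (induced G W))"
      unfolding path_exps_def by blast
    then have "set (vwalk_arcs (i # vs @ [j])) \<subseteq> parcs (induced G W)"
      unfolding vpath_def vwalk_def with_proj_simps by blast
    moreover have "vwalk_arcs (i # vs @ [j]) \<noteq> []" by (cases vs) simp_all
    ultimately show "parcs (induced G W) \<noteq> {}" by (metis empty_subsetI set_empty subset_antisym)
  next
    assume "parcs (induced G W) \<noteq> {}"
    then obtain i j where ij: "(i, j) \<in> parcs (induced G W)" by (metis ex_in_conv surj_pair)
    then have "vpath (i # [] @ [j]) (with_proj (induced G W))"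
      using arcs_G(3)[of i j] by (simp add: vpath_def vwalk_def)
    then show "path_exps n (induced G W) \<noteq> {}" unfolding path_exps_def by blast
  qed
  fix W1 W2 s
  assume P: "W = W1 \<union> W2" "W1 \<inter> W2 = {}"
    "\<And>i j. (i, j) \<in> parcs (induced G W) \<Longrightarrow> i \<in> W1 \<and> j \<in> W1 \<or> i \<in> W2 \<and> j \<in> W2"
    and s: "s \<in> keys ` path_exps n (induced G W)"
  obtain i vs j where p: "vpath (i # vs @ [j]) (with_proj (induced G W))"
    "s = {i, j} \<union> (\<lambda>v. n + v) ` set vs" "set (i # vs @ [j]) \<subseteq> W"
    using s by (rule path_exps_cases[OF W])
  have walk: "set (vwalk_arcs (i # vs @ [j])) \<subseteq> parcs (induced G W)"
    using p(1) unfolding vpath_def vwalk_def with_proj_simps by blast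
  have "set (i # vs @ [j]) \<subseteq> W'" if "i \<in> W'" "W' = W1 \<or> W' = W2" for W'
  proof (rule vwalk_one_side[OF walk])
    fix k l assume "(k, l) \<in> parcs (induced G W)" "k \<in> W'"
    then show "l \<in> W'" using P(2) P(3)[of k l] that(2) by blast
  qed (use that in simp_all)
  then have "set (i # vs @ [j]) \<subseteq> W1 \<or> set (i # vs @ [j]) \<subseteq> W2" using p(3) P(1) by auto
  then have "s \<subseteq> vars n W1 \<or> s \<subseteq> vars n W2" unfolding p(2) by (auto simp: vars_def)
  then show "\<exists>s' \<in> keys ` path_exps n (induced G W). s' \<subseteq> s \<and> (s' \<subseteq> vars n W1 \<or> s' \<subseteq> vars n W2)"
    using s by blast
qed

end

section \<open>The lexicographic initial ideal\<close>

lemma Idl_polyring: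
  fixes S :: "'a::field mpoly set"
  shows "S \<subseteq> Pol X \<Longrightarrow> ideal (Idl\<^bsub>polyring X\<^esub> S) (polyring X)"
    and "S \<subseteq> Pol X \<Longrightarrow> S \<subseteq> Idl\<^bsub>polyring X\<^esub> S"
    and "ideal K (polyring X) \<Longrightarrow> S \<subseteq> K \<Longrightarrow> Idl\<^bsub>polyring X\<^esub> S \<subseteq> K"
proof -
  note R = cring.axioms(1)[OF cring_polyring[of X, where 'a='a]]
  show "S \<subseteq> Pol X \<Longrightarrow> ideal (Idl\<^bsub>polyring X\<^esub> S) (polyring X)" by (rule ring.genideal_ideal[OF R])
  show "S \<subseteq> Pol X \<Longrightarrow> S \<subseteq> Idl\<^bsub>polyring X\<^esub> S" by (rule ring.genideal_self[OF R])
  show "ideal K (polyring X) \<Longrightarrow> S \<subseteq> K \<Longrightarrow> Idl\<^bsub>polyring X\<^esub> S \<subseteq> K" by (rule ring.genideal_minimal[OF R])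
qed

text \<open>All leading exponents of \<open>J\<close>, not those of a chosen set of generators,
  which makes the set monotone in \<open>J\<close>.\<close>

definition init_exps :: "'a::field mpoly set \<Rightarrow> (nat \<Rightarrow>\<^sub>0 nat) set"
  where "init_exps J = {Max (keys f) | f. f \<in> J \<and> f \<noteq> 0}"

lemma initial_ideal_eq:
  fixes J :: "'a::field mpoly set"
  shows "initial_ideal X J = Idl\<^bsub>polyring X\<^esub> (mon ` init_exps J)"
proof -
  have "{Poly_Mapping.single (Max (keys f)) 1 | f. f \<in> J \<and> f \<noteq> 0} = (mon ` init_exps J :: 'a mpoly set)"
    unfolding init_exps_def by blast
  then show ?thesis by (simp add: initial_ideal_def)
qed

lemma Max_keys: "f \<noteq> 0 \<Longrightarrow> Max (keys f) \<in> keys f" for f :: "'a::field mpoly"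
  by (rule Max_in) simp_all

text \<open>Scalars act as constant polynomials, so that bases and linear functionals become
  available.\<close>

lemma vector_space_mpoly:
  "Vector_Spaces.vector_space (\<lambda>c (p :: 'a::field mpoly). Poly_Mapping.single 0 c * p)"
  by unfold_locales
    (simp_all add: distrib_left distrib_right single_add mult.assoc[symmetric] mult_single)

text \<open>The linear functional is given by its values on monomials.  It exists because \<open>u\<close> does not lie in
  the sum of \<open>J\<close> and the span of the smaller monomials.\<close>

lemma separating_functional:
  fixes J :: "'a::field mpoly set"
  assumes J: "ideal J (polyring X)" and u: "\<And>f. f \<in> J \<Longrightarrow> f \<noteq> 0 \<Longrightarrow> Max (keys f) \<noteq> u"
  shows "\<exists>\<alpha> :: (nat \<Rightarrow>\<^sub>0 nat) \<Rightarrow> 'a. \<alpha> u = 1 \<and> (\<forall>m. m < u \<longrightarrow> \<alpha> m = 0) \<and>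
    (\<forall>f \<in> J. (\<Sum>m \<in> keys f. lookup f m * \<alpha> m) = 0)"
proof -
  let ?s = "\<lambda>c (p :: 'a mpoly). Poly_Mapping.single 0 c * p"
  interpret V: vector_space ?s by (rule vector_space_mpoly)
  interpret VK: vector_space_pair ?s "(*) :: 'a \<Rightarrow> 'a \<Rightarrow> 'a" ..
  note JD = ideal_polyringD[OF J]
  \<comment> \<open>Everything that the functional has to annihilate.\<close>
  define L where "L = {g + h | g h. g \<in> J \<and> keys h \<subseteq> {m. m < u}}"
  have sub: "V.subspace L"
  proof (rule V.subspaceI)
    have "0 + 0 \<in> L" unfolding L_def using JD(2) by (intro CollectI exI[of _ 0]) simp
    then show "0 \<in> L" by simp
  next
    fix x y assume "x \<in> L" "y \<in> L"
    then obtain g h g' h' where *: "x = g + h" "g \<in> J" "keys h \<subseteq> {m. m < u}"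
      "y = g' + h'" "g' \<in> J" "keys h' \<subseteq> {m. m < u}" unfolding L_def by blast
    have "keys (h + h') \<subseteq> {m. m < u}" using *(3,6) keys_add[of h h'] by blast
    moreover have "g + g' \<in> J" using JD(3) *(2,5) by blast
    moreover have "x + y = (g + g') + (h + h')" by (simp add: *(1,4))
    ultimately show "x + y \<in> L" unfolding L_def by blast
  next
    fix c x assume "x \<in> L"
    then obtain g h where *: "x = g + h" "g \<in> J" "keys h \<subseteq> {m. m < u}" unfolding L_def by blast
    have "keys (Poly_Mapping.single 0 c * h) \<subseteq> {m. m < u}"
      using *(3) keys_single_times_subset[of 0 c h] by auto
    moreover have "Poly_Mapping.single 0 c * g \<in> J" using JD(4)[of "Poly_Mapping.single 0 c" g] *(2) by simp
    moreover have "Poly_Mapping.single 0 c * x = Poly_Mapping.single 0 c * g + Poly_Mapping.single 0 c * h"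
      by (simp add: *(1) distrib_left)
    ultimately show "Poly_Mapping.single 0 c * x \<in> L" unfolding L_def by blast
  qed
  \<comment> \<open>Otherwise the summand in \<open>J\<close> would have leading exponent
    \<open>u\<close>.\<close>
  have uL: "mon u \<notin> L"
  proof
    assume "mon u \<in> L"
    then obtain g h where *: "mon u = g + h" "g \<in> J" "keys h \<subseteq> {m. m < u}" unfolding L_def by blast
    have lg: "lookup g m = (if m = u then 1 else 0) - lookup h m" for m
    proof -
      have "lookup g m + lookup h m = (if m = u then 1 else 0)"
        unfolding lookup_add[symmetric] *(1)[symmetric] by (auto simp: lookup_single when_def)
      then show ?thesis by (simp only: eq_diff_eq)
    qed
    have "u \<notin> keys h" using *(3) by blast
    then have "lookup g u = 1" by (simp add: lg in_keys_iff)
    then have gu: "u \<in> keys g" by (simp add: in_keys_iff)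
    have "m \<le> u" if m: "m \<in> keys g" for m
    proof (cases "m = u")
      case False
      then have "m \<in> keys h" using m by (simp add: in_keys_iff lg)
      then show ?thesis using *(3) by auto
    qed simp
    then have "Max (keys g) = u" using gu by (intro Max_eqI) simp_all
    moreover have "g \<noteq> 0" using gu by auto
    ultimately show False using u *(2) by blast
  qed
  \<comment> \<open>\<open>mon u\<close> is independent of a basis of \<open>L\<close>, so there is
    a functional with value 1 at \<open>mon u\<close> and 0 on \<open>L\<close>.\<close>
  obtain B where B: "B \<subseteq> L" "V.independent B" "L \<subseteq> V.span B" by (rule V.maximal_independent_subset)
  have "V.span B \<subseteq> L" using B(1) sub by (rule V.span_minimal)
  then have "mon u \<notin> V.span B" using uL by blast
  then have ind: "V.independent (insert (mon u) B)" using B(2) by (rule V.independent_insertI)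
  define g where "g = VK.construct (insert (mon u) B) (\<lambda>b. if b = mon u then 1 else 0)"
  have lin: "Vector_Spaces.linear ?s (*) g" unfolding g_def by (rule VK.linear_construct[OF ind])
  have gu: "g (mon u) = 1" unfolding g_def by (subst VK.construct_basis[OF ind]) simp_all
  have gB: "g b = 0" if b: "b \<in> B" for b
  proof -
    have "b \<noteq> mon u" using b B(1) uL by blast
    then show ?thesis unfolding g_def using b by (subst VK.construct_basis[OF ind]) simp_all
  qed
  have gL: "g p = 0" if "p \<in> L" for p
    by (rule VK.linear_eq_0_on_span[OF lin gB]) (use B(3) that in blast)+
  define \<alpha> where "\<alpha> = (\<lambda>m. g (mon m))"
  have g_eq: "g f = (\<Sum>m \<in> keys f. lookup f m * \<alpha> m)" for f
  proof -
    have single: "Poly_Mapping.single m c = Poly_Mapping.single 0 c * mon m" for m :: "nat \<Rightarrow>\<^sub>0 nat" and c :: 'a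
      by (simp add: mult_single)
    have "g f = g (\<Sum>m \<in> keys f. Poly_Mapping.single m (lookup f m))" using poly_eq_sum[of f] by simp
    also have "\<dots> = (\<Sum>m \<in> keys f. g (Poly_Mapping.single m (lookup f m)))"
      by (rule VK.linear_sum[OF lin])
    also have "\<dots> = (\<Sum>m \<in> keys f. lookup f m * \<alpha> m)"
    proof (rule sum.cong[OF refl])
      fix m
      show "g (Poly_Mapping.single m (lookup f m)) = lookup f m * \<alpha> m"
        unfolding \<alpha>_def by (subst single) (rule VK.linear_scale[OF lin])
    qed
    finally show ?thesis .
  qed
  show ?thesis
  proof (intro exI[of _ \<alpha>] conjI allI impI ballI)
    show "\<alpha> u = 1" by (simp add: \<alpha>_def gu)
    show "\<alpha> m = 0" if m: "m < u" for m
    proof -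
      have "0 + mon m \<in> L" unfolding L_def using JD(2) m by (intro CollectI exI[of _ 0] exI[of _ "mon m"]) simp
      then show ?thesis unfolding \<alpha>_def using gL by simp
    qed
    show "(\<Sum>m \<in> keys f. lookup f m * \<alpha> m) = 0" if f: "f \<in> J" for f
    proof -
      have "f + 0 \<in> L" unfolding L_def using f by (intro CollectI exI[of _ f] exI[of _ 0]) simp
      then show ?thesis unfolding g_eq[symmetric] using gL by simp
    qed
  qed
qed

section \<open>Leading exponents for ideals in disjoint sets of variables\<close>

definition exp_restr :: "nat set \<Rightarrow> (nat \<Rightarrow>\<^sub>0 nat) \<Rightarrow> nat \<Rightarrow>\<^sub>0 nat"
  where "exp_restr Y m = restr (\<lambda>k. k \<in> Y) m"

lemma lookup_exp_restr: "lookup (exp_restr Y m) k = (if k \<in> Y then lookup m k else 0)"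
  by (simp add: exp_restr_def lookup_restr)

lemma exp_restr_add: "exp_restr Y (m + m') = exp_restr Y m + exp_restr Y m'"
  by (simp add: exp_restr_def restr_add)

lemma exp_restr_le: "exp_le (exp_restr Y m) m"
  by (simp add: exp_le_def lookup_exp_restr)

lemma keys_exp_restr: "keys (exp_restr Y m) \<subseteq> Y"
  by (auto simp: exp_restr_def keys_restr)

lemma exp_restr_id: "keys m \<subseteq> Y \<Longrightarrow> exp_restr Y m = m"
  unfolding exp_restr_def by (rule restr_id) blast

lemma exp_restr_0: "keys m \<inter> Y = {} \<Longrightarrow> exp_restr Y m = 0"
  unfolding exp_restr_def by (rule restr_none) blast

lemma exp_restr_split:
  assumes "keys m \<subseteq> Y1 \<union> Y2" "Y1 \<inter> Y2 = {}"
  shows "exp_restr Y1 m + exp_restr Y2 m = m"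
proof (rule poly_mapping_eqI)
  fix k
  have "lookup m k = 0" if "k \<notin> Y1 \<union> Y2" using assms(1) that by (metis in_keys_iff subsetD)
  then show "lookup (exp_restr Y1 m + exp_restr Y2 m) k = lookup m k"
    using assms(2) by (auto simp: lookup_add lookup_exp_restr)
qed

text \<open>The product of functionals separating the two factors of \<open>u\<close> vanishes on the ideal generated
  by both ideals, so \<open>u\<close> is not an initial monomial of it.\<close>

lemma initial_exponent_split:
  fixes J J1 J2 :: "'a::field mpoly set"
  assumes Y: "X = Y1 \<union> Y2" "Y1 \<inter> Y2 = {}"
    and J1: "ideal J1 (polyring Y1)" and J2: "ideal J2 (polyring Y2)"
    and J: "J = Idl\<^bsub>polyring X\<^esub> S" "S \<subseteq> J1 \<union> J2"
    and f: "f \<in> J" "f \<noteq> 0"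
  shows "\<exists>w \<in> init_exps J1 \<union> init_exps J2. exp_le w (Max (keys f))"
proof (rule ccontr)
  assume none: "\<not> ?thesis"
  define u where "u = Max (keys f)"
  define p1 p2 where "p1 = exp_restr Y1" and "p2 = exp_restr Y2"
  have le: "exp_le (p1 u) u" "exp_le (p2 u) u" by (simp_all add: p1_def p2_def exp_restr_le)
  have none1: "Max (keys g) \<noteq> p1 u" if "g \<in> J1" "g \<noteq> 0" for g
  proof
    assume "Max (keys g) = p1 u"
    then have "p1 u \<in> init_exps J1" unfolding init_exps_def using that by (intro CollectI exI[of _ g]) simp
    then show False using none le(1) by (auto simp: u_def)
  qed
  obtain \<alpha> where "\<alpha> (p1 u) = 1 \<and> (\<forall>m. m < p1 u \<longrightarrow> \<alpha> m = 0) \<and>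
      (\<forall>f \<in> J1. (\<Sum>m \<in> keys f. lookup f m * \<alpha> m) = 0)"
    using separating_functional[OF J1 none1] ..
  then have \<alpha>: "\<alpha> (p1 u) = 1" "\<And>m. m < p1 u \<Longrightarrow> \<alpha> m = 0"
    "\<And>f. f \<in> J1 \<Longrightarrow> (\<Sum>m \<in> keys f. lookup f m * \<alpha> m) = 0" by simp_all
  have none2: "Max (keys g) \<noteq> p2 u" if "g \<in> J2" "g \<noteq> 0" for g
  proof
    assume "Max (keys g) = p2 u"
    then have "p2 u \<in> init_exps J2" unfolding init_exps_def using that by (intro CollectI exI[of _ g]) simp
    then show False using none le(2) by (auto simp: u_def)
  qed
  obtain \<beta> where "\<beta> (p2 u) = 1 \<and> (\<forall>m. m < p2 u \<longrightarrow> \<beta> m = 0) \<and>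
      (\<forall>f \<in> J2. (\<Sum>m \<in> keys f. lookup f m * \<beta> m) = 0)"
    using separating_functional[OF J2 none2] ..
  then have \<beta>: "\<beta> (p2 u) = 1" "\<And>m. m < p2 u \<Longrightarrow> \<beta> m = 0"
    "\<And>f. f \<in> J2 \<Longrightarrow> (\<Sum>m \<in> keys f. lookup f m * \<beta> m) = 0" by simp_all
  \<comment> \<open>The tensor product of the two functionals: each factor sees only its own set of
    variables.\<close>
  define \<Phi> where "\<Phi> = (\<lambda>f :: 'a mpoly. \<Sum>m \<in> keys f. lookup f m * (\<alpha> (p1 m) * \<beta> (p2 m)))"
  have \<Phi>_superset: "\<Phi> p = (\<Sum>m \<in> A. lookup p m * (\<alpha> (p1 m) * \<beta> (p2 m)))" if "finite A" "keys p \<subseteq> A" for p A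
    unfolding \<Phi>_def using that by (intro sum.mono_neutral_left) (auto simp: in_keys_iff)
  have \<Phi>_add: "\<Phi> (p + q) = \<Phi> p + \<Phi> q" for p q
  proof -
    have fin: "finite (keys p \<union> keys q)" by simp
    show ?thesis
      unfolding \<Phi>_superset[OF fin keys_add] \<Phi>_superset[OF fin Un_upper1] \<Phi>_superset[OF fin Un_upper2]
      by (simp add: lookup_add distrib_right sum.distrib)
  qed
  have \<Phi>_0: "\<Phi> 0 = 0" by (simp add: \<Phi>_def)
  have \<Phi>_mon: "\<Phi> (mon w * p) = (\<Sum>m \<in> keys p. lookup p m * (\<alpha> (p1 (w + m)) * \<beta> (p2 (w + m))))" for w p
    unfolding \<Phi>_def keys_mon_times
    by (subst sum.reindex) (simp_all add: lookup_single_times)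
  have \<Phi>_single: "\<Phi> (Poly_Mapping.single w c * p) = c * \<Phi> (mon w * p)" for w c p
  proof -
    have "\<Phi> (Poly_Mapping.single w c * p) =
        (\<Sum>m \<in> (+) w ` keys p. lookup (Poly_Mapping.single w c * p) m * (\<alpha> (p1 m) * \<beta> (p2 m)))"
      by (rule \<Phi>_superset) (simp_all add: keys_single_times_subset)
    also have "\<dots> = (\<Sum>m \<in> keys p. c * (lookup p m * (\<alpha> (p1 (w + m)) * \<beta> (p2 (w + m)))))"
      by (subst sum.reindex) (simp_all add: lookup_single_times mult.assoc)
    finally show ?thesis by (simp add: \<Phi>_mon sum_distrib_left)
  qed
  \<comment> \<open>The largest ideal on which \<open>\<Phi>\<close> vanishes, so that only the
    generators \<open>S\<close> have to be checked.\<close>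
  define K where "K = {p \<in> Pol X. \<forall>w. \<Phi> (mon w * p) = 0}"
  have "ideal K (polyring X)"
  proof (rule ideal_polyringI)
    show "K \<subseteq> Pol X" "0 \<in> K" by (auto simp: K_def \<Phi>_0)
    show "p + q \<in> K" if "p \<in> K" "q \<in> K" for p q
      using that by (simp add: K_def Pol_add distrib_left \<Phi>_add)
    show "q * p \<in> K" if q: "q \<in> Pol X" and p: "p \<in> K" for p q
    proof -
      have "\<Phi> (mon w * (q * p)) = 0" for w
      proof (induction q rule: poly_induct)
        case (single m c)
        have "mon w * (Poly_Mapping.single m c * p) = Poly_Mapping.single (w + m) c * p"
          by (simp add: mult.assoc[symmetric] mult_single)
        moreover have "\<Phi> (mon (w + m) * p) = 0" using p by (simp add: K_def)
        ultimately show ?case by (simp only: \<Phi>_single[of "w + m" c p] mult_zero_right)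
      qed (simp_all add: distrib_left distrib_right \<Phi>_add \<Phi>_0)
      then show ?thesis using q p by (simp add: K_def Pol_mult)
    qed
  qed
  moreover have "S \<subseteq> K"
  proof
    fix b assume b: "b \<in> S"
    have X: "Y1 \<subseteq> X" "Y2 \<subseteq> X" using Y(1) by auto
    from b J(2) consider "b \<in> J1" | "b \<in> J2" by blast
    then show "b \<in> K"
    proof cases
      case 1
      have bP: "b \<in> Pol Y1" using ideal_polyringD(1)[OF J1] 1 by blast
      have "\<Phi> (mon w * b) = 0" for w
      proof -
        have kb: "p1 m = m" "p2 m = 0" if "m \<in> keys b" for m
        proof -
          have "keys m \<subseteq> Y1" using PolD[OF bP that] .
          then show "p1 m = m" "p2 m = 0"
            unfolding p1_def p2_def using Y(2) by (intro exp_restr_id exp_restr_0; blast)+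
        qed
        \<comment> \<open>As \<open>b\<close> involves only the variables in \<open>Y1\<close>, the
          second functional sees only \<open>w\<close> and factors out. What remains is the first
          functional at a multiple of \<open>b\<close> in \<open>J1\<close>.\<close>
        have "\<Phi> (mon w * b) = (\<Sum>m \<in> keys b. lookup b m * \<alpha> (p1 w + m)) * \<beta> (p2 w)"
          unfolding \<Phi>_mon sum_distrib_right
          by (rule sum.cong) (simp_all add: p1_def[symmetric] p2_def[symmetric] exp_restr_add[of Y1, folded p1_def]
              exp_restr_add[of Y2, folded p2_def] kb mult.assoc)
        also have "(\<Sum>m \<in> keys b. lookup b m * \<alpha> (p1 w + m)) =
            (\<Sum>m \<in> keys (mon (p1 w) * b). lookup (mon (p1 w) * b) m * \<alpha> m)"
          unfolding keys_mon_times by (subst sum.reindex) (simp_all add: lookup_single_times)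
        also have "\<dots> = 0"
        proof (rule \<alpha>(3))
          have "mon (p1 w) \<in> Pol Y1" using keys_exp_restr by (simp add: p1_def)
          then show "mon (p1 w) * b \<in> J1" using 1 by (rule ideal_polyringD(4)[OF J1])
        qed
        finally show ?thesis by simp
      qed
      then show ?thesis using Pol_mono[OF X(1) bP] by (simp add: K_def)
    next
      case 2
      have bP: "b \<in> Pol Y2" using ideal_polyringD(1)[OF J2] 2 by blast
      have "\<Phi> (mon w * b) = 0" for w
      proof -
        have kb: "p2 m = m" "p1 m = 0" if "m \<in> keys b" for m
        proof -
          have "keys m \<subseteq> Y2" using PolD[OF bP that] .
          then show "p2 m = m" "p1 m = 0"
            unfolding p1_def p2_def using Y(2) by (intro exp_restr_id exp_restr_0; blast)+
        qed
        have "\<Phi> (mon w * b) = \<alpha> (p1 w) * (\<Sum>m \<in> keys b. lookup b m * \<beta> (p2 w + m))"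
          unfolding \<Phi>_mon sum_distrib_left
          by (rule sum.cong) (simp_all add: exp_restr_add[of Y1, folded p1_def]
              exp_restr_add[of Y2, folded p2_def] kb mult.left_commute)
        also have "(\<Sum>m \<in> keys b. lookup b m * \<beta> (p2 w + m)) =
            (\<Sum>m \<in> keys (mon (p2 w) * b). lookup (mon (p2 w) * b) m * \<beta> m)"
          unfolding keys_mon_times by (subst sum.reindex) (simp_all add: lookup_single_times)
        also have "\<dots> = 0"
        proof (rule \<beta>(3))
          have "mon (p2 w) \<in> Pol Y2" using keys_exp_restr by (simp add: p2_def)
          then show "mon (p2 w) * b \<in> J2" using 2 by (rule ideal_polyringD(4)[OF J2])
        qed
        finally show ?thesis by simp
      qed
      then show ?thesis using Pol_mono[OF X(2) bP] by (simp add: K_def)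
    qed
  qed
  ultimately have "J \<subseteq> K" unfolding J(1) by (rule Idl_polyring(3))
  then have "f \<in> K" using f(1) by (rule subsetD)
  then have fP: "f \<in> Pol X" and "\<Phi> (mon 0 * f) = 0" unfolding K_def by blast+
  then have \<Phi>f: "\<Phi> f = 0" by simp
  have uf: "u \<in> keys f" unfolding u_def using f(2) by (rule Max_keys)
  have "\<Phi> f = (\<Sum>m \<in> {u}. lookup f m * (\<alpha> (p1 m) * \<beta> (p2 m)))"
    unfolding \<Phi>_def
  proof (rule sum.mono_neutral_right)
    show "\<forall>m \<in> keys f - {u}. lookup f m * (\<alpha> (p1 m) * \<beta> (p2 m)) = 0"
    proof
      fix m assume m: "m \<in> keys f - {u}"
      have "m \<le> u" unfolding u_def using m by (intro Max_ge) simp_all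
      with m have mu: "m < u" by (simp add: less_le)
      have split: "p1 k + p2 k = k" if "k \<in> keys f" for k
        unfolding p1_def p2_def using PolD[OF fP that] Y by (intro exp_restr_split) auto
      \<comment> \<open>Addition is monotone for the order on exponents, so a smaller exponent is
        smaller in one of its two parts. Hence only the leading term of \<open>f\<close> survives,
        and \<open>\<Phi> f\<close> is its nonzero coefficient.\<close>
      have "p1 m < p1 u \<or> p2 m < p2 u"
      proof (rule ccontr)
        assume "\<not> ?thesis"
        then have "p1 u + p2 u \<le> p1 m + p2 m" by (intro add_mono) (simp_all add: not_less)
        then have "u \<le> m" using split[OF uf] split[of m] m by simp
        then show False using mu by (simp add: not_less[symmetric])
      qed
      then show "lookup f m * (\<alpha> (p1 m) * \<beta> (p2 m)) = 0" using \<alpha>(2) \<beta>(2) by auto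
    qed
  qed (use uf in simp_all)
  also have "\<dots> = lookup f u" by (simp add: \<alpha>(1) \<beta>(1))
  finally show False using \<Phi>f uf by (simp add: in_keys_iff)
qed

section \<open>Binomial edge ideals of induced subgraphs\<close>

definition edge_binomials :: "nat \<Rightarrow> nat pair_pre_digraph \<Rightarrow> 'a::field mpoly set"
  where "edge_binomials n H = {var i * var (n + j) - var j * var (n + i) | i j. (i, j) \<in> parcs H}"

lemma binomial_edge_ideal_eq:
  "binomial_edge_ideal n H = Idl\<^bsub>polyring (vars n (pverts H))\<^esub> (edge_binomials n H)"
  by (simp add: binomial_edge_ideal_def edge_binomials_def var_idx_eq)

lemma keys_edge_binomial:
  "keys (var i * var (n + j) - var j * var (n + i) :: 'a::field mpoly) \<subseteq>
    {unit_exp i + unit_exp (n + j), unit_exp j + unit_exp (n + i)}"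
  using keys_diff[of "var i * var (n + j) :: 'a mpoly" "var j * var (n + i)"]
  by (auto simp: var_eq_mon mult_single)

context simple_graph
begin

abbreviation J :: "nat set \<Rightarrow> 'a::field mpoly set" where "J W \<equiv> binomial_edge_ideal n (induced G W)"

lemma edge_binomials_Pol: "edge_binomials n (induced G W) \<subseteq> (Pol (vars n W) :: 'a::field mpoly set)"
proof
  fix b :: "'a mpoly" assume "b \<in> edge_binomials n (induced G W)"
  then obtain i j where b: "b = var i * var (n + j) - var j * var (n + i)"
      "(i, j) \<in> parcs (induced G W)"
    unfolding edge_binomials_def by blast
  have "i \<in> W" "j \<in> W" using b(2) by simp_all
  then have "{i, n + j, j, n + i} \<subseteq> vars n W" by (auto simp: vars_def)
  then have "keys m \<subseteq> vars n W" if "m \<in> keys b" for m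
    using keys_edge_binomial[of i n j, where 'a='a] that unfolding b(1)[symmetric] by (auto simp: keys_add_nat)
  then show "b \<in> Pol (vars n W)" by (simp add: in_Pol_iff)
qed

lemma J_eq: "J W = Idl\<^bsub>polyring (vars n W)\<^esub> (edge_binomials n (induced G W))"
  by (simp add: binomial_edge_ideal_eq)

lemma J_ideal: "ideal (J W :: 'a::field mpoly set) (polyring (vars n W))"
  unfolding J_eq by (rule Idl_polyring(1)[OF edge_binomials_Pol])

lemma J_gens: "edge_binomials n (induced G W) \<subseteq> (J W :: 'a::field mpoly set)"
  unfolding J_eq by (rule Idl_polyring(2)[OF edge_binomials_Pol])

lemma J_mono:
  assumes "W \<subseteq> W'"
  shows "(J W :: 'a::field mpoly set) \<subseteq> J W'"
proof -
  note D = ideal_polyringD[OF J_ideal[of W', where 'a='a]]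
  have "ideal (J W' \<inter> Pol (vars n W) :: 'a mpoly set) (polyring (vars n W))"
  proof (rule ideal_polyringI)
    fix p f :: "'a mpoly" assume p: "p \<in> Pol (vars n W)" and f: "f \<in> J W' \<inter> Pol (vars n W)"
    have "p \<in> Pol (vars n W')" by (rule Pol_mono[OF vars_mono[OF assms] p])
    then show "p * f \<in> J W' \<inter> Pol (vars n W)" using D(4)[of p f] p f by (simp add: Pol_mult)
  qed (use D(2,3) in \<open>auto simp: Pol_add\<close>)
  moreover have "edge_binomials n (induced G W) \<subseteq> (edge_binomials n (induced G W') :: 'a mpoly set)"
    unfolding edge_binomials_def using assms by auto
  then have "edge_binomials n (induced G W) \<subseteq> (J W' \<inter> Pol (vars n W) :: 'a mpoly set)"
    using J_gens[of W', where 'a='a] edge_binomials_Pol[of W, where 'a='a] by blast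
  ultimately have "J W \<subseteq> (J W' \<inter> Pol (vars n W) :: 'a mpoly set)" unfolding J_eq[of W] by (rule Idl_polyring(3))
  then show ?thesis by blast
qed

text \<open>Keeps 0 from being a leading exponent. The generators have no constant term, and the
  polynomials without constant term form an ideal.\<close>

lemma J_const: "f \<in> (J W :: 'a::field mpoly set) \<Longrightarrow> lookup f 0 = 0"
proof -
  have "ideal {f \<in> Pol (vars n W). lookup f 0 = (0 :: 'a)} (polyring (vars n W))"
    by (rule ideal_polyringI) (auto simp: Pol_add Pol_mult lookup_add lookup_times_0)
  moreover have "edge_binomials n (induced G W) \<subseteq> {f \<in> Pol (vars n W). lookup f 0 = (0 :: 'a)}"
  proof
    fix b :: "'a mpoly" assume b: "b \<in> edge_binomials n (induced G W)"
    have "unit_exp k \<noteq> 0" for k by (rule notI) (drule arg_cong[of _ _ keys], simp)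
    then have "lookup (var k :: 'a mpoly) 0 = 0" for k by (simp add: var_eq_mon lookup_single when_def)
    then have "lookup b 0 = 0"
      using b unfolding edge_binomials_def by (auto simp: lookup_minus lookup_times_0)
    then show "b \<in> {f \<in> Pol (vars n W). lookup f 0 = (0 :: 'a)}" using subsetD[OF edge_binomials_Pol b] by blast
  qed
  ultimately have "J W \<subseteq> {f \<in> Pol (vars n W). lookup f 0 = (0 :: 'a)}"
    unfolding J_eq by (rule Idl_polyring(3))
  then show "f \<in> J W \<Longrightarrow> lookup f 0 = 0" by blast
qed

text \<open>Setting the variables outside \<open>W\<close> to zero maps the ideal of the graph to that of the subgraph.\<close>

lemma J_retract:
  assumes W: "W \<subseteq> {1..n}" and f: "f \<in> (J {1..n} :: 'a::field mpoly set)"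
  shows "restr (\<lambda>m. keys m \<subseteq> vars n W) f \<in> J W"
proof -
  let ?r = "restr (\<lambda>m. keys m \<subseteq> vars n W) :: 'a mpoly \<Rightarrow> 'a mpoly"
  let ?X = "vars n {1..n}"
  note D = ideal_polyringD[OF J_ideal[of W, where 'a='a]]
  have times: "?r (p * q) = ?r p * ?r q" for p q :: "'a mpoly"
  proof -
    have "(\<lambda>m :: nat \<Rightarrow>\<^sub>0 nat. keys m \<subseteq> vars n W) = (\<lambda>m. keys m \<inter> (- vars n W) = {})" by auto
    then show ?thesis by (simp only: restr_avoiding_times)
  qed
  \<comment> \<open>The preimage of the smaller ideal under the retraction; it remains to see that
    it contains the edge binomials.\<close>
  have "ideal {f \<in> Pol ?X. ?r f \<in> J W} (polyring ?X)"
  proof (rule ideal_polyringI)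
    fix p f :: "'a mpoly" assume p: "p \<in> Pol ?X" and f: "f \<in> {f \<in> Pol ?X. ?r f \<in> J W}"
    have "?r p \<in> Pol (vars n W)" by (simp add: in_Pol_iff keys_restr)
    then have "?r p * ?r f \<in> J W" using f by (intro D(4)) simp_all
    then show "p * f \<in> {f \<in> Pol ?X. ?r f \<in> J W}" using p f by (simp add: times Pol_mult)
  qed (use D(2,3) in \<open>auto simp: Pol_add restr_add\<close>)
  moreover have "edge_binomials n (induced G {1..n}) \<subseteq> {f \<in> Pol ?X. ?r f \<in> J W}"
  proof
    fix b :: "'a mpoly" assume b: "b \<in> edge_binomials n (induced G {1..n})"
    then obtain i j where ij: "b = var i * var (n + j) - var j * var (n + i)" "(i, j) \<in> parcs G"
      unfolding edge_binomials_def by auto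
    have "?r b \<in> J W"
    proof (cases "i \<in> W \<and> j \<in> W")
      case True
      then have bW: "b \<in> edge_binomials n (induced G W)" unfolding edge_binomials_def using ij by auto
      then have "b \<in> Pol (vars n W)" using edge_binomials_Pol by blast
      then have "?r b = b" by (intro restr_id) (rule PolD)
      then show ?thesis using bW J_gens by auto
    next
      case False
      have *: "k \<in> vars n W \<longleftrightarrow> k \<in> W" "n + k \<in> vars n W \<longleftrightarrow> k \<in> W" if "k \<in> {1..n}" for k
        using W that by (auto simp: vars_def)
      have ijn: "i \<in> {1..n}" "j \<in> {1..n}" using arcs_G(1,2)[OF ij(2)] by auto
      \<comment> \<open>Both monomials of the binomial involve both vertices of the edge, so both
        are removed.\<close>
      have "\<not> keys m \<subseteq> vars n W" if m: "m \<in> keys b" for m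
      proof -
        have "keys m = {i, n + j} \<or> keys m = {j, n + i}"
          using keys_edge_binomial[of i n j, where 'a='a] m unfolding ij(1)[symmetric] by (auto simp: keys_add_nat)
        then show ?thesis using False *[OF ijn(1)] *[OF ijn(2)] by auto
      qed
      then have "?r b = 0" by (rule restr_none)
      then show ?thesis using D(2) by simp
    qed
    then show "b \<in> {f \<in> Pol ?X. ?r f \<in> J W}" using subsetD[OF edge_binomials_Pol b] by blast
  qed
  ultimately have "J {1..n} \<subseteq> {f \<in> Pol ?X. ?r f \<in> J W}" unfolding J_eq[of "{1..n}"] by (rule Idl_polyring(3))
  then show ?thesis using f by blast
qed

lemma init_exps_mono: "I \<subseteq> I' \<Longrightarrow> init_exps I \<subseteq> init_exps I'"
  unfolding init_exps_def by blast

lemma keys_init_exp: "u \<in> init_exps (J W :: 'a::field mpoly set) \<Longrightarrow> keys u \<subseteq> vars n W"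
proof -
  assume "u \<in> init_exps (J W :: 'a mpoly set)"
  then obtain f :: "'a mpoly" where f: "f \<in> J W" "f \<noteq> 0" "u = Max (keys f)" unfolding init_exps_def by blast
  have "f \<in> Pol (vars n W)" using ideal_polyringD(1)[OF J_ideal] f(1) by blast
  then show ?thesis unfolding f(3) using Max_keys[OF f(2)] by (rule PolD)
qed

text \<open>By \<open>J_retract\<close>, dropping the monomials that leave \<open>W\<close> maps the
  ideal into that of the subgraph, and a leading monomial over \<open>W\<close> stays leading. The
  splitting condition is \<open>initial_exponent_split\<close>, since each edge binomial belongs to
  one part.\<close>

lemma init_exps_graph_ideals:
  "graph_ideals n G (\<lambda>H. init_exps (binomial_edge_ideal n H :: 'a::field mpoly set))"
proof unfold_locales
  fix W assume W: "W \<subseteq> {1..n}"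
  let ?B = "\<lambda>W. init_exps (J W :: 'a mpoly set)"
  show "keys u \<subseteq> vars n W" if "u \<in> ?B W" for u using that by (rule keys_init_exp)
  show "0 \<notin> ?B W"
  proof
    assume "0 \<in> ?B W"
    then obtain f :: "'a mpoly" where f: "f \<in> J W" "f \<noteq> 0" "0 = Max (keys f)" unfolding init_exps_def by blast
    have "0 \<in> keys f" using Max_keys[OF f(2)] unfolding f(3)[symmetric] .
    then show False using J_const[OF f(1)] by (simp add: in_keys_iff)
  qed
  show "keys ` ?B W = {s \<in> keys ` init_exps (binomial_edge_ideal n G :: 'a mpoly set). s \<subseteq> vars n W}"
  proof (intro equalityI subsetI)
    fix s assume "s \<in> keys ` ?B W"
    then obtain u where u: "u \<in> ?B W" "s = keys u" by blast
    have "u \<in> ?B {1..n}" using init_exps_mono[OF J_mono[OF W]] u(1) by (rule subsetD)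
    then have "u \<in> init_exps (binomial_edge_ideal n G :: 'a mpoly set)" unfolding induced_V .
    then show "s \<in> {s \<in> keys ` init_exps (binomial_edge_ideal n G :: 'a mpoly set). s \<subseteq> vars n W}"
      using keys_init_exp[OF u(1)] u(2) by blast
  next
    fix s assume s: "s \<in> {s \<in> keys ` init_exps (binomial_edge_ideal n G :: 'a mpoly set). s \<subseteq> vars n W}"
    then obtain f :: "'a mpoly" where f: "f \<in> binomial_edge_ideal n G" "f \<noteq> 0" "s = keys (Max (keys f))"
      unfolding init_exps_def by blast
    let ?u = "Max (keys f)" and ?g = "restr (\<lambda>m. keys m \<subseteq> vars n W) f"
    have "f \<in> J {1..n}" unfolding induced_V by (rule f(1))
    then have gJ: "?g \<in> J W" by (rule J_retract[OF W])
    have "keys ?u \<subseteq> vars n W" using s f(3) by simp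
    then have ug: "?u \<in> keys ?g" using Max_keys[OF f(2)] by (simp add: keys_restr)
    have "Max (keys ?g) = ?u"
    proof (rule Max_eqI[OF finite_keys _ ug])
      fix m assume "m \<in> keys ?g"
      then have "m \<in> keys f" by (simp add: keys_restr)
      then show "m \<le> ?u" by (intro Max_ge) simp_all
    qed
    moreover have "?g \<noteq> 0" using ug by auto
    ultimately have "?u \<in> ?B W" unfolding init_exps_def using gJ by (intro CollectI exI[of _ ?g]) simp
    then show "s \<in> keys ` ?B W" unfolding f(3) by (rule imageI)
  qed
  show "?B W \<noteq> {} \<longleftrightarrow> parcs (induced G W) \<noteq> {}"
  proof
    assume ne: "?B W \<noteq> {}"
    show "parcs (induced G W) \<noteq> {}"
    proof
      assume "parcs (induced G W) = {}"
      then have "edge_binomials n (induced G W) \<subseteq> ({0} :: 'a mpoly set)" unfolding edge_binomials_def by blast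
      moreover have "ideal ({0} :: 'a mpoly set) (polyring (vars n W))" by (rule ideal_polyringI) simp_all
      ultimately have J0: "J W \<subseteq> ({0} :: 'a mpoly set)" unfolding J_eq by (intro Idl_polyring(3))
      from ne obtain u where "u \<in> ?B W" by (rule ex_in_conv[THEN iffD2, THEN exE])
      then obtain f :: "'a mpoly" where "f \<in> J W" "f \<noteq> 0" unfolding init_exps_def by (elim CollectE exE conjE)
      then show False using subsetD[OF J0, of f] by simp
    qed
  next
    assume "parcs (induced G W) \<noteq> {}"
    then obtain i j where ij: "(i, j) \<in> parcs (induced G W)" by fastforce
    let ?b = "var i * var (n + j) - var j * var (n + i) :: 'a mpoly"
    have ijG: "(i, j) \<in> parcs G" using ij by simp
    have bJ: "?b \<in> J W" using J_gens[of W, where 'a='a] ij unfolding edge_binomials_def by blast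
    have "unit_exp j + unit_exp (n + i) \<noteq> unit_exp i + unit_exp (n + j)"
    proof
      assume "unit_exp j + unit_exp (n + i) = unit_exp i + unit_exp (n + j)"
      then have "keys (unit_exp i + unit_exp (n + j)) = keys (unit_exp j + unit_exp (n + i))" by (simp only:)
      then have "{i, n + j} = {j, n + i}" by (simp add: keys_add_nat insert_commute)
      then have "i \<in> {j, n + i}" by (rule subst) (rule insertI1)
      then show False using arcs_G[OF ijG] by auto
    qed
    then have "lookup ?b (unit_exp i + unit_exp (n + j)) = 1"
      unfolding var_eq_mon mult_single lookup_minus lookup_single when_def by (simp only: if_True if_False) simp
    then have "?b \<noteq> 0" by (intro notI) (simp only: lookup_zero zero_neq_one)
    then show "?B W \<noteq> {}" unfolding init_exps_def using bJ by blast
  qed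
  fix W1 W2 s
  assume P: "W = W1 \<union> W2" "W1 \<inter> W2 = {}"
    "\<And>i j. (i, j) \<in> parcs (induced G W) \<Longrightarrow> i \<in> W1 \<and> j \<in> W1 \<or> i \<in> W2 \<and> j \<in> W2"
    and s: "s \<in> keys ` ?B W"
  obtain f :: "'a mpoly" where f: "f \<in> J W" "f \<noteq> 0" "s = keys (Max (keys f))"
    using s unfolding init_exps_def by blast
  have W12: "W1 \<subseteq> {1..n}" "W2 \<subseteq> {1..n}" "W1 \<subseteq> W" "W2 \<subseteq> W" using W P(1) by auto
  have "edge_binomials n (induced G W) \<subseteq> (J W1 \<union> J W2 :: 'a mpoly set)"
  proof
    fix b :: "'a mpoly" assume "b \<in> edge_binomials n (induced G W)"
    then obtain i j where ij: "b = var i * var (n + j) - var j * var (n + i)" "(i, j) \<in> parcs (induced G W)"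
      unfolding edge_binomials_def by blast
    have "b \<in> edge_binomials n (induced G W1) \<or> b \<in> edge_binomials n (induced G W2)"
      using P(3)[OF ij(2)] ij unfolding edge_binomials_def by auto
    then show "b \<in> J W1 \<union> J W2"
      using J_gens[of W1, where 'a='a] J_gens[of W2, where 'a='a] by blast
  qed
  moreover have "vars n W = vars n W1 \<union> vars n W2" by (auto simp: vars_def P(1))
  ultimately obtain w where w: "w \<in> ?B W1 \<union> ?B W2" "exp_le w (Max (keys f))"
    using initial_exponent_split[OF _ vars_disjoint[OF W12(1,2) P(2)] J_ideal J_ideal J_eq _ f(1,2)] by blast
  have "w \<in> ?B W" using w(1) init_exps_mono[OF J_mono[OF W12(3)]] init_exps_mono[OF J_mono[OF W12(4)]] by blast
  moreover have "keys w \<subseteq> s" unfolding f(3) by (rule exp_le_keys[OF w(2)])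
  moreover have "keys w \<subseteq> vars n W1 \<or> keys w \<subseteq> vars n W2" using w(1) keys_init_exp by blast
  ultimately show "\<exists>s' \<in> keys ` ?B W. s' \<subseteq> s \<and> (s' \<subseteq> vars n W1 \<or> s' \<subseteq> vars n W2)" by blast
qed

end

theorem theorem2:
  fixes n :: nat
    and G :: "nat pair_pre_digraph"
    and I :: "nat pair_pre_digraph \<Rightarrow> 'a::field mpoly set"
  assumes "pair_graph G"
    and "pverts G = {1..n}"
    and "Digraph_Component.connected (with_proj G)"
    and "parcs G \<noteq> {}"
    and "(\<forall>H \<in> conn_induced_subgraphs G. I H = gin n H) \<or>
         (\<forall>H \<in> conn_induced_subgraphs G.
            I H = initial_ideal (var_idx n H) (binomial_edge_ideal n H))"
  shows "let U = (\<Union>H \<in> conn_induced_subgraphs G.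
                    coord_inclusion (var_idx n H) ` full_vertices n H (I H))
         in vertices (symbolic_polyhedron (var_idx n G) (I G)) = U \<and>
            ((\<exists>v \<in> U. alpha_hat (var_idx n G) (I G) = coord_sum v) \<and>
             (\<forall>v \<in> U. alpha_hat (var_idx n G) (I G) \<le> coord_sum v)) \<and>
            ((\<exists>v \<in> U. reg_hat (var_idx n G) (I G) = coord_sum v) \<and>
             (\<forall>v \<in> U. coord_sum v \<le> reg_hat (var_idx n G) (I G)))"
proof -
  have sg: "simple_graph n G" using assms(1,2) by (rule simple_graph.intro)
  from assms(5) show ?thesis
  proof
    assume gin: "\<forall>H \<in> conn_induced_subgraphs G. I H = gin n H"
    show ?thesis
    proof (rule graph_ideals.vertices_and_asymptotics[OF simple_graph.path_exps_graph_ideals[OF sg] assms(3,4)])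
      fix H assume "H \<in> conn_induced_subgraphs G"
      then show "I H = Idl\<^bsub>polyring (var_idx n H)\<^esub> (mon ` path_exps n H)" using gin by (simp only: gin_eq)
    qed
  next
    assume ini: "\<forall>H \<in> conn_induced_subgraphs G.
      I H = initial_ideal (var_idx n H) (binomial_edge_ideal n H)"
    show ?thesis
    proof (rule graph_ideals.vertices_and_asymptotics[OF
          simple_graph.init_exps_graph_ideals[OF sg, where 'a='a] assms(3,4)])
      fix H assume "H \<in> conn_induced_subgraphs G"
      then show "I H = Idl\<^bsub>polyring (var_idx n H)\<^esub> (mon ` init_exps (binomial_edge_ideal n H :: 'a mpoly set))"
        using ini by (simp only: initial_ideal_eq)
    qed
  qed
qed

end
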